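(* Let $(K,J,g)$ be a compact Kähler manifold, let $\psi:K\to K$ be a Kähler isometry (a holomorphic diffeomorphism with $\psi^*g=g$), and let $M_f=(K\times\mathbb S^3)_f$ be the mapping torus of $f=(\psi,\mathrm{Id}_{\mathbb S^3})$, endowed with the SKT structure $(I,h)$ described in the context. If the Kähler metric $g$ on $(K,J)$ is Ricci-flat and non-flat, then the SKT metric $h$ on $(M_f,I)$ is CYT and its Bismut connection is non-flat.
   Context: The mapping torus $M_f$ is the quotient of $K\times\mathbb S^3\times\mathbb R$ by the $\mathbb Z$-action $n\cdot(p,q,t)=(\psi^n(p),q,t+n)$. The map $(p,q,t)\mapsto(p,2^tq)$ (with $\mathbb S^3\subset\mathbb C^2$ the unit sphere) induces a diffeomorphism of $M_f$ with the quotient of $K\times(\mathbb C^2\setminus\{(0,0)\})$ by the free and properly discontinuous $\mathbb Z$-action $n\cdot(p,x)=(\psi^n(p),2^nx)$. The SKT structure $(I,h)$ on $M_f$: $I$ is the complex structure induced on the quotient by the $\mathbb Z$-invariant product complex structure $J\times J_-$, where $J_-$ is the standard complex structure of $\mathbb C^2\setminus\{(0,0)\}$; $h$ is the metric induced on the quotient by the $\mathbb Z$-invariant product metric $g+\frac{1}{R^2}g_E$, where $g_E$ is the Euclidean metric of $\mathbb C^2$ and $R^2=z_1\overline z_1+z_2\overline z_2$ in the standard coordinates. For a Hermitian manifold $(M,J,g)$ of complex dimension $m$ with $\omega=g(J\cdot,\cdot)$: SKT means $dd^c\omega=0$, where $d^c\omega(X,Y,Z)=-d\omega(JX,JY,JZ)$.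 The Bismut connection $\nabla^B$ is the unique connection with $\nabla^Bg=0$, $\nabla^BJ=0$ and totally skew-symmetric torsion. With $R^B$ its curvature, the Bismut Ricci form is $\rho^B(X,Y)=\frac12\sum_{i=1}^{2m}g(R^B(X,Y)Je_i,e_i)$ for a local orthonormal frame $\{e_i\}$; the metric is CYT if $\rho^B=0$. The Bismut connection is flat if $R^B=0$. *)

theory Defs
  imports "HOL-Analysis.Analysis"
begin

section \<open>Smooth and holomorphic maps between open subsets of coordinate spaces\<close>

primrec Ck_on ::
  "nat \<Rightarrow> 'v::euclidean_space set \<Rightarrow> ('v \<Rightarrow> 'w::euclidean_space) \<Rightarrow> bool" where
  "Ck_on 0 S f \<longleftrightarrow> continuous_on S f"
| "Ck_on (Suc k) S f \<longleftrightarrow> (\<forall>x\<in>S. f differentiable (at x)) \<and>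
     (\<forall>v. Ck_on k S (\<lambda>x. frechet_derivative f (at x) v))"

text \<open>Only meant for open \<open>S\<close>.\<close>
definition smooth_on :: "'v::euclidean_space set \<Rightarrow> ('v \<Rightarrow> 'w::euclidean_space) \<Rightarrow> bool" where
  "smooth_on S f \<longleftrightarrow> (\<forall>k. Ck_on k S f)"

abbreviation imult :: "complex ^ 'n \<Rightarrow> complex ^ 'n::finite" where
  "imult v \<equiv> \<i> *s v"

text \<open>Smooth with complex linear derivative.\<close>
definition holo_on :: "(complex ^ 'm::finite) set \<Rightarrow> (complex ^ 'm \<Rightarrow> complex ^ 'n::finite) \<Rightarrow> bool"
  where
  "holo_on S f \<longleftrightarrow> smooth_on S f \<and>
     (\<forall>x\<in>S. \<forall>v. frechet_derivative f (at x) (imult v) = imult (frechet_derivative f (at x) v))"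


section \<open>Complex manifolds\<close>

text \<open>A chart is a pair of its domain and its coordinate map.  A complex structure is given by a
  holomorphic atlas; in every such chart the endomorphism \<open>J\<close> of the tangent bundle is
  multiplication by \<open>\<i>\<close>, that is \<^const>\<open>imult\<close>.\<close>

type_synonym ('a, 'n) chart = "'a set \<times> ('a \<Rightarrow> complex ^ 'n)"

record ('a, 'n) cmfd =
  mtop :: "'a topology"
  atlas :: "('a, 'n) chart set"

definition cmap_image :: "('a, 'n::finite) chart \<Rightarrow> (complex ^ 'n) set" where
  "cmap_image c = snd c ` fst c"

definition cmap_inv :: "('a, 'n::finite) chart \<Rightarrow> complex ^ 'n \<Rightarrow> 'a" where
  "cmap_inv c = inv_into (fst c) (snd c)"

definition second_countable_space :: "'a topology \<Rightarrow> bool" where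
  "second_countable_space X \<longleftrightarrow> (\<exists>\<B>. countable \<B> \<and> (\<forall>V\<in>\<B>. openin X V) \<and>
     (\<forall>U x. openin X U \<and> x \<in> U \<longrightarrow> (\<exists>V\<in>\<B>. x \<in> V \<and> V \<subseteq> U)))"

definition complex_manifold :: "('a, 'n::finite) cmfd \<Rightarrow> bool" where
  "complex_manifold M \<longleftrightarrow>
     Hausdorff_space (mtop M) \<and> second_countable_space (mtop M) \<and>
     (\<Union>c\<in>atlas M. fst c) = topspace (mtop M) \<and>
     (\<forall>c\<in>atlas M. openin (mtop M) (fst c) \<and> open (cmap_image c) \<and>
        homeomorphic_map (subtopology (mtop M) (fst c)) (top_of_set (cmap_image c)) (snd c)) \<and>
     (\<forall>c\<in>atlas M. \<forall>d\<in>atlas M. holo_on (snd c ` (fst c \<inter> fst d)) (snd d \<circ> cmap_inv c))"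

definition holomorphic_map ::
  "('a, 'm::finite) cmfd \<Rightarrow> ('b, 'n::finite) cmfd \<Rightarrow> ('a \<Rightarrow> 'b) \<Rightarrow> bool" where
  "holomorphic_map M N F \<longleftrightarrow> continuous_map (mtop M) (mtop N) F \<and>
     (\<forall>c\<in>atlas M. \<forall>d\<in>atlas N.
        holo_on (snd c ` {p \<in> fst c. F p \<in> fst d}) (snd d \<circ> F \<circ> cmap_inv c))"

definition biholomorphic_map ::
  "('a, 'm::finite) cmfd \<Rightarrow> ('b, 'n::finite) cmfd \<Rightarrow> ('a \<Rightarrow> 'b) \<Rightarrow> bool" where
  "biholomorphic_map M N F \<longleftrightarrow> bij_betw F (topspace (mtop M)) (topspace (mtop N)) \<and>
     holomorphic_map M N F \<and> holomorphic_map N M (inv_into (topspace (mtop M)) F)"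


section \<open>Tangent vectors and covariant 2-tensors\<close>

text \<open>The tangent space at a point \<open>p\<close> is identified with the coordinate space through one chart
  \<open>chart_at M p\<close> around \<open>p\<close>, chosen once and for all.  A field of bilinear forms is then a function
  of a point and two coordinate vectors; its expression in an arbitrary chart is \<open>coord_form\<close>.\<close>

definition chart_at :: "('a, 'n::finite) cmfd \<Rightarrow> 'a \<Rightarrow> ('a, 'n) chart" where
  "chart_at M p = (SOME c. c \<in> atlas M \<and> p \<in> fst c)"

definition differential ::
  "('a, 'm::finite) cmfd \<Rightarrow> ('b, 'n::finite) cmfd \<Rightarrow> ('a \<Rightarrow> 'b) \<Rightarrow> 'a \<Rightarrow>
     complex ^ 'm \<Rightarrow> complex ^ 'n" where
  "differential M N F p =
     frechet_derivative (snd (chart_at N (F p)) \<circ> F \<circ> cmap_inv (chart_at M p))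
       (at (snd (chart_at M p) p))"

type_synonym ('a, 'n) bilin_field = "'a \<Rightarrow> complex ^ 'n \<Rightarrow> complex ^ 'n \<Rightarrow> real"

definition pullback ::
  "('a, 'm::finite) cmfd \<Rightarrow> ('b, 'n::finite) cmfd \<Rightarrow> ('a \<Rightarrow> 'b) \<Rightarrow>
     ('b, 'n) bilin_field \<Rightarrow> ('a, 'm) bilin_field" where
  "pullback M N F h p u v = h (F p) (differential M N F p u) (differential M N F p v)"

definition coord_form ::
  "('a, 'n::finite) cmfd \<Rightarrow> ('a, 'n) bilin_field \<Rightarrow> ('a, 'n) chart \<Rightarrow>
     complex ^ 'n \<Rightarrow> complex ^ 'n \<Rightarrow> complex ^ 'n \<Rightarrow> real" where
  "coord_form M g c x u v =
     (let p = cmap_inv c x; A = frechet_derivative (snd (chart_at M p) \<circ> cmap_inv c) (at x)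
      in g p (A u) (A v))"


section \<open>Hermitian, Kaehler and SKT metrics\<close>

definition hermitian_metric :: "('a, 'n::finite) cmfd \<Rightarrow> ('a, 'n) bilin_field \<Rightarrow> bool" where
  "hermitian_metric M g \<longleftrightarrow>
     (\<forall>p\<in>topspace (mtop M). bilinear (g p) \<and> (\<forall>u v. g p u v = g p v u) \<and>
        (\<forall>u. u \<noteq> 0 \<longrightarrow> g p u u > 0) \<and> (\<forall>u v. g p (imult u) (imult v) = g p u v)) \<and>
     (\<forall>c\<in>atlas M. \<forall>u v. smooth_on (cmap_image c) (\<lambda>x. coord_form M g c x u v))"

definition hermitian_manifold :: "('a, 'n::finite) cmfd \<Rightarrow> ('a, 'n) bilin_field \<Rightarrow> bool" where
  "hermitian_manifold M g \<longleftrightarrow> complex_manifold M \<and> hermitian_metric M g"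

definition fundamental_form ::
  "('a, 'n::finite) cmfd \<Rightarrow> ('a, 'n) bilin_field \<Rightarrow> ('a, 'n) chart \<Rightarrow>
     complex ^ 'n \<Rightarrow> complex ^ 'n \<Rightarrow> complex ^ 'n \<Rightarrow> real" where
  "fundamental_form M g c x u v = coord_form M g c x (imult u) v"

text \<open>Exterior derivatives of 2-forms and 3-forms given on an open set of a coordinate space,
  without numerical prefactors.\<close>

definition ext_d2 ::
  "('v \<Rightarrow> 'v \<Rightarrow> 'v \<Rightarrow> real) \<Rightarrow> 'v::euclidean_space \<Rightarrow> 'v \<Rightarrow> 'v \<Rightarrow> 'v \<Rightarrow> real" where
  "ext_d2 \<alpha> x u v w =
     frechet_derivative (\<lambda>y. \<alpha> y v w) (at x) u
     - frechet_derivative (\<lambda>y. \<alpha> y u w) (at x) v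
     + frechet_derivative (\<lambda>y. \<alpha> y u v) (at x) w"

definition ext_d3 ::
  "('v \<Rightarrow> 'v \<Rightarrow> 'v \<Rightarrow> 'v \<Rightarrow> real) \<Rightarrow> 'v::euclidean_space \<Rightarrow> 'v \<Rightarrow> 'v \<Rightarrow> 'v \<Rightarrow> 'v \<Rightarrow> real" where
  "ext_d3 \<beta> x a u v w =
     frechet_derivative (\<lambda>y. \<beta> y u v w) (at x) a
     - frechet_derivative (\<lambda>y. \<beta> y a v w) (at x) u
     + frechet_derivative (\<lambda>y. \<beta> y a u w) (at x) v
     - frechet_derivative (\<lambda>y. \<beta> y a u v) (at x) w"

definition dc_fundamental_form ::
  "('a, 'n::finite) cmfd \<Rightarrow> ('a, 'n) bilin_field \<Rightarrow> ('a, 'n) chart \<Rightarrow>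
     complex ^ 'n \<Rightarrow> complex ^ 'n \<Rightarrow> complex ^ 'n \<Rightarrow> complex ^ 'n \<Rightarrow> real" where
  "dc_fundamental_form M g c x u v w =
     - ext_d2 (fundamental_form M g c) x (imult u) (imult v) (imult w)"

definition kaehler_manifold :: "('a, 'n::finite) cmfd \<Rightarrow> ('a, 'n) bilin_field \<Rightarrow> bool" where
  "kaehler_manifold M g \<longleftrightarrow> hermitian_manifold M g \<and>
     (\<forall>c\<in>atlas M. \<forall>x\<in>cmap_image c. \<forall>u v w. ext_d2 (fundamental_form M g c) x u v w = 0)"

definition skt_manifold :: "('a, 'n::finite) cmfd \<Rightarrow> ('a, 'n) bilin_field \<Rightarrow> bool" where
  "skt_manifold M g \<longleftrightarrow> hermitian_manifold M g \<and>
     (\<forall>c\<in>atlas M. \<forall>x\<in>cmap_image c. \<forall>a u v w. ext_d3 (dc_fundamental_form M g c) x a u v w = 0)"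

definition kaehler_isometry ::
  "('a, 'n::finite) cmfd \<Rightarrow> ('a, 'n) bilin_field \<Rightarrow> ('a \<Rightarrow> 'a) \<Rightarrow> bool" where
  "kaehler_isometry M g \<psi> \<longleftrightarrow> biholomorphic_map M M \<psi> \<and>
     (\<forall>p\<in>topspace (mtop M). \<forall>u v. pullback M M \<psi> g p u v = g p u v)"


section \<open>Connections on the tangent bundle\<close>

text \<open>A connection is given by its Christoffel symbols, one smooth field of bilinear maps for each
  chart, subject to the inhomogeneous transformation law: if \<open>\<tau>\<close> is the change of coordinates from
  the chart \<open>c\<close> to the chart \<open>d\<close>, then
  \<open>D\<tau> (\<Gamma>\<^sub>c (u, v)) = D\<^sup>2\<tau> (u, v) + \<Gamma>\<^sub>d (D\<tau> u, D\<tau> v)\<close>.\<close>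

type_synonym ('a, 'n) christoffel =
  "('a, 'n) chart \<Rightarrow> complex ^ 'n \<Rightarrow> complex ^ 'n \<Rightarrow> complex ^ 'n \<Rightarrow> complex ^ 'n"

definition affine_connection :: "('a, 'n::finite) cmfd \<Rightarrow> ('a, 'n) christoffel \<Rightarrow> bool" where
  "affine_connection M \<Gamma> \<longleftrightarrow>
     (\<forall>c\<in>atlas M. (\<forall>x\<in>cmap_image c. bilinear (\<Gamma> c x)) \<and>
        (\<forall>u v. smooth_on (cmap_image c) (\<lambda>x. \<Gamma> c x u v))) \<and>
     (\<forall>c\<in>atlas M. \<forall>d\<in>atlas M. \<forall>x \<in> snd c ` (fst c \<inter> fst d). \<forall>u v.
        (let \<tau> = snd d \<circ> cmap_inv c; D = (\<lambda>y. frechet_derivative \<tau> (at y))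
         in D x (\<Gamma> c x u v) =
              frechet_derivative (\<lambda>y. D y v) (at x) u + \<Gamma> d (\<tau> x) (D x u) (D x v)))"

text \<open>Covariant derivative \<open>\<nabla>\<^sub>X Y\<close> of vector fields on a coordinate domain.\<close>
definition cov_deriv ::
  "('a, 'n::finite) christoffel \<Rightarrow> ('a, 'n) chart \<Rightarrow> (complex ^ 'n \<Rightarrow> complex ^ 'n) \<Rightarrow>
     (complex ^ 'n \<Rightarrow> complex ^ 'n) \<Rightarrow> complex ^ 'n \<Rightarrow> complex ^ 'n" where
  "cov_deriv \<Gamma> c X Y x = frechet_derivative Y (at x) (X x) + \<Gamma> c x (X x) (Y x)"

text \<open>The remaining notions are tensorial, so they are evaluated on constant coordinate vector
  fields.  These commute, so the Lie bracket terms in torsion and curvature vanish: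
  \<open>T(X, Y) = \<nabla>\<^sub>X Y - \<nabla>\<^sub>Y X - [X, Y]\<close> and
  \<open>R(X, Y) Z = \<nabla>\<^sub>X (\<nabla>\<^sub>Y Z) - \<nabla>\<^sub>Y (\<nabla>\<^sub>X Z) - \<nabla>\<^sub>[\<^sub>X\<^sub>,\<^sub>Y\<^sub>] Z\<close>.\<close>

definition torsion ::
  "('a, 'n::finite) christoffel \<Rightarrow> ('a, 'n) chart \<Rightarrow>
     complex ^ 'n \<Rightarrow> complex ^ 'n \<Rightarrow> complex ^ 'n \<Rightarrow> complex ^ 'n" where
  "torsion \<Gamma> c x u v = cov_deriv \<Gamma> c (\<lambda>_. u) (\<lambda>_. v) x - cov_deriv \<Gamma> c (\<lambda>_. v) (\<lambda>_. u) x"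

definition curvature ::
  "('a, 'n::finite) christoffel \<Rightarrow> ('a, 'n) chart \<Rightarrow>
     complex ^ 'n \<Rightarrow> complex ^ 'n \<Rightarrow> complex ^ 'n \<Rightarrow> complex ^ 'n \<Rightarrow> complex ^ 'n" where
  "curvature \<Gamma> c x u v w =
     cov_deriv \<Gamma> c (\<lambda>_. u) (cov_deriv \<Gamma> c (\<lambda>_. v) (\<lambda>_. w)) x
     - cov_deriv \<Gamma> c (\<lambda>_. v) (cov_deriv \<Gamma> c (\<lambda>_. u) (\<lambda>_. w)) x"

definition flat_connection :: "('a, 'n::finite) cmfd \<Rightarrow> ('a, 'n) christoffel \<Rightarrow> bool" where
  "flat_connection M \<Gamma> \<longleftrightarrow>
     (\<forall>c\<in>atlas M. \<forall>x\<in>cmap_image c. \<forall>u v w. curvature \<Gamma> c x u v w = 0)"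

text \<open>\<open>\<nabla>g = 0\<close>\<close>
definition metric_connection ::
  "('a, 'n::finite) cmfd \<Rightarrow> ('a, 'n) bilin_field \<Rightarrow> ('a, 'n) christoffel \<Rightarrow> bool" where
  "metric_connection M g \<Gamma> \<longleftrightarrow>
     (\<forall>c\<in>atlas M. \<forall>x\<in>cmap_image c. \<forall>u v w.
        frechet_derivative (\<lambda>y. coord_form M g c y v w) (at x) u =
          coord_form M g c x (cov_deriv \<Gamma> c (\<lambda>_. u) (\<lambda>_. v) x) w +
          coord_form M g c x v (cov_deriv \<Gamma> c (\<lambda>_. u) (\<lambda>_. w) x))"

text \<open>\<open>\<nabla>J = 0\<close>\<close>
definition complex_connection :: "('a, 'n::finite) cmfd \<Rightarrow> ('a, 'n) christoffel \<Rightarrow> bool" where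
  "complex_connection M \<Gamma> \<longleftrightarrow>
     (\<forall>c\<in>atlas M. \<forall>x\<in>cmap_image c. \<forall>u v.
        cov_deriv \<Gamma> c (\<lambda>_. u) (\<lambda>_. imult v) x = imult (cov_deriv \<Gamma> c (\<lambda>_. u) (\<lambda>_. v) x))"

text \<open>Total skew-symmetry of \<open>g(T(X, Y), Z)\<close>; skew-symmetry in \<open>X\<close> and \<open>Y\<close> is automatic.\<close>
definition skew_torsion ::
  "('a, 'n::finite) cmfd \<Rightarrow> ('a, 'n) bilin_field \<Rightarrow> ('a, 'n) christoffel \<Rightarrow> bool" where
  "skew_torsion M g \<Gamma> \<longleftrightarrow>
     (\<forall>c\<in>atlas M. \<forall>x\<in>cmap_image c. \<forall>u v w.
        coord_form M g c x (torsion \<Gamma> c x u v) w = - coord_form M g c x (torsion \<Gamma> c x u w) v)"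


section \<open>The Levi-Civita connection\<close>

definition levi_civita ::
  "('a, 'n::finite) cmfd \<Rightarrow> ('a, 'n) bilin_field \<Rightarrow> ('a, 'n) christoffel \<Rightarrow> bool" where
  "levi_civita M g \<Gamma> \<longleftrightarrow> affine_connection M \<Gamma> \<and> metric_connection M g \<Gamma> \<and>
     (\<forall>c\<in>atlas M. \<forall>x\<in>cmap_image c. \<forall>u v. torsion \<Gamma> c x u v = 0)"

text \<open>\<open>Ric(v, w)\<close> is the trace of the real endomorphism \<open>u \<mapsto> R(u, v) w\<close>.\<close>
definition ricci ::
  "('a, 'n::finite) christoffel \<Rightarrow> ('a, 'n) chart \<Rightarrow>
     complex ^ 'n \<Rightarrow> complex ^ 'n \<Rightarrow> complex ^ 'n \<Rightarrow> real" where
  "ricci \<Gamma> c x v w = (\<Sum>b\<in>Basis. curvature \<Gamma> c x b v w \<bullet> b)"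

text \<open>The Levi-Civita connection and the Bismut connection below exist and are unique, so that
  ``the connection has property \<open>P\<close>'' is rendered by an existential quantifier.\<close>

definition ricci_flat :: "('a, 'n::finite) cmfd \<Rightarrow> ('a, 'n) bilin_field \<Rightarrow> bool" where
  "ricci_flat M g \<longleftrightarrow> (\<exists>\<Gamma>. levi_civita M g \<Gamma> \<and>
     (\<forall>c\<in>atlas M. \<forall>x\<in>cmap_image c. \<forall>v w. ricci \<Gamma> c x v w = 0))"

definition flat_metric :: "('a, 'n::finite) cmfd \<Rightarrow> ('a, 'n) bilin_field \<Rightarrow> bool" where
  "flat_metric M g \<longleftrightarrow> (\<exists>\<Gamma>. levi_civita M g \<Gamma> \<and> flat_connection M \<Gamma>)"


section \<open>The Bismut connection\<close>

definition bismut_connection ::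
  "('a, 'n::finite) cmfd \<Rightarrow> ('a, 'n) bilin_field \<Rightarrow> ('a, 'n) christoffel \<Rightarrow> bool" where
  "bismut_connection M g \<Gamma> \<longleftrightarrow> affine_connection M \<Gamma> \<and> metric_connection M g \<Gamma> \<and>
     complex_connection M \<Gamma> \<and> skew_torsion M g \<Gamma>"

definition orthonormal_frame ::
  "('v \<Rightarrow> 'v \<Rightarrow> real) \<Rightarrow> 'v::euclidean_space set \<Rightarrow> bool" where
  "orthonormal_frame b E \<longleftrightarrow> finite E \<and> card E = DIM('v) \<and>
     (\<forall>e\<in>E. \<forall>e'\<in>E. b e e' = (if e = e' then 1 else 0))"

definition bismut_ricci_form ::
  "('a, 'n::finite) cmfd \<Rightarrow> ('a, 'n) bilin_field \<Rightarrow> ('a, 'n) christoffel \<Rightarrow> ('a, 'n) chart \<Rightarrow>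
     complex ^ 'n \<Rightarrow> (complex ^ 'n) set \<Rightarrow> complex ^ 'n \<Rightarrow> complex ^ 'n \<Rightarrow> real" where
  "bismut_ricci_form M g \<Gamma> c x E u v =
     (\<Sum>e\<in>E. coord_form M g c x (curvature \<Gamma> c x u v (imult e)) e) / 2"

text \<open>The value of the Bismut Ricci form does not depend on the orthonormal frame.\<close>
definition cyt :: "('a, 'n::finite) cmfd \<Rightarrow> ('a, 'n) bilin_field \<Rightarrow> bool" where
  "cyt M g \<longleftrightarrow> (\<exists>\<Gamma>. bismut_connection M g \<Gamma> \<and>
     (\<forall>c\<in>atlas M. \<forall>x\<in>cmap_image c. \<forall>E. orthonormal_frame (coord_form M g c x) E \<longrightarrow>
        (\<forall>u v. bismut_ricci_form M g \<Gamma> c x E u v = 0)))"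

definition bismut_flat :: "('a, 'n::finite) cmfd \<Rightarrow> ('a, 'n) bilin_field \<Rightarrow> bool" where
  "bismut_flat M g \<longleftrightarrow> (\<exists>\<Gamma>. bismut_connection M g \<Gamma> \<and> flat_connection M \<Gamma>)"


section \<open>Mapping tori\<close>

definition quotient_topology :: "'a topology \<Rightarrow> ('a \<Rightarrow> 'b) \<Rightarrow> 'b topology" where
  "quotient_topology X q =
     topology (\<lambda>U. U \<subseteq> q ` topspace X \<and> openin X {x \<in> topspace X. q x \<in> U})"

lemma openin_quotient_topology:
  "openin (quotient_topology X q) U \<longleftrightarrow>
     U \<subseteq> q ` topspace X \<and> openin X {x \<in> topspace X. q x \<in> U}"
proof -
  let ?P = "\<lambda>U. U \<subseteq> q ` topspace X \<and> openin X {x \<in> topspace X. q x \<in> U}"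
  have "?P (S \<inter> T)" if "?P S" "?P T" for S T
  proof -
    have "{x \<in> topspace X. q x \<in> S \<inter> T} =
      {x \<in> topspace X. q x \<in> S} \<inter> {x \<in> topspace X. q x \<in> T}" by auto
    then show ?thesis using that by auto
  qed
  moreover have "?P (\<Union>\<K>)" if "\<forall>S\<in>\<K>. ?P S" for \<K>
  proof -
    have "{x \<in> topspace X. q x \<in> \<Union>\<K>} = (\<Union>S\<in>\<K>. {x \<in> topspace X. q x \<in> S})" by auto
    then show ?thesis using that by auto
  qed
  ultimately have "istopology ?P" unfolding istopology_def by blast
  then show ?thesis unfolding quotient_topology_def by (simp add: topology_inverse')
qed

lemma quotient_map_quotient_topology: "quotient_map X (quotient_topology X q) q"
proof -
  have "openin X {x \<in> topspace X. q x \<in> q ` topspace X}"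
    by (metis (mono_tags, lifting) Collect_cong Collect_mem_eq imageI openin_topspace)
  then have "topspace (quotient_topology X q) = q ` topspace X"
    by (metis openin_quotient_topology openin_subset openin_topspace subset_antisym subset_refl)
  then show ?thesis unfolding quotient_map_def by (auto simp: openin_quotient_topology)
qed

definition int_iterate :: "'a set \<Rightarrow> ('a \<Rightarrow> 'a) \<Rightarrow> int \<Rightarrow> 'a \<Rightarrow> 'a" where
  "int_iterate S f n = (if 0 \<le> n then f ^^ nat n else inv_into S f ^^ nat (- n))"

text \<open>The orbit of \<open>(x, t)\<close> under the action \<open>n \<cdot> (x, t) = (f\<^sup>n x, t + n)\<close> of the integers; the
  points of the mapping torus of \<open>f : S \<rightarrow> S\<close> are these orbits.\<close>
definition torus_orbit :: "'a set \<Rightarrow> ('a \<Rightarrow> 'a) \<Rightarrow> 'a \<times> real \<Rightarrow> ('a \<times> real) set" where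
  "torus_orbit S f = (\<lambda>(x, t). range (\<lambda>n::int. (int_iterate S f n x, t + of_int n)))"

definition mapping_torus :: "'a topology \<Rightarrow> ('a \<Rightarrow> 'a) \<Rightarrow> ('a \<times> real) set topology" where
  "mapping_torus X f = quotient_topology (prod_topology X euclideanreal) (torus_orbit (topspace X) f)"


section \<open>The manifold \<open>K \<times> (\<complex>\<^sup>2 - {0})\<close>\<close>

definition vec_join :: "complex ^ 'm::finite \<Rightarrow> complex ^ 'n::finite \<Rightarrow> complex ^ ('m + 'n)" where
  "vec_join x y = (\<chi> i. case i of Inl a \<Rightarrow> x $ a | Inr b \<Rightarrow> y $ b)"

definition prod_manifold ::
  "('a, 'm::finite) cmfd \<Rightarrow> ('b, 'n::finite) cmfd \<Rightarrow> ('a \<times> 'b, 'm + 'n) cmfd" where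
  "prod_manifold M N =
     \<lparr>mtop = prod_topology (mtop M) (mtop N),
      atlas = {(fst c \<times> fst d, \<lambda>(p, q). vec_join (snd c p) (snd d q)) | c d.
                 c \<in> atlas M \<and> d \<in> atlas N}\<rparr>"

definition punctured_C2 :: "(complex ^ 2, 2) cmfd" where
  "punctured_C2 = \<lparr>mtop = top_of_set (- {0}), atlas = {(- {0}, \<lambda>x. x)}\<rparr>"

definition cover :: "('a, 'n::finite) cmfd \<Rightarrow> ('a \<times> (complex ^ 2), 'n + 2) cmfd" where
  "cover K = prod_manifold K punctured_C2"

definition euclidean_metric :: "(complex ^ 2, 2) bilin_field" where
  "euclidean_metric x u v = u \<bullet> v"

text \<open>The metric \<open>g + g\<^sub>E / R\<^sup>2\<close>, where \<open>R\<close> is the norm of the second component.\<close>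
definition cover_metric ::
  "('a, 'n::finite) cmfd \<Rightarrow> ('a, 'n) bilin_field \<Rightarrow> ('a \<times> (complex ^ 2), 'n + 2) bilin_field" where
  "cover_metric K g y u v =
     pullback (cover K) K fst g y u v +
     pullback (cover K) punctured_C2 snd euclidean_metric y u v / (norm (snd y))\<^sup>2"


section \<open>The mapping torus of \<open>(\<psi>, id)\<close> on \<open>K \<times> S\<^sup>3\<close> and its Hermitian structure\<close>

abbreviation sphere3 :: "(complex ^ 2) set" where
  "sphere3 \<equiv> sphere 0 1"

type_synonym 'a torus_point = "(('a \<times> (complex ^ 2)) \<times> real) set"

definition torus_space :: "('a, 'n::finite) cmfd \<Rightarrow> ('a \<Rightarrow> 'a) \<Rightarrow> 'a torus_point topology" where
  "torus_space K \<psi> = mapping_torus (prod_topology (mtop K) (top_of_set sphere3)) (map_prod \<psi> id)"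

definition unroll :: "('a \<times> (complex ^ 2)) \<times> real \<Rightarrow> 'a \<times> (complex ^ 2)" where
  "unroll = (\<lambda>((p, q), t). (p, (2 powr t) *\<^sub>R q))"

text \<open>The covering map from \<open>K \<times> (\<complex>\<^sup>2 - {0})\<close> onto the mapping torus: the bijection \<open>unroll\<close> from
  \<open>K \<times> S\<^sup>3 \<times> \<real>\<close> is inverted and followed by the projection to orbits.  It identifies the mapping
  torus with the quotient of \<open>K \<times> (\<complex>\<^sup>2 - {0})\<close> by \<open>n \<cdot> (p, x) = (\<psi>\<^sup>n p, 2\<^sup>n x)\<close>.\<close>
definition torus_cover ::
  "('a, 'n::finite) cmfd \<Rightarrow> ('a \<Rightarrow> 'a) \<Rightarrow> 'a \<times> (complex ^ 2) \<Rightarrow> 'a torus_point" where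
  "torus_cover K \<psi> =
     torus_orbit (topspace (mtop K) \<times> sphere3) (map_prod \<psi> id) \<circ>
     inv_into ((topspace (mtop K) \<times> sphere3) \<times> UNIV) unroll"

text \<open>The complex structure that a local homeomorphism \<open>q\<close> from \<open>M\<close> onto \<open>X\<close> induces on \<open>X\<close>: the
  charts are the charts of \<open>M\<close>, restricted to open sets on which \<open>q\<close> is injective, composed with the
  local inverses of \<open>q\<close>.\<close>
definition induced_manifold ::
  "('b, 'n::finite) cmfd \<Rightarrow> 'a topology \<Rightarrow> ('b \<Rightarrow> 'a) \<Rightarrow> ('a, 'n) cmfd" where
  "induced_manifold M X q =
     \<lparr>mtop = X,
      atlas = {(q ` W, snd c \<circ> inv_into W q) | W c.
                 c \<in> atlas M \<and> W \<subseteq> fst c \<and> openin (mtop M) W \<and> inj_on q W}\<rparr>"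

text \<open>The metric induced by an invariant metric \<open>G\<close> on \<open>M\<close>: tangent vectors are lifted by the
  inverse of the differential of \<open>q\<close> at some point of the fibre.\<close>
definition induced_metric ::
  "('b, 'n::finite) cmfd \<Rightarrow> ('a, 'n) cmfd \<Rightarrow> ('b \<Rightarrow> 'a) \<Rightarrow> ('b, 'n) bilin_field \<Rightarrow>
     ('a, 'n) bilin_field" where
  "induced_metric M N q G p u v =
     (let y = (SOME y. y \<in> topspace (mtop M) \<and> q y = p); L = inv (differential M N q y)
      in G y (L u) (L v))"

definition torus_manifold ::
  "('a, 'n::finite) cmfd \<Rightarrow> ('a \<Rightarrow> 'a) \<Rightarrow> ('a torus_point, 'n + 2) cmfd" where
  "torus_manifold K \<psi> = induced_manifold (cover K) (torus_space K \<psi>) (torus_cover K \<psi>)"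

definition torus_metric ::
  "('a, 'n::finite) cmfd \<Rightarrow> ('a, 'n) bilin_field \<Rightarrow> ('a \<Rightarrow> 'a) \<Rightarrow>
     ('a torus_point, 'n + 2) bilin_field" where
  "torus_metric K g \<psi> =
     induced_metric (cover K) (torus_manifold K \<psi>) (torus_cover K \<psi>) (cover_metric K g)"

end

theory Submission
  imports Defs
begin


text \<open>The Hermitian structure of the mapping torus is locally a product.  A chart of the torus is a chart of
\<open>K \<times> (\<complex>\<^sup>2 - {0})\<close> read on an open set that the covering map embeds, and the deck
transformations \<open>(\<psi>\<^sup>n, 2\<^sup>n)\<close> are holomorphic isometries of \<open>g + g\<^sub>E / R\<^sup>2\<close>.  In every chart the
torus metric is therefore the direct sum of the Kaehler metric \<open>g\<close> and of the Hopf metric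
\<open>g\<^sub>E / R\<^sup>2\<close> (\<open>coord_form_induced_metric\<close>, \<open>coord_form_cover_metric\<close>), and all three claims become
statements about such sums.

The Bismut connection splits in the same way.  On the Kaehler side it is the Levi-Civita
connection, which preserves the complex structure (\<open>levi_civita_complex\<close>).  On the other side
\<open>\<complex>\<^sup>2 - {0}\<close> is the group of nonzero quaternions, and the connection is the one whose parallel
fields are the right-invariant fields \<open>x \<mapsto> a x\<close>.  These have constant inner products for
\<open>g\<^sub>E / R\<^sup>2\<close>, and multiplication by \<open>\<i>\<close>, being a left multiplication, permutes them; so the
connection is metric, complex and flat.  Its torsion is totally skew, and the form \<open>d\<^sup>c\<omega>\<close> is a constant
multiple of the volume form of the sphere pulled back by \<open>x \<mapsto> x / |x|\<close>, hence closed: this is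
the SKT condition (\<open>hopf_skt\<close>).

That the local sums fit together to a connection on the torus takes no computation with
Christoffel symbols.  A Bismut connection is determined at each point by the metric and its first
derivatives (\<open>bismut_difference_zero\<close>), so every holomorphic isometry, and in particular every change
of charts, respects it (\<open>bismut_transformation\<close>).

The curvature of the sum is the curvature of \<open>K\<close> extended by zero.  Its Bismut Ricci form is half the
trace of \<open>w \<mapsto> R(u, v) (\<i> w)\<close> on \<open>K\<close>, which the Bianchi identity expresses by the Ricci tensor
(\<open>trace_complex_curvature_zero\<close>); it vanishes because \<open>g\<close> is Ricci-flat.  If some Bismut
connection of the torus were flat, then by uniqueness it would be this sum, and \<open>K\<close> would be flat.\<close>

section \<open>Smooth maps between open subsets of Euclidean spaces\<close>

lemma frechet_derivative_cong_open:
  assumes "open S" "x \<in> S" "\<And>y. y \<in> S \<Longrightarrow> f y = g y"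
  shows "frechet_derivative f (at x) = frechet_derivative g (at x)"
proof -
  have "(f has_derivative D) (at x) \<longleftrightarrow> (g has_derivative D) (at x)" for D
    using has_derivative_transform_within_open[of f D x UNIV S g]
      has_derivative_transform_within_open[of g D x UNIV S f] assms by auto
  then show ?thesis by (simp add: frechet_derivative_def)
qed

lemma differentiable_cong_open:
  assumes "open S" "x \<in> S" "\<And>y. y \<in> S \<Longrightarrow> f y = g y" "f differentiable (at x)"
  shows "g differentiable (at x)"
  using assms has_derivative_transform_within_open[of f _ x UNIV S g]
  by (auto simp: differentiable_def)

lemma frechet_derivative_eqI:
  "(f has_derivative D) (at x) \<Longrightarrow> frechet_derivative f (at x) = D"
  using frechet_derivative_at by metis

lemma Ck_on_cong:
  assumes "open S" "\<And>x. x \<in> S \<Longrightarrow> f x = g x" "Ck_on k S f"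
  shows "Ck_on k S g"
  using assms(2,3)
proof (induction k arbitrary: f g)
  case 0
  then show ?case using continuous_on_eq[of S f g] unfolding Ck_on.simps by blast
next
  case (Suc k)
  have "Ck_on k S (\<lambda>x. frechet_derivative g (at x) v)" for v
  proof (rule Suc.IH)
    show "Ck_on k S (\<lambda>x. frechet_derivative f (at x) v)"
      using Suc.prems(2) unfolding Ck_on.simps by blast
    show "frechet_derivative f (at x) v = frechet_derivative g (at x) v" if "x \<in> S" for x
      using fun_cong[OF frechet_derivative_cong_open[OF assms(1) that Suc.prems(1)]] by simp
  qed
  moreover have "g differentiable (at x)" if "x \<in> S" for x
    by (rule differentiable_cong_open[OF assms(1) that, of f]) (use Suc.prems that in auto)
  ultimately show ?case by simp
qed

lemma Ck_on_SucI:
  assumes "open S" "\<And>x. x \<in> S \<Longrightarrow> (f has_derivative D x) (at x)"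
    and "\<And>v. Ck_on k S (\<lambda>x. D x v)"
  shows "Ck_on (Suc k) S f"
proof -
  have "Ck_on k S (\<lambda>x. frechet_derivative f (at x) v)" for v
  proof (rule Ck_on_cong[OF assms(1) _ assms(3)[of v]])
    fix x assume "x \<in> S"
    from frechet_derivative_eqI[OF assms(2)[OF this]]
    show "D x v = frechet_derivative f (at x) v" by simp
  qed
  moreover have "f differentiable (at x)" if "x \<in> S" for x
    using assms(2)[OF that] unfolding differentiable_def by blast
  ultimately show ?thesis unfolding Ck_on.simps by blast
qed

lemma Ck_on_Suc_imp: "Ck_on (Suc k) S f \<Longrightarrow> Ck_on k S f"
proof (induction k arbitrary: f)
  case 0
  then show ?case
    by (auto intro!: continuous_at_imp_continuous_on differentiable_imp_continuous_within)
next
  case (Suc k)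
  show ?case using Suc.prems Suc.IH unfolding Ck_on.simps(2)[of "Suc k"] Ck_on.simps(2)[of k] by blast
qed

lemma Ck_on_subset: "T \<subseteq> S \<Longrightarrow> Ck_on k S f \<Longrightarrow> Ck_on k T f"
  by (induction k arbitrary: f) (auto intro: continuous_on_subset)

lemma Ck_on_local:
  assumes "\<And>x. x \<in> S \<Longrightarrow> \<exists>T. open T \<and> x \<in> T \<and> Ck_on k T f"
  shows "Ck_on k S f"
  using assms
proof (induction k arbitrary: f)
  case 0
  have "continuous (at x) f" if "x \<in> S" for x
    using 0[OF that] by (auto simp: continuous_on_eq_continuous_at)
  then show ?case by (simp add: continuous_at_imp_continuous_on)
next
  case (Suc k)
  have "Ck_on k S (\<lambda>x. frechet_derivative f (at x) v)" for v
    by (rule Suc.IH) (use Suc.prems in fastforce)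
  moreover have "f differentiable (at x)" if "x \<in> S" for x
    using Suc.prems[OF that] by auto
  ultimately show ?case by simp
qed

lemma Ck_on_const [simp]: "Ck_on k S (\<lambda>x. c)"
  by (induction k arbitrary: c) auto

lemma Ck_on_linear:
  assumes "bounded_linear L"
  shows "Ck_on k S L"
proof (cases k)
  case 0
  then show ?thesis using assms by (simp add: linear_continuous_on)
next
  case (Suc j)
  have "(L has_derivative L) (at x)" for x
    using assms bounded_linear_imp_has_derivative by blast
  then show ?thesis using Suc frechet_derivative_eqI[of L L]
    by (auto simp: differentiable_def)
qed

lemma Ck_on_add:
  assumes "open S" "Ck_on k S f" "Ck_on k S g"
  shows "Ck_on k S (\<lambda>x. f x + g x)"
  using assms(2,3)
proof (induction k arbitrary: f g)
  case 0
  then show ?case by (simp add: continuous_on_add)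
next
  case (Suc k)
  have D: "((\<lambda>x. f x + g x) has_derivative
      (\<lambda>v. frechet_derivative f (at x) v + frechet_derivative g (at x) v)) (at x)" if "x \<in> S" for x
    using Suc.prems that
    by (auto intro!: has_derivative_add simp: frechet_derivative_works[symmetric])
  have "Ck_on k S (\<lambda>x. frechet_derivative f (at x) v + frechet_derivative g (at x) v)" for v
    using Suc by simp
  from Ck_on_SucI[OF assms(1) D this] show ?case .
qed

lemma Ck_on_sum:
  assumes "open S" "\<And>i. i \<in> I \<Longrightarrow> Ck_on k S (f i)"
  shows "Ck_on k S (\<lambda>x. \<Sum>i\<in>I. f i x)"
  using assms(2)
proof (induction I rule: infinite_finite_induct)
  case (insert i I)
  have "Ck_on k S (\<lambda>x. f i x + (\<Sum>i\<in>I. f i x))"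
    by (rule Ck_on_add[OF assms(1)]) (use insert in blast)+
  then show ?case using insert by simp
qed (simp_all del: Ck_on.simps)

lemma Ck_on_bilinear:
  assumes B: "bounded_bilinear B" and "open S" "Ck_on k S f" "Ck_on k S g"
  shows "Ck_on k S (\<lambda>x. B (f x) (g x))"
  using assms(3,4)
proof (induction k arbitrary: f g)
  case 0
  then show ?case using bounded_bilinear.continuous_on[OF B] by auto
next
  case (Suc k)
  have D: "((\<lambda>x. B (f x) (g x)) has_derivative
      (\<lambda>v. B (f x) (frechet_derivative g (at x) v) + B (frechet_derivative f (at x) v) (g x))) (at x)"
    if "x \<in> S" for x
    using Suc.prems that
    by (intro bounded_bilinear.FDERIV[OF B]) (auto simp: frechet_derivative_works[symmetric])
  have "Ck_on k S (\<lambda>x. B (f x) (frechet_derivative g (at x) v) + B (frechet_derivative f (at x) v) (g x))" for v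
    using Suc.prems
    by (intro Ck_on_add[OF assms(2)] Suc.IH Ck_on_Suc_imp[of k S f] Ck_on_Suc_imp[of k S g]) simp_all
  from Ck_on_SucI[OF assms(2) D this] show ?case .
qed

text \<open>The derivative of \<open>g \<circ> f\<close> in direction \<open>v\<close> is \<open>Dg\<close> applied to a direction that moves with
the point.  Expanding this direction in the standard basis leaves only derivatives of \<open>g\<close> in fixed
directions, to which the induction hypothesis applies.\<close>

lemma Ck_on_compose:
  assumes "open S" "open T" "f ` S \<subseteq> T" "Ck_on k S f" "Ck_on k T g"
  shows "Ck_on k S (\<lambda>x. g (f x))"
  using assms(4,5)
proof (induction k arbitrary: g)
  case 0
  then show ?case using assms(3) by (auto intro: continuous_on_compose2)
next
  case (Suc k)
  let ?D = frechet_derivative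
  have lin: "linear (?D g (at (f x)))" if "x \<in> S" for x
    using Suc.prems(2) assms(3) that by (auto intro!: linear_frechet_derivative)
  have D: "((\<lambda>x. g (f x)) has_derivative (\<lambda>v. ?D g (at (f x)) (?D f (at x) v))) (at x)"
    if "x \<in> S" for x
    using Suc.prems that assms(3) diff_chain_at[of f "?D f (at x)" x g "?D g (at (f x))"]
    by (auto simp: frechet_derivative_works[symmetric] o_def image_subset_iff)
  have "Ck_on k S (\<lambda>x. \<Sum>b\<in>Basis. (?D f (at x) v \<bullet> b) *\<^sub>R ?D g (at (f x)) b)" for v
  proof (intro Ck_on_sum[OF assms(1)] Ck_on_bilinear[OF bounded_bilinear_scaleR assms(1)])
    fix b :: 'b
    show "Ck_on k S (\<lambda>x. ?D f (at x) v \<bullet> b)"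
      by (rule Ck_on_bilinear[OF bounded_bilinear_inner assms(1)]) (use Suc.prems in simp_all)
    show "Ck_on k S (\<lambda>x. ?D g (at (f x)) b)"
      by (rule Suc.IH) (use Suc.prems Ck_on_Suc_imp in auto)
  qed
  moreover have "(\<Sum>b\<in>Basis. (?D f (at x) v \<bullet> b) *\<^sub>R ?D g (at (f x)) b) = ?D g (at (f x)) (?D f (at x) v)"
    if "x \<in> S" for x v
  proof -
    have "?D g (at (f x)) (?D f (at x) v) = ?D g (at (f x)) (\<Sum>b\<in>Basis. (?D f (at x) v \<bullet> b) *\<^sub>R b)"
      by (simp add: euclidean_representation)
    then show ?thesis by (simp add: linear_sum[OF lin[OF that]] linear_cmul[OF lin[OF that]])
  qed
  ultimately have "Ck_on k S (\<lambda>x. ?D g (at (f x)) (?D f (at x) v))" for v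
    using Ck_on_cong[OF assms(1), where f="\<lambda>x. \<Sum>b\<in>Basis. (?D f (at x) v \<bullet> b) *\<^sub>R ?D g (at (f x)) b"
      and g="\<lambda>x. ?D g (at (f x)) (?D f (at x) v)" and k=k] by blast
  from Ck_on_SucI[OF assms(1) D this] show ?case .
qed

lemma Ck_on_inverse:
  fixes f :: "'v::euclidean_space \<Rightarrow> real"
  assumes "open S" "\<And>x. x \<in> S \<Longrightarrow> f x \<noteq> 0" "Ck_on k S f"
  shows "Ck_on k S (\<lambda>x. inverse (f x))"
  using assms(3)
proof (induction k)
  case 0
  then show ?case using assms(2) by (auto intro: continuous_on_inverse)
next
  case (Suc k)
  have D: "((\<lambda>x. inverse (f x)) has_derivative
      (\<lambda>v. - (inverse (f x) * frechet_derivative f (at x) v * inverse (f x)))) (at x)" if "x \<in> S" for x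
    using Suc.prems that assms(2)
    by (intro Deriv.has_derivative_inverse) (auto simp: frechet_derivative_works[symmetric])
  have k: "Ck_on k S (\<lambda>x. inverse (f x))" by (rule Suc.IH[OF Ck_on_Suc_imp[OF Suc.prems]])
  have "Ck_on k S (\<lambda>x. (-1) * (inverse (f x) * frechet_derivative f (at x) v * inverse (f x)))" for v
    by (intro Ck_on_bilinear[OF bounded_bilinear_mult] assms(1) k Ck_on_const) (use Suc.prems in simp)
  then have "Ck_on k S (\<lambda>x. - (inverse (f x) * frechet_derivative f (at x) v * inverse (f x)))" for v
    by simp
  from Ck_on_SucI[OF assms(1) D this] show ?case .
qed

lemma smooth_on_cong:
  "open S \<Longrightarrow> (\<And>x. x \<in> S \<Longrightarrow> f x = g x) \<Longrightarrow> smooth_on S f \<Longrightarrow> smooth_on S g"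
  unfolding smooth_on_def using Ck_on_cong by metis

lemma smooth_on_subset: "T \<subseteq> S \<Longrightarrow> smooth_on S f \<Longrightarrow> smooth_on T f"
  by (simp add: smooth_on_def Ck_on_subset)

lemma smooth_on_local:
  "(\<And>x. x \<in> S \<Longrightarrow> \<exists>T. open T \<and> x \<in> T \<and> smooth_on T f) \<Longrightarrow> smooth_on S f"
  unfolding smooth_on_def by (meson Ck_on_local)

lemma smooth_on_linear: "linear L \<Longrightarrow> smooth_on S L"
  by (simp add: smooth_on_def Ck_on_linear linear_linear)

lemma smooth_on_const: "smooth_on S (\<lambda>x. c)"
  by (simp add: smooth_on_def)

lemma smooth_on_add: "open S \<Longrightarrow> smooth_on S f \<Longrightarrow> smooth_on S g \<Longrightarrow> smooth_on S (\<lambda>x. f x + g x)"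
  by (simp add: smooth_on_def Ck_on_add)

lemma smooth_on_bilinear:
  "bounded_bilinear B \<Longrightarrow> open S \<Longrightarrow> smooth_on S f \<Longrightarrow> smooth_on S g \<Longrightarrow> smooth_on S (\<lambda>x. B (f x) (g x))"
  by (simp add: smooth_on_def Ck_on_bilinear)

lemma smooth_on_compose:
  "open S \<Longrightarrow> open T \<Longrightarrow> f ` S \<subseteq> T \<Longrightarrow> smooth_on S f \<Longrightarrow> smooth_on T g \<Longrightarrow> smooth_on S (\<lambda>x. g (f x))"
  unfolding smooth_on_def using Ck_on_compose by blast

lemma smooth_on_inverse:
  fixes f :: "'v::euclidean_space \<Rightarrow> real"
  shows "open S \<Longrightarrow> (\<And>x. x \<in> S \<Longrightarrow> f x \<noteq> 0) \<Longrightarrow> smooth_on S f \<Longrightarrow> smooth_on S (\<lambda>x. inverse (f x))"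
  by (simp add: smooth_on_def Ck_on_inverse)

lemma smooth_on_derivative:
  "smooth_on S f \<Longrightarrow> smooth_on S (\<lambda>x. frechet_derivative f (at x) v)"
  unfolding smooth_on_def using Ck_on.simps(2) by blast

lemma smooth_on_imp_differentiable:
  "smooth_on S f \<Longrightarrow> x \<in> S \<Longrightarrow> f differentiable (at x)"
  unfolding smooth_on_def using Ck_on.simps(2) by blast

lemma smooth_on_imp_has_derivative:
  "smooth_on S f \<Longrightarrow> x \<in> S \<Longrightarrow> (f has_derivative frechet_derivative f (at x)) (at x)"
  using smooth_on_imp_differentiable frechet_derivative_works by blast

lemma smooth_on_imp_continuous_on: "smooth_on S f \<Longrightarrow> continuous_on S f"
  unfolding smooth_on_def using Ck_on.simps(1) by blast

text \<open>The mean value theorem is used twice: in direction \<open>u\<close> for the difference of \<open>f\<close> between two opposite sides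
of the parallelogram, then in direction \<open>v\<close> for the derivative of \<open>f\<close> along \<open>u\<close>.\<close>

lemma mixed_difference_mvt:
  fixes f :: "'v::euclidean_space \<Rightarrow> real"
  assumes S: "\<And>s t. 0 \<le> s \<Longrightarrow> s \<le> h \<Longrightarrow> 0 \<le> t \<Longrightarrow> t \<le> h \<Longrightarrow> x + s *\<^sub>R u + t *\<^sub>R v \<in> S"
    and f: "smooth_on S f" and h: "0 < h"
  shows "\<exists>s t. 0 < s \<and> s < h \<and> 0 < t \<and> t < h \<and>
    f (x + h *\<^sub>R u + h *\<^sub>R v) - f (x + h *\<^sub>R u) - f (x + h *\<^sub>R v) + f x =
      h * h * frechet_derivative (\<lambda>y. frechet_derivative f (at y) u) (at (x + s *\<^sub>R u + t *\<^sub>R v)) v"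
proof -
  let ?D = "\<lambda>y. frechet_derivative f (at y)"
  let ?E = "\<lambda>y. frechet_derivative (\<lambda>y. ?D y u) (at y)"
  define \<phi> where "\<phi> s = f (x + s *\<^sub>R u + h *\<^sub>R v) - f (x + s *\<^sub>R u)" for s
  have lin: "linear (?D y)" "linear (?E y)" if "y \<in> S" for y
    by (rule linear_frechet_derivative smooth_on_imp_differentiable[OF _ that] smooth_on_derivative f)+
  have 1: "((\<lambda>s. f (x + s *\<^sub>R u + t *\<^sub>R v)) has_real_derivative ?D (x + s *\<^sub>R u + t *\<^sub>R v) u) (at s)"
    if "0 \<le> s" "s \<le> h" "0 \<le> t" "t \<le> h" for s t
  proof -
    have "((\<lambda>s. x + s *\<^sub>R u + t *\<^sub>R v) has_derivative (\<lambda>s. s *\<^sub>R u)) (at s)"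
      by (auto intro!: derivative_eq_intros)
    from diff_chain_at[OF this smooth_on_imp_has_derivative[OF f S[OF that]]]
    show ?thesis using lin(1)[OF S[OF that]]
      by (auto simp: has_field_derivative_def o_def linear_cmul elim!: has_derivative_eq_rhs)
  qed
  have 2: "((\<lambda>t. ?D (x + s *\<^sub>R u + t *\<^sub>R v) u) has_real_derivative ?E (x + s *\<^sub>R u + t *\<^sub>R v) v) (at t)"
    if "0 \<le> s" "s \<le> h" "0 \<le> t" "t \<le> h" for s t
  proof -
    have "((\<lambda>t. x + s *\<^sub>R u + t *\<^sub>R v) has_derivative (\<lambda>t. t *\<^sub>R v)) (at t)"
      by (auto intro!: derivative_eq_intros)
    from diff_chain_at[OF this smooth_on_imp_has_derivative[OF smooth_on_derivative[OF f, of u] S[OF that]]]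
    show ?thesis using lin(2)[OF S[OF that]]
      by (auto simp: has_field_derivative_def o_def linear_cmul elim!: has_derivative_eq_rhs)
  qed
  have "\<exists>s. 0 < s \<and> s < h \<and> \<phi> h - \<phi> 0 = (h - 0) * (?D (x + s *\<^sub>R u + h *\<^sub>R v) u - ?D (x + s *\<^sub>R u) u)"
    unfolding \<phi>_def
    by (rule MVT2[OF h]) (use 1[of _ h] 1[of _ 0] h in \<open>auto intro!: DERIV_diff\<close>)
  then obtain s where s: "0 < s" "s < h"
    and \<phi>: "\<phi> h - \<phi> 0 = h * (?D (x + s *\<^sub>R u + h *\<^sub>R v) u - ?D (x + s *\<^sub>R u) u)" by auto
  have "\<exists>t. 0 < t \<and> t < h \<and> ?D (x + s *\<^sub>R u + h *\<^sub>R v) u - ?D (x + s *\<^sub>R u + 0 *\<^sub>R v) u =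
      (h - 0) * ?E (x + s *\<^sub>R u + t *\<^sub>R v) v"
    by (rule MVT2[OF h]) (use 2[of s] s in auto)
  then obtain t where t: "0 < t" "t < h"
    "?D (x + s *\<^sub>R u + h *\<^sub>R v) u - ?D (x + s *\<^sub>R u) u = h * ?E (x + s *\<^sub>R u + t *\<^sub>R v) v" by auto
  have "f (x + h *\<^sub>R u + h *\<^sub>R v) - f (x + h *\<^sub>R u) - f (x + h *\<^sub>R v) + f x = \<phi> h - \<phi> 0"
    by (simp add: \<phi>_def)
  then show ?thesis using s t \<phi> by (metis mult.assoc)
qed

text \<open>The second difference of \<open>f\<close> over a parallelogram is symmetric in the two sides, and divided by the
square of the scale it tends to the mixed derivative.\<close>

lemma second_derivative_symmetric:
  fixes f :: "'v::euclidean_space \<Rightarrow> 'w::euclidean_space"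
  assumes "open S" "x \<in> S" "smooth_on S f"
  shows "frechet_derivative (\<lambda>y. frechet_derivative f (at y) u) (at x) v =
         frechet_derivative (\<lambda>y. frechet_derivative f (at y) v) (at x) u"
proof -
  have real: "frechet_derivative (\<lambda>y. frechet_derivative f (at y) u) (at x) v =
         frechet_derivative (\<lambda>y. frechet_derivative f (at y) v) (at x) u"
    if f: "smooth_on S f" for f :: "'v \<Rightarrow> real"
  proof -
    define E where "E u v y = frechet_derivative (\<lambda>y. frechet_derivative f (at y) u) (at y) v" for u v y
    obtain r where r: "r > 0" "ball x r \<subseteq> S" using assms open_contains_ball by blast
    define m where "m = norm u + norm v + 1"
    have m: "m > 0" by (simp add: m_def add_nonneg_pos)
    \<comment> \<open>the parallelograms shrink to \<open>x\<close> and stay inside \<open>ball x r\<close>\<close>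
    define h where "h n = r / m * (inverse (real (Suc n)) / 2)" for n
    have h: "h n > 0" for n using r m by (simp add: h_def)
    have hm: "h n * m = r * (inverse (real (Suc n)) / 2)" for n using m by (simp add: h_def)
    have "inverse (real (Suc n)) / 2 < 1" for n by (simp add: field_simps)
    then have hr: "h n * m < r" for n using r(1) unfolding hm by simp
    have dist_le: "dist (x + s *\<^sub>R a + t *\<^sub>R b) x \<le> h n * m"
      if "0 \<le> s" "s \<le> h n" "0 \<le> t" "t \<le> h n" "norm a + norm b \<le> m" for s t n a b
    proof -
      have "dist (x + s *\<^sub>R a + t *\<^sub>R b) x = norm (s *\<^sub>R a + t *\<^sub>R b)" by (simp add: dist_norm)
      also have "\<dots> \<le> s * norm a + t * norm b"
        by (rule order_trans[OF norm_triangle_ineq]) (use that in auto)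
      also have "\<dots> \<le> h n * norm a + h n * norm b"
        by (intro add_mono mult_right_mono) (use that in auto)
      also have "\<dots> = h n * (norm a + norm b)" by (simp add: algebra_simps)
      also have "\<dots> \<le> h n * m" using that h[of n] by simp
      finally show ?thesis .
    qed
    define \<Delta> where "\<Delta> a b n = f (x + h n *\<^sub>R a + h n *\<^sub>R b) - f (x + h n *\<^sub>R a) - f (x + h n *\<^sub>R b) + f x"
      for a b n
    have lim: "(\<lambda>n. \<Delta> a b n / (h n * h n)) \<longlonglongrightarrow> E a b x" if ab: "norm a + norm b \<le> m" for a b
    proof -
      have "\<exists>y. dist y x \<le> h n * m \<and> \<Delta> a b n = h n * h n * E a b y" for n
      proof -
        have "\<exists>s t. 0 < s \<and> s < h n \<and> 0 < t \<and> t < h n \<and>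
            \<Delta> a b n = h n * h n * E a b (x + s *\<^sub>R a + t *\<^sub>R b)"
          unfolding \<Delta>_def E_def
        proof (rule mixed_difference_mvt[OF _ f h])
          fix s t assume "0 \<le> s" "s \<le> h n" "0 \<le> t" "t \<le> h n"
          then have "dist (x + s *\<^sub>R a + t *\<^sub>R b) x < r" using dist_le[OF _ _ _ _ ab] hr[of n]
            by (meson order_le_less_trans)
          then show "x + s *\<^sub>R a + t *\<^sub>R b \<in> S" using r by (auto simp: dist_commute)
        qed
        then show ?thesis using dist_le[OF _ _ _ _ ab] by (meson less_imp_le)
      qed
      then obtain y where y: "\<And>n. dist (y n) x \<le> h n * m" "\<And>n. \<Delta> a b n = h n * h n * E a b (y n)"
        by metis
      have "(\<lambda>n. h n * m) \<longlonglongrightarrow> r * (0 / 2)"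
        unfolding hm by (intro tendsto_intros LIMSEQ_inverse_real_of_nat) auto
      then have "(\<lambda>n. h n * m) \<longlonglongrightarrow> 0" by simp
      then have "(\<lambda>n. dist (y n) x) \<longlonglongrightarrow> 0"
        by (rule tendsto_sandwich[of "\<lambda>_. 0", rotated -1]) (use y in auto)
      then have "y \<longlonglongrightarrow> x" using tendsto_dist_iff by blast
      moreover have "isCont (E a b) x"
        using smooth_on_imp_continuous_on[OF smooth_on_derivative[OF smooth_on_derivative[OF f]]] assms
        unfolding E_def by (simp add: continuous_on_eq_continuous_at)
      ultimately have "(\<lambda>n. E a b (y n)) \<longlonglongrightarrow> E a b x" using isCont_tendsto_compose by blast
      then show ?thesis using y(2) h by (simp add: less_imp_neq[symmetric])
    qed
    have "\<Delta> u v = \<Delta> v u" by (auto simp: \<Delta>_def algebra_simps)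
    then have "E u v x = E v u x"
      using lim[of u v] lim[of v u] LIMSEQ_unique by (auto simp: m_def)
    then show ?thesis by (simp add: E_def)
  qed
  have comp: "frechet_derivative (\<lambda>y. frechet_derivative f (at y) a) (at x) b \<bullet> i =
      frechet_derivative (\<lambda>y. frechet_derivative (\<lambda>y. f y \<bullet> i) (at y) a) (at x) b" for a b i
  proof -
    have inn: "frechet_derivative (\<lambda>y. h y \<bullet> i) (at y) c = frechet_derivative h (at y) c \<bullet> i"
      if "smooth_on S h" "y \<in> S" for h :: "'v \<Rightarrow> 'w" and y c
      using frechet_derivative_eqI[OF has_derivative_inner_left[OF smooth_on_imp_has_derivative[OF that]]]
      by simp
    have "frechet_derivative (\<lambda>y. frechet_derivative (\<lambda>y. f y \<bullet> i) (at y) a) (at x) b =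
        frechet_derivative (\<lambda>y. frechet_derivative f (at y) a \<bullet> i) (at x) b"
      by (rule fun_cong[OF frechet_derivative_cong_open[OF assms(1,2)]]) (rule inn[OF assms(3)])
    then show ?thesis by (simp add: inn[OF smooth_on_derivative[OF assms(3)] assms(2)])
  qed
  have sm: "smooth_on S (\<lambda>y. f y \<bullet> i)" for i
    by (rule smooth_on_bilinear[OF bounded_bilinear_inner assms(1,3) smooth_on_const])
  show ?thesis
    by (rule euclidean_eqI) (simp only: comp real[OF sm])
qed


section \<open>Holomorphic maps and charts\<close>

lemma holo_on_imp_smooth_on: "holo_on S f \<Longrightarrow> smooth_on S f"
  by (simp add: holo_on_def)

lemma holo_on_cong:
  assumes "open S" "\<And>x. x \<in> S \<Longrightarrow> f x = g x" "holo_on S f"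
  shows "holo_on S g"
proof -
  have "frechet_derivative g (at x) = frechet_derivative f (at x)" if "x \<in> S" for x
    using frechet_derivative_cong_open[OF assms(1) that assms(2)] by simp
  moreover have "smooth_on S g"
    by (rule smooth_on_cong[OF assms(1,2) holo_on_imp_smooth_on[OF assms(3)]])
  ultimately show ?thesis using assms(3) unfolding holo_on_def by simp
qed

lemma holo_on_subset: "T \<subseteq> S \<Longrightarrow> holo_on S f \<Longrightarrow> holo_on T f"
  unfolding holo_on_def using smooth_on_subset by blast

lemma holo_on_local:
  assumes "\<And>x. x \<in> S \<Longrightarrow> \<exists>T. open T \<and> x \<in> T \<and> holo_on T f"
  shows "holo_on S f"
  unfolding holo_on_def
proof (intro conjI ballI allI)
  show "smooth_on S f" by (rule smooth_on_local) (use assms in \<open>blast intro: holo_on_imp_smooth_on\<close>)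
  show "frechet_derivative f (at x) (imult v) = imult (frechet_derivative f (at x) v)"
    if "x \<in> S" for x v using assms[OF that] by (auto simp: holo_on_def)
qed

lemma holo_on_linear: "linear L \<Longrightarrow> (\<And>v. L (imult v) = imult (L v)) \<Longrightarrow> holo_on S L"
  unfolding holo_on_def
  by (auto simp: smooth_on_linear frechet_derivative_eqI[OF linear_imp_has_derivative])

lemma holo_on_compose:
  assumes "open S" "open T" "f ` S \<subseteq> T" "holo_on S f" "holo_on T g"
  shows "holo_on S (\<lambda>x. g (f x))"
  unfolding holo_on_def
proof (intro conjI ballI allI)
  note sm = holo_on_imp_smooth_on[OF assms(4)] holo_on_imp_smooth_on[OF assms(5)]
  show "smooth_on S (\<lambda>x. g (f x))" by (rule smooth_on_compose[OF assms(1-3) sm])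
  fix x v assume x: "x \<in> S"
  then have fx: "f x \<in> T" using assms(3) by blast
  have "frechet_derivative (\<lambda>x. g (f x)) (at x) =
      frechet_derivative g (at (f x)) \<circ> frechet_derivative f (at x)"
    using frechet_derivative_eqI[OF diff_chain_at[OF smooth_on_imp_has_derivative[OF sm(1) x]
      smooth_on_imp_has_derivative[OF sm(2) fx]]] by (simp add: o_def)
  then show "frechet_derivative (\<lambda>x. g (f x)) (at x) (imult v) =
      imult (frechet_derivative (\<lambda>x. g (f x)) (at x) v)"
    using x fx assms(4,5) by (simp add: holo_on_def)
qed

lemma complex_manifoldD:
  assumes "complex_manifold M"
  shows "Hausdorff_space (mtop M)" "second_countable_space (mtop M)"
    "(\<Union>c\<in>atlas M. fst c) = topspace (mtop M)"
    "c \<in> atlas M \<Longrightarrow> openin (mtop M) (fst c)"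
    "c \<in> atlas M \<Longrightarrow> open (cmap_image c)"
    "c \<in> atlas M \<Longrightarrow> homeomorphic_map (subtopology (mtop M) (fst c)) (top_of_set (cmap_image c)) (snd c)"
    "c \<in> atlas M \<Longrightarrow> d \<in> atlas M \<Longrightarrow> holo_on (snd c ` (fst c \<inter> fst d)) (snd d \<circ> cmap_inv c)"
  using assms unfolding complex_manifold_def by blast+

lemma chart_subset_topspace:
  "complex_manifold M \<Longrightarrow> c \<in> atlas M \<Longrightarrow> fst c \<subseteq> topspace (mtop M)"
  using complex_manifoldD(3) by blast

lemma chart_at:
  assumes "complex_manifold M" "p \<in> topspace (mtop M)"
  shows "chart_at M p \<in> atlas M" "p \<in> fst (chart_at M p)"
proof -
  have "\<exists>c. c \<in> atlas M \<and> p \<in> fst c" using assms complex_manifoldD(3) by blast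
  then have "chart_at M p \<in> atlas M \<and> p \<in> fst (chart_at M p)"
    unfolding chart_at_def by (rule someI_ex)
  then show "chart_at M p \<in> atlas M" "p \<in> fst (chart_at M p)" by auto
qed

lemma inj_on_chart:
  assumes "complex_manifold M" "c \<in> atlas M"
  shows "inj_on (snd c) (fst c)"
  using complex_manifoldD(6)[OF assms] chart_subset_topspace[OF assms]
  by (simp add: homeomorphic_eq_everything_map Int_absorb1)

lemma cmap_inv_left:
  "complex_manifold M \<Longrightarrow> c \<in> atlas M \<Longrightarrow> p \<in> fst c \<Longrightarrow> cmap_inv c (snd c p) = p"
  unfolding cmap_inv_def by (rule inv_into_f_f[OF inj_on_chart])

lemma cmap_inv_right: "x \<in> cmap_image c \<Longrightarrow> snd c (cmap_inv c x) = x"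
  unfolding cmap_inv_def cmap_image_def by (rule f_inv_into_f)

lemma cmap_inv_in: "x \<in> cmap_image c \<Longrightarrow> cmap_inv c x \<in> fst c"
  unfolding cmap_inv_def cmap_image_def by (rule inv_into_into)

lemma open_chart_image:
  assumes "complex_manifold M" "c \<in> atlas M" "openin (mtop M) W" "W \<subseteq> fst c"
  shows "open (snd c ` W)"
proof -
  have "openin (subtopology (mtop M) (fst c)) W" using assms(3,4) by (auto simp: openin_subtopology)
  then have "openin (top_of_set (cmap_image c)) (snd c ` W)"
    using complex_manifoldD(6)[OF assms(1,2)] homeomorphic_imp_open_map open_map_def by blast
  then show ?thesis
    using complex_manifoldD(5)[OF assms(1,2)] openin_open_eq by blast
qed

lemma holomorphic_map_continuous: "holomorphic_map M N F \<Longrightarrow> continuous_map (mtop M) (mtop N) F"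
  by (simp add: holomorphic_map_def)

lemma holomorphic_map_holo:
  "holomorphic_map M N F \<Longrightarrow> c \<in> atlas M \<Longrightarrow> d \<in> atlas N \<Longrightarrow>
     holo_on (snd c ` {p \<in> fst c. F p \<in> fst d}) (snd d \<circ> F \<circ> cmap_inv c)"
  by (simp add: holomorphic_map_def)

lemma openin_chart_domain:
  assumes "complex_manifold M" "complex_manifold N" "continuous_map (mtop M) (mtop N) F"
    "c \<in> atlas M" "d \<in> atlas N"
  shows "openin (mtop M) {p \<in> fst c. F p \<in> fst d}"
proof -
  have "openin (mtop M) {p \<in> topspace (mtop M). F p \<in> fst d}"
    using assms(3) complex_manifoldD(4)[OF assms(2,5)] by (auto simp: continuous_map)
  then have "openin (mtop M) (fst c \<inter> {p \<in> topspace (mtop M). F p \<in> fst d})"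
    using complex_manifoldD(4)[OF assms(1,4)] by blast
  moreover have "fst c \<inter> {p \<in> topspace (mtop M). F p \<in> fst d} = {p \<in> fst c. F p \<in> fst d}"
    using chart_subset_topspace[OF assms(1,4)] by auto
  ultimately show ?thesis by simp
qed

lemma open_chart_domain:
  assumes "complex_manifold M" "complex_manifold N" "continuous_map (mtop M) (mtop N) F"
    "c \<in> atlas M" "d \<in> atlas N"
  shows "open (snd c ` {p \<in> fst c. F p \<in> fst d})"
  by (rule open_chart_image[OF assms(1,4) openin_chart_domain[OF assms]]) auto

lemma holomorphic_map_id:
  assumes "complex_manifold M"
  shows "holomorphic_map M M (\<lambda>p. p)"
proof -
  have "{p \<in> fst c. p \<in> fst d} = fst c \<inter> fst d" for c d :: "('a, 'b) chart" by auto
  then show ?thesis using complex_manifoldD(7)[OF assms]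
    by (simp add: holomorphic_map_def o_def)
qed

lemma holomorphic_map_compose:
  assumes M: "complex_manifold M" and N: "complex_manifold N" and P: "complex_manifold P"
    and F: "holomorphic_map M N F" and G: "holomorphic_map N P G"
  shows "holomorphic_map M P (\<lambda>p. G (F p))"
  unfolding holomorphic_map_def
proof (intro conjI ballI)
  note cF = holomorphic_map_continuous[OF F] and cG = holomorphic_map_continuous[OF G]
  show cont: "continuous_map (mtop M) (mtop P) (\<lambda>p. G (F p))"
    using continuous_map_compose[OF cF cG] by (simp add: o_def)
  fix c e assume c: "c \<in> atlas M" and e: "e \<in> atlas P"
  show "holo_on (snd c ` {p \<in> fst c. G (F p) \<in> fst e}) (snd e \<circ> (\<lambda>p. G (F p)) \<circ> cmap_inv c)"
  proof (rule holo_on_local)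
    fix x assume "x \<in> snd c ` {p \<in> fst c. G (F p) \<in> fst e}"
    then obtain p where p: "p \<in> fst c" "G (F p) \<in> fst e" "x = snd c p" by auto
    then have "F p \<in> topspace (mtop N)"
      using chart_subset_topspace[OF M c] cF by (auto simp: continuous_map)
    then obtain d where d: "d \<in> atlas N" "F p \<in> fst d" using chart_at[OF N] by blast
    define W where "W = {p \<in> fst c. F p \<in> fst d} \<inter> {p \<in> fst c. G (F p) \<in> fst e}"
    have W: "openin (mtop M) W"
      unfolding W_def by (intro openin_Int openin_chart_domain[OF M N cF c d(1)]
          openin_chart_domain[OF M P cont c e])
    have oW: "open (snd c ` W)" by (rule open_chart_image[OF M c W]) (auto simp: W_def)
    have 1: "holo_on (snd c ` W) (snd d \<circ> F \<circ> cmap_inv c)"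
      by (rule holo_on_subset[OF _ holomorphic_map_holo[OF F c d(1)]]) (auto simp: W_def)
    have 2: "(snd d \<circ> F \<circ> cmap_inv c) ` (snd c ` W) \<subseteq> snd d ` {p \<in> fst d. G p \<in> fst e}"
      using cmap_inv_left[OF M c] by (auto simp: W_def)
    have "holo_on (snd c ` W) (\<lambda>x. (snd e \<circ> G \<circ> cmap_inv d) ((snd d \<circ> F \<circ> cmap_inv c) x))"
      by (rule holo_on_compose[OF oW open_chart_domain[OF N P cG d(1) e] 2 1
            holomorphic_map_holo[OF G d(1) e]])
    then have "holo_on (snd c ` W) (snd e \<circ> (\<lambda>p. G (F p)) \<circ> cmap_inv c)"
      by (rule holo_on_cong[OF oW, rotated])
         (use cmap_inv_left[OF M c] cmap_inv_left[OF N d(1)] in \<open>auto simp: W_def\<close>)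
    then show "\<exists>T. open T \<and> x \<in> T \<and> holo_on T (snd e \<circ> (\<lambda>p. G (F p)) \<circ> cmap_inv c)"
      using oW p d by (intro exI[of _ "snd c ` W"]) (auto simp: W_def)
  qed
qed

section \<open>Differentials in arbitrary charts\<close>

text \<open>The constant \<^const>\<open>differential\<close> refers to the charts chosen by \<^const>\<open>chart_at\<close>.  With both charts as
parameters, the chain rule can be applied in the charts at hand and the chosen charts drop out.\<close>

definition chart_deriv ::
  "('a, 'm::finite) chart \<Rightarrow> ('b, 'n::finite) chart \<Rightarrow> ('a \<Rightarrow> 'b) \<Rightarrow> 'a \<Rightarrow>
     complex ^ 'm \<Rightarrow> complex ^ 'n" where
  "chart_deriv c d F p = frechet_derivative (snd d \<circ> F \<circ> cmap_inv c) (at (snd c p))"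

lemma chart_deriv_has_derivative:
  assumes "holomorphic_map M N F" "c \<in> atlas M" "d \<in> atlas N" "p \<in> fst c" "F p \<in> fst d"
  shows "((snd d \<circ> F \<circ> cmap_inv c) has_derivative chart_deriv c d F p) (at (snd c p))"
  unfolding chart_deriv_def
  by (rule smooth_on_imp_has_derivative[OF holo_on_imp_smooth_on[OF holomorphic_map_holo[OF assms(1-3)]]])
     (use assms in auto)

lemma chart_deriv_linear:
  assumes "holomorphic_map M N F" "c \<in> atlas M" "d \<in> atlas N" "p \<in> fst c" "F p \<in> fst d"
  shows "linear (chart_deriv c d F p)"
  using chart_deriv_has_derivative[OF assms] has_derivative_linear by blast

lemma chart_deriv_imult:
  assumes "holomorphic_map M N F" "c \<in> atlas M" "d \<in> atlas N" "p \<in> fst c" "F p \<in> fst d"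
  shows "chart_deriv c d F p (imult v) = imult (chart_deriv c d F p v)"
  using holomorphic_map_holo[OF assms(1-3)] assms(4,5) unfolding holo_on_def chart_deriv_def by blast

lemma chart_deriv_cong:
  assumes M: "complex_manifold M" "c \<in> atlas M" and "p \<in> fst c" "openin (mtop M) W" "p \<in> W"
    and eq: "\<And>p'. p' \<in> W \<Longrightarrow> p' \<in> fst c \<Longrightarrow> F p' = G p'"
  shows "chart_deriv c d F p = chart_deriv c d G p"
  unfolding chart_deriv_def
proof (rule frechet_derivative_cong_open)
  show "open (snd c ` (fst c \<inter> W))"
    by (rule open_chart_image[OF M]) (use assms complex_manifoldD(4)[OF M] in auto)
qed (use assms cmap_inv_left[OF M] in auto)

lemma chart_deriv_compose:
  assumes M: "complex_manifold M" and N: "complex_manifold N"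
    and F: "holomorphic_map M N F" and G: "holomorphic_map N P G"
    and c: "c \<in> atlas M" and d: "d \<in> atlas N" and e: "e \<in> atlas P"
    and p: "p \<in> fst c" "F p \<in> fst d" "G (F p) \<in> fst e"
  shows "chart_deriv c e (\<lambda>p. G (F p)) p u = chart_deriv d e G (F p) (chart_deriv c d F p u)"
proof -
  have v: "(snd d \<circ> F \<circ> cmap_inv c) (snd c p) = snd d (F p)" using cmap_inv_left[OF M c p(1)] by simp
  have D: "(((snd e \<circ> G \<circ> cmap_inv d) \<circ> (snd d \<circ> F \<circ> cmap_inv c)) has_derivative
      (chart_deriv d e G (F p) \<circ> chart_deriv c d F p)) (at (snd c p))"
    by (rule diff_chain_at[OF chart_deriv_has_derivative[OF F c d p(1,2)]])
       (use chart_deriv_has_derivative[OF G d e p(2,3)] in \<open>simp only: v\<close>)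
  have "frechet_derivative (snd e \<circ> (\<lambda>p. G (F p)) \<circ> cmap_inv c) (at (snd c p)) =
      frechet_derivative ((snd e \<circ> G \<circ> cmap_inv d) \<circ> (snd d \<circ> F \<circ> cmap_inv c)) (at (snd c p))"
  proof (rule frechet_derivative_cong_open)
    show "open (snd c ` {p \<in> fst c. F p \<in> fst d})"
      by (rule open_chart_domain[OF M N holomorphic_map_continuous[OF F] c d])
  qed (use p cmap_inv_left[OF M c] cmap_inv_left[OF N d] in auto)
  then show ?thesis unfolding chart_deriv_def[of c e] using frechet_derivative_eqI[OF D] by simp
qed

lemma chart_deriv_id:
  assumes "complex_manifold M" "c \<in> atlas M" "p \<in> fst c"
  shows "chart_deriv c c (\<lambda>p. p) p u = u"
proof -
  have "frechet_derivative (snd c \<circ> (\<lambda>p. p) \<circ> cmap_inv c) (at (snd c p)) = frechet_derivative (\<lambda>x. x) (at (snd c p))"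
    by (rule frechet_derivative_cong_open[OF complex_manifoldD(5)[OF assms(1,2)]])
       (use assms cmap_inv_left[OF assms(1,2)] in \<open>auto simp: cmap_image_def\<close>)
  then show ?thesis by (simp add: chart_deriv_def)
qed

lemma chart_deriv_inverse:
  assumes M: "complex_manifold M" and N: "complex_manifold N"
    and F: "holomorphic_map M N F" and G: "holomorphic_map N M G"
    and c: "c \<in> atlas M" and d: "d \<in> atlas N" and p: "p \<in> fst c" "F p \<in> fst d"
    and GF: "\<And>p. p \<in> topspace (mtop M) \<Longrightarrow> G (F p) = p"
  shows "chart_deriv d c G (F p) (chart_deriv c d F p u) = u"
proof -
  have GFp: "G (F p) = p" using GF p(1) chart_subset_topspace[OF M c] by blast
  have "chart_deriv c c (\<lambda>p. G (F p)) p = chart_deriv c c (\<lambda>p. p) p"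
    by (rule chart_deriv_cong[OF M c p(1) complex_manifoldD(4)[OF M c] p(1)])
       (use GF chart_subset_topspace[OF M c] in blast)
  then show ?thesis
    using chart_deriv_compose[OF M N F G c d c p] chart_deriv_id[OF M c p(1)] p GFp by simp
qed

lemma transition_inverse:
  assumes "complex_manifold M" "c \<in> atlas M" "d \<in> atlas M" "p \<in> fst c" "p \<in> fst d"
  shows "chart_deriv d c (\<lambda>p. p) p (chart_deriv c d (\<lambda>p. p) p u) = u"
  using chart_deriv_inverse[OF assms(1,1) holomorphic_map_id[OF assms(1)] holomorphic_map_id[OF assms(1)]
    assms(2-4)] assms(5) by blast

section \<open>Fields of bilinear forms in charts\<close>

lemma coord_form_chart_deriv:
  assumes "complex_manifold M" "c \<in> atlas M" "p \<in> fst c"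
  shows "coord_form M g c (snd c p) u v =
     g p (chart_deriv c (chart_at M p) (\<lambda>p. p) p u) (chart_deriv c (chart_at M p) (\<lambda>p. p) p v)"
  using cmap_inv_left[OF assms] by (simp add: coord_form_def chart_deriv_def Let_def o_def)

lemma differential_chart_deriv:
  "differential M N F p = chart_deriv (chart_at M p) (chart_at N (F p)) F p"
  by (simp add: differential_def chart_deriv_def)

text \<open>This is the tensorial behaviour of a pullback, for charts which need not be the chosen ones.\<close>

lemma coord_form_pullback:
  assumes M: "complex_manifold M" and N: "complex_manifold N" and F: "holomorphic_map M N F"
    and c: "c \<in> atlas M" and d: "d \<in> atlas N" and p: "p \<in> fst c" "F p \<in> fst d"
  shows "coord_form M (pullback M N F h) c (snd c p) u v =
     coord_form N h d (snd d (F p)) (chart_deriv c d F p u) (chart_deriv c d F p v)"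
proof -
  let ?c = "chart_at M p" and ?d = "chart_at N (F p)"
  note iM = holomorphic_map_id[OF M] and iN = holomorphic_map_id[OF N]
  have pt: "p \<in> topspace (mtop M)" "F p \<in> topspace (mtop N)"
    using p chart_subset_topspace[OF M c] chart_subset_topspace[OF N d] by auto
  note c' = chart_at[OF M pt(1)] and d' = chart_at[OF N pt(2)]
  have "chart_deriv ?c ?d F p (chart_deriv c ?c (\<lambda>p. p) p w) =
      chart_deriv d ?d (\<lambda>p. p) (F p) (chart_deriv c d F p w)" for w
    using chart_deriv_compose[OF M M iM F c c'(1) d'(1) p(1) c'(2) d'(2)]
      chart_deriv_compose[OF M N F iN c d d'(1) p d'(2)] by simp
  then show ?thesis
    by (simp add: coord_form_chart_deriv[OF M c p(1)] coord_form_chart_deriv[OF N d p(2)]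
        pullback_def differential_chart_deriv)
qed

lemma coord_form_transition:
  assumes M: "complex_manifold M" and c: "c \<in> atlas M" and d: "d \<in> atlas M"
    and p: "p \<in> fst c" "p \<in> fst d"
  shows "coord_form M g d (snd d p) (chart_deriv c d (\<lambda>p. p) p u) (chart_deriv c d (\<lambda>p. p) p v) =
     coord_form M g c (snd c p) u v"
proof -
  have "p \<in> topspace (mtop M)" using p chart_subset_topspace[OF M c] by auto
  note c' = chart_at[OF M this]
  show ?thesis
    using chart_deriv_compose[OF M M holomorphic_map_id[OF M] holomorphic_map_id[OF M] c d c'(1) p c'(2)]
    by (simp add: coord_form_chart_deriv[OF M c p(1)] coord_form_chart_deriv[OF M d p(2)])
qed

lemma coord_form_chart_at:
  assumes "complex_manifold M" "p \<in> topspace (mtop M)"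
  shows "coord_form M g (chart_at M p) (snd (chart_at M p) p) u v = g p u v"
  using chart_at[OF assms] chart_deriv_id[OF assms(1)] coord_form_chart_deriv[OF assms(1)] by simp

lemma pullback_compose:
  assumes M: "complex_manifold M" and N: "complex_manifold N" and P: "complex_manifold P"
    and F: "holomorphic_map M N F" and G: "holomorphic_map N P G" and p: "p \<in> topspace (mtop M)"
  shows "pullback M N F (pullback N P G h) p u v = pullback M P (\<lambda>p. G (F p)) h p u v"
proof -
  have p': "F p \<in> topspace (mtop N)" "G (F p) \<in> topspace (mtop P)"
    using holomorphic_map_continuous[OF F] holomorphic_map_continuous[OF G] p
    by (auto simp: continuous_map)
  note c = chart_at[OF M p] and d = chart_at[OF N p'(1)] and e = chart_at[OF P p'(2)]
  show ?thesis
    using chart_deriv_compose[OF M N F G c(1) d(1) e(1) c(2) d(2) e(2)]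
    by (simp add: pullback_def differential_chart_deriv)
qed

lemma hermitian_metricD:
  assumes "hermitian_metric M g" "p \<in> topspace (mtop M)"
  shows "bilinear (g p)" "g p u v = g p v u" "u \<noteq> 0 \<Longrightarrow> g p u u > 0"
    "g p (imult u) (imult v) = g p u v"
  using assms unfolding hermitian_metric_def by blast+

definition hermitian_form :: "(complex ^ 'n::finite \<Rightarrow> complex ^ 'n \<Rightarrow> real) \<Rightarrow> bool" where
  "hermitian_form b \<longleftrightarrow> bilinear b \<and> (\<forall>u v. b u v = b v u) \<and> (\<forall>u. u \<noteq> 0 \<longrightarrow> b u u > 0) \<and>
     (\<forall>u v. b (imult u) (imult v) = b u v)"

lemma hermitian_form_coord_form:
  assumes M: "complex_manifold M" and g: "hermitian_metric M g" and c: "c \<in> atlas M"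
    and x: "x \<in> cmap_image c"
  shows "hermitian_form (coord_form M g c x)"
proof -
  define p where "p = cmap_inv c x"
  have p: "p \<in> fst c" "snd c p = x" unfolding p_def using x by (simp_all add: cmap_inv_in cmap_inv_right)
  then have pt: "p \<in> topspace (mtop M)" using chart_subset_topspace[OF M c] by auto
  note c' = chart_at[OF M pt] and i = holomorphic_map_id[OF M]
  let ?A = "chart_deriv c (chart_at M p) (\<lambda>p. p) p"
  have lin: "linear ?A" by (rule chart_deriv_linear[OF i c c'(1) p(1) c'(2)])
  have cx: "?A (imult v) = imult (?A v)" for v by (rule chart_deriv_imult[OF i c c'(1) p(1) c'(2)])
  have nz: "?A u \<noteq> 0" if "u \<noteq> 0" for u
  proof
    assume "?A u = 0"
    moreover have "linear (chart_deriv (chart_at M p) c (\<lambda>p. p) p)"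
      by (rule chart_deriv_linear[OF i c'(1) c c'(2) p(1)])
    ultimately have "u = 0"
      using transition_inverse[OF M c c'(1) p(1) c'(2), of u] by (simp add: linear_0)
    then show False using that by simp
  qed
  have eq: "coord_form M g c x = (\<lambda>u v. g p (?A u) (?A v))"
    using coord_form_chart_deriv[OF M c p(1)] p(2) by (intro ext) simp
  note gp = hermitian_metricD[OF g pt]
  have "bilinear (\<lambda>u v. g p (?A u) (?A v))"
    using gp(1) lin unfolding bilinear_def by (auto intro: linear_compose[unfolded o_def])
  then show ?thesis unfolding hermitian_form_def eq using gp cx nz by auto
qed


section \<open>Traces\<close>

definition lin_trace :: "('v::euclidean_space \<Rightarrow> 'v) \<Rightarrow> real" where
  "lin_trace L = (\<Sum>b\<in>Basis. L b \<bullet> b)"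

text \<open>Both sides are the sum of the products of the matrix entries of \<open>f\<close> and \<open>g\<close>.  The two spaces may differ,
so that the trace of a map factoring through a projection is a trace on the smaller space.\<close>

lemma lin_trace_cyclic:
  fixes f :: "'v::euclidean_space \<Rightarrow> 'w::euclidean_space"
  assumes "linear f" "linear g"
  shows "lin_trace (\<lambda>x. g (f x)) = lin_trace (\<lambda>y. f (g y))"
proof -
  have expand: "k (h b) \<bullet> b = (\<Sum>c\<in>Basis. (h b \<bullet> c) * (k c \<bullet> b))"
    if "linear k" for h :: "'x::euclidean_space \<Rightarrow> 'y::euclidean_space" and k b
  proof -
    have "k (h b) = k (\<Sum>c\<in>Basis. (h b \<bullet> c) *\<^sub>R c)" by (simp add: euclidean_representation)
    also have "\<dots> = (\<Sum>c\<in>Basis. (h b \<bullet> c) *\<^sub>R k c)" by (simp add: linear_sum[OF that] linear_cmul[OF that])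
    finally show ?thesis by (simp add: inner_sum_left)
  qed
  have "lin_trace (\<lambda>x. g (f x)) = (\<Sum>b\<in>Basis. \<Sum>c\<in>Basis. (f b \<bullet> c) * (g c \<bullet> b))"
    unfolding lin_trace_def by (rule sum.cong[OF refl], rule expand[OF assms(2)])
  also have "\<dots> = (\<Sum>c\<in>Basis. \<Sum>b\<in>Basis. (g c \<bullet> b) * (f b \<bullet> c))"
    by (subst sum.swap) (simp add: mult.commute)
  also have "\<dots> = lin_trace (\<lambda>y. f (g y))"
    unfolding lin_trace_def by (rule sum.cong[OF refl], rule expand[OF assms(1), symmetric])
  finally show ?thesis .
qed

lemma orthonormal_frame_expansion:
  fixes b :: "'v::euclidean_space \<Rightarrow> 'v \<Rightarrow> real"
  assumes b: "bilinear b" and E: "orthonormal_frame b E"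
  shows "(\<Sum>e\<in>E. b x e *\<^sub>R e) = x"
proof -
  have fin: "finite E" and card: "card E = DIM('v)"
    and on: "\<And>e e'. e \<in> E \<Longrightarrow> e' \<in> E \<Longrightarrow> b e e' = (if e = e' then 1 else 0)"
    using E by (auto simp: orthonormal_frame_def)
  have coeff: "b (\<Sum>e\<in>E. a e *\<^sub>R e) e' = a e'" if "e' \<in> E" for a e'
  proof -
    have "linear (\<lambda>x. b x e')" using b by (simp add: bilinear_def)
    then have "b (\<Sum>e\<in>E. a e *\<^sub>R e) e' = (\<Sum>e\<in>E. a e * b e e')"
      by (simp add: linear_sum[of "\<lambda>x. b x e'"] linear_cmul[of "\<lambda>x. b x e'"])
    also have "\<dots> = (\<Sum>e\<in>E. if e = e' then a e else 0)"
      by (rule sum.cong) (use on that in auto)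
    also have "\<dots> = a e'" using fin that by simp
    finally show ?thesis .
  qed
  have "independent E"
  proof (rule independent_if_scalars_zero[OF fin])
    fix a e assume "(\<Sum>e\<in>E. a e *\<^sub>R e) = 0" "e \<in> E"
    then show "a e = 0" using coeff[of e a] bilinear_lzero[OF b] by simp
  qed
  then have "UNIV \<subseteq> span E" by (rule card_ge_dim_independent[rotated]) (simp_all add: card)
  then obtain a where a: "x = (\<Sum>e\<in>E. a e *\<^sub>R e)" using span_finite[OF fin] by auto
  then show ?thesis using coeff by simp
qed

text \<open>The Bismut Ricci form is half a sum of the kind on the left; by the right side it depends neither on the frame
nor on the metric.\<close>

lemma lin_trace_orthonormal_frame:
  fixes b :: "'v::euclidean_space \<Rightarrow> 'v \<Rightarrow> real"
  assumes b: "bilinear b" and E: "orthonormal_frame b E" and L: "linear L"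
  shows "(\<Sum>e\<in>E. b (L e) e) = lin_trace L"
proof -
  have l: "linear (\<lambda>x. b (L x) e)" for e
    using b L linear_compose[of L "\<lambda>x. b x e"] by (simp add: bilinear_def o_def)
  have "lin_trace L = (\<Sum>i\<in>Basis. \<Sum>e\<in>E. b (L i) e * (e \<bullet> i))"
    unfolding lin_trace_def
    by (rule sum.cong[OF refl], subst orthonormal_frame_expansion[OF b E, symmetric])
       (simp add: inner_sum_left)
  also have "\<dots> = (\<Sum>e\<in>E. \<Sum>i\<in>Basis. (e \<bullet> i) * b (L i) e)"
    by (subst sum.swap) (simp add: mult.commute)
  also have "\<dots> = (\<Sum>e\<in>E. b (L (\<Sum>i\<in>Basis. (e \<bullet> i) *\<^sub>R i)) e)"
    by (simp add: linear_sum[OF l] linear_cmul[OF l])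
  finally show ?thesis by (simp add: euclidean_representation)
qed

section \<open>Uniqueness of the Bismut connection\<close>

lemma cov_deriv_const: "cov_deriv \<Gamma> c (\<lambda>_. u) (\<lambda>_. v) = (\<lambda>x. \<Gamma> c x u v)"
  by (simp add: cov_deriv_def fun_eq_iff)

lemma torsion_eq: "torsion \<Gamma> c x u v = \<Gamma> c x u v - \<Gamma> c x v u"
  by (simp add: torsion_def cov_deriv_const)

text \<open>In contrast to \<^const>\<open>curvature\<close> no chart is mentioned, so the summands on \<open>K\<close> and on \<open>\<complex>\<^sup>2 - {0}\<close> and
their sum can be treated alike.\<close>

definition coord_curvature ::
  "('v::euclidean_space \<Rightarrow> 'v \<Rightarrow> 'v \<Rightarrow> 'v) \<Rightarrow> 'v \<Rightarrow> 'v \<Rightarrow> 'v \<Rightarrow> 'v \<Rightarrow> 'v" where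
  "coord_curvature G x u v w =
     frechet_derivative (\<lambda>y. G y v w) (at x) u + G x u (G x v w)
     - (frechet_derivative (\<lambda>y. G y u w) (at x) v + G x v (G x u w))"

lemma curvature_eq: "curvature \<Gamma> c = coord_curvature (\<Gamma> c)"
  by (intro ext) (simp add: curvature_def coord_curvature_def cov_deriv_const, simp add: cov_deriv_def)

lemma coord_curvature_cong:
  assumes "open S" "x \<in> S" "\<And>y u v. y \<in> S \<Longrightarrow> G y u v = G' y u v"
  shows "coord_curvature G x u v w = coord_curvature G' x u v w"
proof -
  have "frechet_derivative (\<lambda>y. G y u v) (at x) = frechet_derivative (\<lambda>y. G' y u v) (at x)" for u v
    by (rule frechet_derivative_cong_open[OF assms(1,2)]) (rule assms(3))
  then show ?thesis using assms(3)[OF assms(2)] by (simp add: coord_curvature_def)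
qed

text \<open>The first two identities make \<open>a\<close> alternating.  By the third one, \<open>\<i>\<close> may be moved from one argument to
another at the cost of a sign; moving it once around all three arguments yields \<open>a = - a\<close>.\<close>

lemma skew_complex_trilinear_zero:
  fixes a :: "complex ^ 'n::finite \<Rightarrow> complex ^ 'n \<Rightarrow> complex ^ 'n \<Rightarrow> real"
  assumes 1: "\<And>u v w. a u v w = - a u w v"
    and 2: "\<And>u v w. a u v w - a v u w = - (a u w v - a w u v)"
    and 3: "\<And>u v w. a u (imult v) w = - a u v (imult w)"
  shows "a u v w = 0"
proof -
  have 13: "a u v w = - a w v u" for u v w using 1[of u v w] 1[of v u w] 1[of w u v] 2[of u v w] 2[of v u w] 2[of v w u] 1[of v w u] by linarith
  have 12: "a u v w = - a v u w" for u v w using 13 1 by metis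
  have z: "a u v (imult w) = 0" for u v w
    using 3[of u v w] 12[of "imult u" v w] 3[of v u w] 12[of v u "imult w"]
      13[of "imult u" v w] 3[of w v u] 13[of w "imult v" u] by (smt (verit))
  have "imult (- imult w) = w"
    by (simp add: vec_eq_iff)
  then show ?thesis using z[of u v "- imult w"] by simp
qed

lemma hermitian_formD:
  assumes "hermitian_form b"
  shows "bilinear b" "b u v = b v u" "u \<noteq> 0 \<Longrightarrow> b u u > 0" "b (imult u) (imult v) = b u v"
proof -
  note h = assms[unfolded hermitian_form_def]
  show "bilinear b" using h by (rule conjunct1)
  show "b u v = b v u" using h[THEN conjunct2, THEN conjunct1] by (elim allE)
  show "b u u > 0" if "u \<noteq> 0" using h[THEN conjunct2, THEN conjunct2, THEN conjunct1] that by simp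
  show "b (imult u) (imult v) = b u v" using h[THEN conjunct2, THEN conjunct2, THEN conjunct2] by (elim allE)
qed

lemma hermitian_form_imult_left:
  assumes "hermitian_form b"
  shows "b (imult u) v = - b u (imult v)"
proof -
  have "b (imult u) v = b (imult (imult u)) (imult v)"
    using assms unfolding hermitian_form_def by metis
  also have "imult (imult u) = - u" by (simp add: vec_eq_iff)
  also have "b (- u) (imult v) = - b u (imult v)"
    using assms by (intro bilinear_lneg) (simp add: hermitian_form_def)
  finally show ?thesis .
qed

lemma hermitian_form_nondegenerate:
  assumes "hermitian_form b" "\<And>w. b u w = 0"
  shows "u = 0"
  using assms(1) assms(2)[of u] by (auto simp: hermitian_form_def)

text \<open>The difference of two Bismut connections satisfies the hypotheses on \<open>A\<close>: both are metric, both have skew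
torsion, both commute with \<open>\<i>\<close>.  The map \<open>D\<close> is the derivative of a change of charts along which the second
connection has been pulled back.\<close>

lemma bismut_difference_zero:
  fixes b :: "complex ^ 'n::finite \<Rightarrow> complex ^ 'n \<Rightarrow> real" and D :: "complex ^ 'm::finite \<Rightarrow> complex ^ 'n"
  assumes b: "hermitian_form b" and D: "surj D" "\<And>v. D (imult v) = imult (D v)"
    and 1: "\<And>u v w. b (A u v) (D w) = - b (A u w) (D v)"
    and 2: "\<And>u v w. b (A u v - A v u) (D w) = - b (A u w - A w u) (D v)"
    and 3: "\<And>u v. A u (imult v) = imult (A u v)"
  shows "A u v = 0"
proof (rule hermitian_form_nondegenerate[OF b])
  have bil: "bilinear b" using b by (simp add: hermitian_form_def)
  fix w
  obtain w' where w': "w = D w'" using D(1) by (meson surjD)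
  have "b (A u v) (D w') = 0"
  proof (rule skew_complex_trilinear_zero[of "\<lambda>u v w. b (A u v) (D w)"])
    show "b (A u v) (D w) = - b (A u w) (D v)" for u v w by (rule 1)
    show "b (A u v) (D w) - b (A v u) (D w) = - (b (A u w) (D v) - b (A w u) (D v))" for u v w
      using 2[of u v w] by (simp add: bilinear_lsub[OF bil])
    show "b (A u (imult v)) (D w) = - b (A u v) (D (imult w))" for u v w
      by (simp add: 3 D(2) hermitian_form_imult_left[OF b])
  qed
  then show "b (A u v) w = 0" by (simp add: w')
qed

lemma bilinear_expansion:
  fixes B :: "'v::euclidean_space \<Rightarrow> 'w::euclidean_space \<Rightarrow> real"
  assumes "bilinear B"
  shows "B a b = (\<Sum>i\<in>Basis. \<Sum>j\<in>Basis. (a \<bullet> i) * (b \<bullet> j) * B i j)"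
proof -
  have "B a b = B (\<Sum>i\<in>Basis. (a \<bullet> i) *\<^sub>R i) (\<Sum>j\<in>Basis. (b \<bullet> j) *\<^sub>R j)"
    by (simp add: euclidean_representation)
  also have "\<dots> = (\<Sum>i\<in>Basis. \<Sum>j\<in>Basis. B ((a \<bullet> i) *\<^sub>R i) ((b \<bullet> j) *\<^sub>R j))"
    by (subst bilinear_sum[OF assms]) (simp add: sum.cartesian_product)
  also have "\<dots> = (\<Sum>i\<in>Basis. \<Sum>j\<in>Basis. (a \<bullet> i) * (b \<bullet> j) * B i j)"
    by (simp add: bilinear_lmul[OF assms] bilinear_rmul[OF assms] mult.assoc mult.left_commute)
  finally show ?thesis .
qed

text \<open>Of the field \<open>B\<close> only the values on constant vectors are known to be differentiable.  Expanding the moving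
vectors \<open>f y\<close> and \<open>g y\<close> in the standard basis reduces the claim to the ordinary product rule.\<close>

lemma has_derivative_bilinear_field:
  fixes B :: "'x::euclidean_space \<Rightarrow> 'v::euclidean_space \<Rightarrow> 'v \<Rightarrow> real" and \<tau> :: "'y::euclidean_space \<Rightarrow> 'x"
  assumes V: "open V" and U: "open U" "y \<in> U" "\<tau> ` U \<subseteq> V"
    and bil: "\<And>z. z \<in> V \<Longrightarrow> bilinear (B z)"
    and diff: "\<And>a b. (\<lambda>z. B z a b) differentiable (at (\<tau> y))"
    and \<tau>: "(\<tau> has_derivative \<tau>') (at y)" and f: "(f has_derivative f') (at y)"
    and g: "(g has_derivative g') (at y)"
  shows "((\<lambda>y. B (\<tau> y) (f y) (g y)) has_derivative
     (\<lambda>u. frechet_derivative (\<lambda>z. B z (f y) (g y)) (at (\<tau> y)) (\<tau>' u) +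
          B (\<tau> y) (f' u) (g y) + B (\<tau> y) (f y) (g' u))) (at y)"
proof -
  have yV: "\<tau> y \<in> V" using U by auto
  define dB where "dB i j = frechet_derivative (\<lambda>z. B z i j) (at (\<tau> y))" for i j
  have dB: "((\<lambda>z. B z i j) has_derivative dB i j) (at (\<tau> y))" for i j
    unfolding dB_def using diff frechet_derivative_works by blast
  have dBexp: "dB a b w = (\<Sum>i\<in>Basis. \<Sum>j\<in>Basis. (a \<bullet> i) * (b \<bullet> j) * dB i j w)" for a b w
  proof -
    have 1: "((\<lambda>z. \<Sum>i\<in>Basis. \<Sum>j\<in>Basis. (a \<bullet> i) * (b \<bullet> j) * B z i j) has_derivative
        (\<lambda>w. \<Sum>i\<in>Basis. \<Sum>j\<in>Basis. (a \<bullet> i) * (b \<bullet> j) * dB i j w)) (at (\<tau> y))"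
      by (rule has_derivative_sum)+ (rule has_derivative_mult_right[OF dB])
    have 2: "dB a b = frechet_derivative (\<lambda>z. \<Sum>i\<in>Basis. \<Sum>j\<in>Basis. (a \<bullet> i) * (b \<bullet> j) * B z i j) (at (\<tau> y))"
      unfolding dB_def by (rule frechet_derivative_cong_open[OF V yV]) (rule bilinear_expansion[OF bil])
    show ?thesis unfolding 2 frechet_derivative_eqI[OF 1] ..
  qed
  have prod_der: "((\<lambda>y. (f y \<bullet> i) * (g y \<bullet> j) * B (\<tau> y) i j) has_derivative
     (\<lambda>u. (f y \<bullet> i) * (g y \<bullet> j) * dB i j (\<tau>' u) +
        ((f y \<bullet> i) * (g' u \<bullet> j) + (f' u \<bullet> i) * (g y \<bullet> j)) * B (\<tau> y) i j)) (at y)" for i j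
    by (rule has_derivative_mult[OF has_derivative_mult[OF has_derivative_inner_left[OF f]
          has_derivative_inner_left[OF g]] has_derivative_compose[OF \<tau> dB]])
  have "((\<lambda>y. \<Sum>i\<in>Basis. \<Sum>j\<in>Basis. (f y \<bullet> i) * (g y \<bullet> j) * B (\<tau> y) i j) has_derivative
     (\<lambda>u. \<Sum>i\<in>Basis. \<Sum>j\<in>Basis. (f y \<bullet> i) * (g y \<bullet> j) * dB i j (\<tau>' u) +
        ((f y \<bullet> i) * (g' u \<bullet> j) + (f' u \<bullet> i) * (g y \<bullet> j)) * B (\<tau> y) i j)) (at y)"
    by (rule has_derivative_sum, rule has_derivative_sum, rule prod_der)
  then have "((\<lambda>y. B (\<tau> y) (f y) (g y)) has_derivative
     (\<lambda>u. \<Sum>i\<in>Basis. \<Sum>j\<in>Basis. (f y \<bullet> i) * (g y \<bullet> j) * dB i j (\<tau>' u) +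
        ((f y \<bullet> i) * (g' u \<bullet> j) + (f' u \<bullet> i) * (g y \<bullet> j)) * B (\<tau> y) i j)) (at y)"
  proof (rule has_derivative_transform_within_open[OF _ U(1,2)])
    fix z assume "z \<in> U"
    then have "\<tau> z \<in> V" using U(3) by auto
    from bilinear_expansion[OF bil[OF this], of "f z" "g z"]
    show "(\<Sum>i\<in>Basis. \<Sum>j\<in>Basis. (f z \<bullet> i) * (g z \<bullet> j) * B (\<tau> z) i j) = B (\<tau> z) (f z) (g z)" by simp
  qed
  moreover have "(\<Sum>i\<in>Basis. \<Sum>j\<in>Basis. (f y \<bullet> i) * (g y \<bullet> j) * dB i j (\<tau>' u) +
        ((f y \<bullet> i) * (g' u \<bullet> j) + (f' u \<bullet> i) * (g y \<bullet> j)) * B (\<tau> y) i j) =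
      dB (f y) (g y) (\<tau>' u) + B (\<tau> y) (f' u) (g y) + B (\<tau> y) (f y) (g' u)" for u
    unfolding dBexp[of "f y" "g y"] bilinear_expansion[OF bil[OF yV], of "f' u" "g y"]
      bilinear_expansion[OF bil[OF yV], of "f y" "g' u"]
    by (simp add: sum.distrib algebra_simps)
  ultimately show ?thesis unfolding dB_def by simp
qed

lemma metric_connectionD:
  assumes "metric_connection M h \<Gamma>" "c \<in> atlas M" "x \<in> cmap_image c"
  shows "frechet_derivative (\<lambda>y. coord_form M h c y v w) (at x) u =
    coord_form M h c x (\<Gamma> c x u v) w + coord_form M h c x v (\<Gamma> c x u w)"
  using assms(1)[unfolded metric_connection_def cov_deriv_const, rule_format, OF assms(2,3)] .

lemma complex_connectionD:
  assumes "complex_connection M \<Gamma>" "c \<in> atlas M" "x \<in> cmap_image c"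
  shows "\<Gamma> c x u (imult v) = imult (\<Gamma> c x u v)"
  using assms(1)[unfolded complex_connection_def cov_deriv_const, rule_format, OF assms(2,3)] .

lemma skew_torsionD:
  assumes "skew_torsion M h \<Gamma>" "c \<in> atlas M" "x \<in> cmap_image c"
  shows "coord_form M h c x (\<Gamma> c x u v - \<Gamma> c x v u) w =
    - coord_form M h c x (\<Gamma> c x u w - \<Gamma> c x w u) v"
  using assms(1)[unfolded skew_torsion_def torsion_eq, rule_format, OF assms(2,3)] .

lemma hermitian_metric_differentiable:
  assumes "hermitian_metric M h" "c \<in> atlas M" "x \<in> cmap_image c"
  shows "(\<lambda>y. coord_form M h c y u v) differentiable (at x)"
proof -
  have "smooth_on (cmap_image c) (\<lambda>y. coord_form M h c y u v)"
    using assms(1,2) unfolding hermitian_metric_def by blast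
  then show ?thesis using assms(3) by (rule smooth_on_imp_differentiable)
qed

text \<open>A change of charts \<open>\<tau>\<close> is a holomorphic isometry between the coordinate expressions of the metric, so the
connection pulled back along \<open>\<tau>\<close> is again a Bismut connection for \<open>h\<close> and must agree with the given one.
Differentiating the isometry identity yields that the difference \<open>A\<close> is metric; the second derivative of
\<open>\<tau>\<close> does not contribute to the torsion because it is symmetric, and it commutes with \<open>\<i>\<close> because \<open>\<tau>\<close> is
holomorphic.\<close>

lemma bismut_transformation:
  fixes M :: "('a, 'n::finite) cmfd"
  assumes M: "complex_manifold M" and h: "hermitian_metric M h"
    and metric: "metric_connection M h \<Gamma>" and complex: "complex_connection M \<Gamma>"
    and skew: "skew_torsion M h \<Gamma>"
    and c: "c \<in> atlas M" and d: "d \<in> atlas M" and x: "x \<in> snd c ` (fst c \<inter> fst d)"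
  defines "\<tau> \<equiv> snd d \<circ> cmap_inv c"
  defines "D \<equiv> \<lambda>y. frechet_derivative \<tau> (at y)"
  shows "D x (\<Gamma> c x u v) = frechet_derivative (\<lambda>y. D y v) (at x) u + \<Gamma> d (\<tau> x) (D x u) (D x v)"
proof -
  let ?U = "snd c ` (fst c \<inter> fst d)" and ?V = "cmap_image d"
  let ?B = "coord_form M h c" and ?C = "coord_form M h d"
  have setU: "?U = snd c ` {p \<in> fst c. p \<in> fst d}" by auto
  have U: "open ?U" unfolding setU
    using open_chart_domain[OF M M holomorphic_map_continuous[OF holomorphic_map_id[OF M]] c d] by simp
  have V: "open ?V" by (rule complex_manifoldD(5)[OF M d])
  have \<tau>V: "\<tau> ` ?U \<subseteq> ?V" using cmap_inv_left[OF M c] by (auto simp: \<tau>_def cmap_image_def)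
  have holo: "holo_on ?U \<tau>" unfolding \<tau>_def by (rule complex_manifoldD(7)[OF M c d])
  note smooth = holo_on_imp_smooth_on[OF holo]
  have xc: "x \<in> cmap_image c" using x by (auto simp: cmap_image_def)
  have xd: "\<tau> x \<in> ?V" using \<tau>V x by blast
  have Dchart: "D y = chart_deriv c d (\<lambda>p. p) (cmap_inv c y)" if "y \<in> ?U" for y
    using that cmap_inv_left[OF M c] by (auto simp: D_def \<tau>_def chart_deriv_def o_def)
  have iso: "?B y a b = ?C (\<tau> y) (D y a) (D y b)" if "y \<in> ?U" for y a b
  proof -
    obtain p where p: "p \<in> fst c" "p \<in> fst d" "y = snd c p" using \<open>y \<in> ?U\<close> by auto
    then show ?thesis
      using coord_form_transition[OF M c d p(1,2), of h a b] cmap_inv_left[OF M c p(1)] Dchart[OF \<open>y \<in> ?U\<close>]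
      by (simp add: \<tau>_def)
  qed
  have bij: "surj (D x)"
  proof -
    obtain p where p: "p \<in> fst c" "p \<in> fst d" "x = snd c p" using x by auto
    have "D x (chart_deriv d c (\<lambda>p. p) p w) = w" for w
      using transition_inverse[OF M d c p(2,1)] Dchart[OF x] cmap_inv_left[OF M c p(1)] p(3) by simp
    then show ?thesis by (metis surjI)
  qed
  have linD: "linear (D y)" if "y \<in> ?U" for y
    unfolding D_def by (rule linear_frechet_derivative[OF smooth_on_imp_differentiable[OF smooth that]])
  have cxD: "D y (imult a) = imult (D y a)" if "y \<in> ?U" for y a
    using holo that unfolding holo_on_def D_def by blast
  have \<tau>der: "(\<tau> has_derivative D x) (at x)"
    unfolding D_def by (rule smooth_on_imp_has_derivative[OF smooth x])
  define D2 where "D2 a b = frechet_derivative (\<lambda>y. D y b) (at x) a" for a b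
  have smoothD: "smooth_on ?U (\<lambda>y. D y a)" for a unfolding D_def by (rule smooth_on_derivative[OF smooth])
  have derD: "((\<lambda>y. D y a) has_derivative (\<lambda>b. D2 b a)) (at x)" for a
    unfolding D2_def by (rule smooth_on_imp_has_derivative[OF smoothD x])
  have symD2: "D2 a b = D2 b a" for a b
    unfolding D2_def D_def by (rule second_derivative_symmetric[OF U x smooth])
  have cxD2: "D2 a (imult b) = imult (D2 a b)" for a b
  proof -
    have "frechet_derivative (\<lambda>y. D y (imult b)) (at x) = frechet_derivative (\<lambda>y. imult (D y b)) (at x)"
      by (rule frechet_derivative_cong_open[OF U x]) (rule cxD)
    also have "\<dots> = (\<lambda>a. imult (D2 a b))"
    proof (rule frechet_derivative_eqI)
      have "linear (imult :: complex ^ 'n \<Rightarrow> _)"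
        by (rule linearI) (auto simp: vec_eq_iff algebra_simps scaleR_conv_of_real)
      from linear_imp_has_derivative[OF this] derD[of b]
      show "((\<lambda>y. imult (D y b)) has_derivative (\<lambda>a. imult (D2 a b))) (at x)"
        using has_derivative_compose by blast
    qed
    finally show ?thesis by (simp add: D2_def)
  qed
  have hB: "hermitian_form (?B x)" by (rule hermitian_form_coord_form[OF M h c xc])
  have hC: "hermitian_form (?C z)" if "z \<in> ?V" for z by (rule hermitian_form_coord_form[OF M h d that])
  note bilC = hermitian_formD(1)[OF hC] and symC = hermitian_formD(2)[OF hC]
  \<comment> \<open>the failure of the transformation law\<close>
  define A where "A a b = D x (\<Gamma> c x a b) - D2 a b - \<Gamma> d (\<tau> x) (D x a) (D x b)" for a b
  have mB: "frechet_derivative (\<lambda>y. ?B y b e) (at x) a = ?B x (\<Gamma> c x a b) e + ?B x b (\<Gamma> c x a e)" for a b e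
    by (rule metric_connectionD[OF metric c xc])
  have mC: "frechet_derivative (\<lambda>y. ?C y b e) (at (\<tau> x)) a =
      ?C (\<tau> x) (\<Gamma> d (\<tau> x) a b) e + ?C (\<tau> x) b (\<Gamma> d (\<tau> x) a e)" for a b e
    by (rule metric_connectionD[OF metric d xd])
  have der: "frechet_derivative (\<lambda>y. ?B y b e) (at x) a =
      frechet_derivative (\<lambda>z. ?C z (D x b) (D x e)) (at (\<tau> x)) (D x a) +
      ?C (\<tau> x) (D2 a b) (D x e) + ?C (\<tau> x) (D x b) (D2 a e)" for a b e
  proof -
    have 1: "frechet_derivative (\<lambda>y. ?B y b e) (at x) = frechet_derivative (\<lambda>y. ?C (\<tau> y) (D y b) (D y e)) (at x)"
      by (rule frechet_derivative_cong_open[OF U x]) (rule iso)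
    have 2: "((\<lambda>y. ?C (\<tau> y) (D y b) (D y e)) has_derivative
      (\<lambda>a. frechet_derivative (\<lambda>z. ?C z (D x b) (D x e)) (at (\<tau> x)) (D x a) +
      ?C (\<tau> x) (D2 a b) (D x e) + ?C (\<tau> x) (D x b) (D2 a e))) (at x)"
      by (rule has_derivative_bilinear_field[where B="?C" and f="\<lambda>y. D y b" and g="\<lambda>y. D y e",
            OF V U x \<tau>V bilC hermitian_metric_differentiable[OF h d xd] \<tau>der derD derD])
    show ?thesis unfolding 1 frechet_derivative_eqI[OF 2] ..
  qed
  note lC = bilinear_lsub[OF bilC[OF xd]] and isx = iso[OF x] and sC = symC[OF xd]
  have "A u v = 0"
  proof (rule bismut_difference_zero[where A=A and D="D x", OF hC[OF xd] bij cxD[OF x]])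
    fix a b e
    show "?C (\<tau> x) (A a b) (D x e) = - ?C (\<tau> x) (A a e) (D x b)"
      using der[of b e a] mB[of b e a] mC[of "D x b" "D x e" "D x a"]
        sC[of "D x b" "D x (\<Gamma> c x a e)"] sC[of "D x b" "D2 a e"] sC[of "D x b" "\<Gamma> d (\<tau> x) (D x a) (D x e)"]
      by (simp add: A_def lC isx)
    have "?B x (\<Gamma> c x a b - \<Gamma> c x b a) e = - ?B x (\<Gamma> c x a e - \<Gamma> c x e a) b"
      by (rule skew_torsionD[OF skew c xc])
    moreover have "?C (\<tau> x) (\<Gamma> d (\<tau> x) (D x a) (D x b) - \<Gamma> d (\<tau> x) (D x b) (D x a)) (D x e) =
       - ?C (\<tau> x) (\<Gamma> d (\<tau> x) (D x a) (D x e) - \<Gamma> d (\<tau> x) (D x e) (D x a)) (D x b)"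
      by (rule skew_torsionD[OF skew d xd])
    ultimately show "?C (\<tau> x) (A a b - A b a) (D x e) = - ?C (\<tau> x) (A a e - A e a) (D x b)"
      by (simp add: A_def lC isx symD2[of b a] symD2[of e a] linear_diff[OF linD[OF x]]
          bilinear_ladd[OF bilC[OF xd]])
    show "A a (imult b) = imult (A a b)"
    proof -
      have "\<Gamma> c x a (imult b) = imult (\<Gamma> c x a b)"
        "\<Gamma> d (\<tau> x) (D x a) (imult (D x b)) = imult (\<Gamma> d (\<tau> x) (D x a) (D x b))"
        by (rule complex_connectionD[OF complex] c d xc xd)+
      then show ?thesis
        unfolding A_def by (simp only: cxD[OF x] cxD2 vector_ssub_ldistrib)
    qed
  qed
  then show ?thesis by (simp add: A_def D2_def algebra_simps)
qed

lemma bismut_unique: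
  fixes M :: "('a, 'n::finite) cmfd"
  assumes M: "complex_manifold M" and h: "hermitian_metric M h"
    and c: "c \<in> atlas M" and x: "x \<in> cmap_image c"
    and metric: "\<And>u v w. frechet_derivative (\<lambda>y. coord_form M h c y v w) (at x) u =
       coord_form M h c x (G u v) w + coord_form M h c x v (G u w)"
    and complex: "\<And>u v. G u (imult v) = imult (G u v)"
    and skew: "\<And>u v w. coord_form M h c x (G u v - G v u) w = - coord_form M h c x (G u w - G w u) v"
    and bismut: "metric_connection M h \<Gamma>" "complex_connection M \<Gamma>" "skew_torsion M h \<Gamma>"
  shows "\<Gamma> c x u v = G u v"
proof -
  let ?B = "coord_form M h c x"
  have hB: "hermitian_form ?B" by (rule hermitian_form_coord_form[OF M h c x])
  note bil = hermitian_formD(1)[OF hB] and sym = hermitian_formD(2)[OF hB]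
  have m: "frechet_derivative (\<lambda>y. coord_form M h c y b e) (at x) a = ?B (\<Gamma> c x a b) e + ?B b (\<Gamma> c x a e)" for a b e
    by (rule metric_connectionD[OF bismut(1) c x])
  have s: "?B (\<Gamma> c x a b - \<Gamma> c x b a) e = - ?B (\<Gamma> c x a e - \<Gamma> c x e a) b" for a b e
    by (rule skew_torsionD[OF bismut(3) c x])
  have i: "\<Gamma> c x a (imult b) = imult (\<Gamma> c x a b)" for a b
    by (rule complex_connectionD[OF bismut(2) c x])
  have "\<Gamma> c x u v - G u v = 0"
  proof (rule bismut_difference_zero[where A="\<lambda>u v. \<Gamma> c x u v - G u v" and D="\<lambda>v. v", OF hB])
    fix a b e
    show "?B (\<Gamma> c x a b - G a b) e = - ?B (\<Gamma> c x a e - G a e) b"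
      using m[of b e a] metric[of b e a] sym[of b "\<Gamma> c x a e"] sym[of b "G a e"]
      by (simp add: bilinear_lsub[OF bil])
    show "?B (\<Gamma> c x a b - G a b - (\<Gamma> c x b a - G b a)) e = - ?B (\<Gamma> c x a e - G a e - (\<Gamma> c x e a - G e a)) b"
      using s[of a b e] skew[of a b e] by (simp add: bilinear_lsub[OF bil])
    show "\<Gamma> c x a (imult b) - G a (imult b) = imult (\<Gamma> c x a b - G a b)"
      by (simp add: i complex vec_eq_iff algebra_simps)
  qed auto
  then show ?thesis by simp
qed

section \<open>The Levi-Civita connection of a Kaehler metric\<close>

text \<open>With \<open>b(u, v, w) = g((\<nabla>\<^sub>u J) v, w)\<close>, closedness of the fundamental form says that the cyclic sum of \<open>b\<close>
vanishes, and the torsion-free connection together with the constant \<open>J\<close> in holomorphic charts gives a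
symmetry of \<open>b\<close> under \<open>J\<close> (the vanishing of the Nijenhuis tensor).  Since \<open>\<nabla>\<^sub>u J\<close> anticommutes with \<open>J\<close> and is
skew, subtracting the cyclic sum at \<open>(u, J v, J w)\<close> from the one at \<open>(u, v, w)\<close> leaves \<open>2 b(u, v, w)\<close>.\<close>

lemma levi_civita_complex:
  fixes K :: "('a, 'n::finite) cmfd"
  assumes K: "kaehler_manifold K g" and lc: "levi_civita K g \<Gamma>"
    and c: "c \<in> atlas K" and x: "x \<in> cmap_image c"
  shows "\<Gamma> c x u (imult v) = imult (\<Gamma> c x u v)"
proof -
  let ?B = "coord_form K g c"
  have M: "complex_manifold K" and h: "hermitian_metric K g"
    using K by (auto simp: kaehler_manifold_def hermitian_manifold_def)
  have op: "open (cmap_image c)" by (rule complex_manifoldD(5)[OF M c])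
  have hB: "hermitian_form (?B y)" if "y \<in> cmap_image c" for y by (rule hermitian_form_coord_form[OF M h c that])
  note bil = hermitian_formD(1)[OF hB[OF x]] and sym = hermitian_formD(2)[OF hB[OF x]]
    and J = hermitian_formD(4)[OF hB]
  have m: "frechet_derivative (\<lambda>y. ?B y b e) (at x) a = ?B x (\<Gamma> c x a b) e + ?B x b (\<Gamma> c x a e)" for a b e
    by (rule metric_connectionD[OF _ c x]) (use lc in \<open>simp add: levi_civita_def\<close>)
  have tf: "\<Gamma> c x a b = \<Gamma> c x b a" for a b
    using lc c x by (simp add: levi_civita_def torsion_eq)
  define \<gamma> where "\<gamma> a b e = ?B x (\<Gamma> c x a b) e" for a b e
  have \<gamma>s: "\<gamma> a b e = \<gamma> b a e" for a b e by (simp add: \<gamma>_def tf[of a b])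
  have ii: "imult (imult a) = - a" for a :: "complex ^ 'n" by (simp add: vec_eq_iff)
  have gam_bil: "bilinear (\<Gamma> c x)" using lc c x by (simp add: levi_civita_def affine_connection_def)
  have \<gamma>n: "\<gamma> (- a) b e = - \<gamma> a b e" "\<gamma> a (- b) e = - \<gamma> a b e" "\<gamma> a b (- e) = - \<gamma> a b e" for a b e
    by (simp_all add: \<gamma>_def bilinear_lneg[OF gam_bil] bilinear_rneg[OF gam_bil] bilinear_lneg[OF bil]
        bilinear_rneg[OF bil])
  \<comment> \<open>\<open>g((\<nabla>\<^sub>a J) e, f)\<close>, where skewness of \<open>J\<close> turns \<open>- g(J \<nabla>\<^sub>a e, f)\<close> into the second summand\<close>
  define b where "b a e f = \<gamma> a (imult e) f + \<gamma> a e (imult f)" for a e f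
  have herm: "\<gamma> a (imult e) (imult f) + \<gamma> a (imult f) (imult e) = \<gamma> a e f + \<gamma> a f e" for a e f
  proof -
    have "frechet_derivative (\<lambda>y. ?B y (imult e) (imult f)) (at x) = frechet_derivative (\<lambda>y. ?B y e f) (at x)"
      by (rule frechet_derivative_cong_open[OF op x]) (rule J)
    from fun_cong[OF this, of a] show ?thesis using m[of "imult e" "imult f" a] m[of e f a]
        sym[of "imult e" "\<Gamma> c x a (imult f)"] sym[of e "\<Gamma> c x a f"]
      unfolding \<gamma>_def by linarith
  qed
  have b_skew: "b a e f = - b a f e" for a e f
    using herm[of a "imult e" f] unfolding b_def ii \<gamma>n by linarith
  have d\<omega>: "b a e f + b e f a + b f a e = 0" for a e f
  proof -
    have "ext_d2 (fundamental_form K g c) x a e f = 0" using K c x by (simp add: kaehler_manifold_def)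
    then have "\<gamma> a (imult e) f + \<gamma> a f (imult e) - (\<gamma> e (imult a) f + \<gamma> e f (imult a))
        + (\<gamma> f (imult a) e + \<gamma> f e (imult a)) = 0"
      using sym[of "imult e" "\<Gamma> c x a f"] sym[of "imult a" "\<Gamma> c x e f"] sym[of "imult a" "\<Gamma> c x f e"]
      unfolding ext_d2_def fundamental_form_def m \<gamma>_def by linarith
    then show ?thesis
      using \<gamma>s[of a f "imult e"] \<gamma>s[of e f "imult a"] \<gamma>s[of a e "imult f"] b_skew[of e f a]
      unfolding b_def by linarith
  qed
  have b_J: "b a e (imult f) = b a (imult e) f" for a e f
    unfolding b_def ii \<gamma>n by linarith
  \<comment> \<open>the Nijenhuis tensor of \<open>J\<close> vanishes\<close>
  have nij: "b (imult a) e f + b a e (imult f) = b (imult e) a f + b e a (imult f)" for a e f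
    using \<gamma>s[of "imult a" "imult e" f] \<gamma>s[of "imult a" e "imult f"] \<gamma>s[of a "imult e" "imult f"] \<gamma>s[of a e f]
    unfolding b_def ii \<gamma>n by linarith
  have bn: "b a (- e) f = - b a e f" "b a e (- f) = - b a e f" for a e f
    by (simp_all add: b_def \<gamma>n vector_smult_rneg)
  have zero: "b a e f = 0" for a e f
  proof -
    have "b a (imult e) (imult f) = - b a e f" using b_J[of a "imult e" f] unfolding ii bn .
    moreover have "b (imult e) (imult f) a = b (imult e) f (imult a)" by (rule b_J[symmetric])
    moreover have "b (imult f) a (imult e) = - b (imult f) e (imult a)"
      using b_J[of "imult f" a e] b_skew[of "imult f" "imult a" e] by linarith
    moreover have "b (imult e) f (imult a) - b e f a = b (imult f) e (imult a) - b f e a"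
      using nij[of e f "imult a"] unfolding ii bn by linarith
    ultimately show ?thesis
      using d\<omega>[of a e f] d\<omega>[of a "imult e" "imult f"] b_skew[of f a e] by linarith
  qed
  have "\<Gamma> c x u (imult v) - imult (\<Gamma> c x u v) = 0"
  proof (rule hermitian_form_nondegenerate[OF hB[OF x]])
    fix w
    show "?B x (\<Gamma> c x u (imult v) - imult (\<Gamma> c x u v)) w = 0"
      using zero[of u v w] hermitian_form_imult_left[OF hB[OF x], of "\<Gamma> c x u v" w]
      by (simp add: b_def \<gamma>_def bilinear_lsub[OF bil])
  qed
  then show ?thesis by simp
qed


section \<open>The Ricci tensor as a complex trace\<close>

lemma linear_imult: "linear (imult :: complex ^ 'n::finite \<Rightarrow> complex ^ 'n)"
  by (rule linearI) (auto simp: vec_eq_iff algebra_simps scaleR_conv_of_real)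

text \<open>This makes the curvature linear in the arguments on which the differentiated Christoffel symbols depend.\<close>

lemma linear_derivative_of_linear_field:
  fixes L :: "'x::euclidean_space \<Rightarrow> 'v::euclidean_space \<Rightarrow> 'w::euclidean_space"
  assumes U: "open U" "x \<in> U" and lin: "\<And>y. y \<in> U \<Longrightarrow> linear (L y)"
    and diff: "\<And>a. (\<lambda>y. L y a) differentiable (at x)"
  shows "linear (\<lambda>a. frechet_derivative (\<lambda>y. L y a) (at x) u)"
proof (rule linearI)
  note D = frechet_derivative_works[THEN iffD1, OF diff]
  fix a b
  have "frechet_derivative (\<lambda>y. L y (a + b)) (at x) = frechet_derivative (\<lambda>y. L y a + L y b) (at x)"
    by (rule frechet_derivative_cong_open[OF U]) (rule linear_add[OF lin])
  also have "\<dots> = (\<lambda>u. frechet_derivative (\<lambda>y. L y a) (at x) u + frechet_derivative (\<lambda>y. L y b) (at x) u)"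
    by (rule frechet_derivative_eqI[OF has_derivative_add[OF D D]])
  finally show "frechet_derivative (\<lambda>y. L y (a + b)) (at x) u =
      frechet_derivative (\<lambda>y. L y a) (at x) u + frechet_derivative (\<lambda>y. L y b) (at x) u" by (rule fun_cong)
next
  note D = frechet_derivative_works[THEN iffD1, OF diff]
  fix r a
  have "frechet_derivative (\<lambda>y. L y (r *\<^sub>R a)) (at x) = frechet_derivative (\<lambda>y. r *\<^sub>R L y a) (at x)"
    by (rule frechet_derivative_cong_open[OF U]) (rule linear_cmul[OF lin])
  also have "\<dots> = (\<lambda>u. r *\<^sub>R frechet_derivative (\<lambda>y. L y a) (at x) u)"
    by (rule frechet_derivative_eqI[OF has_derivative_scaleR_right[OF D]])
  finally show "frechet_derivative (\<lambda>y. L y (r *\<^sub>R a)) (at x) u =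
      r *\<^sub>R frechet_derivative (\<lambda>y. L y a) (at x) u" by (rule fun_cong)
qed

lemma bilinearD:
  assumes "bilinear B"
  shows "linear (\<lambda>x. B x y)" "linear (B x)"
  using assms by (auto simp: bilinear_def)

lemma coord_curvature_linear_last:
  fixes G :: "'v::euclidean_space \<Rightarrow> 'v \<Rightarrow> 'v \<Rightarrow> 'v"
  assumes U: "open U" "x \<in> U" and bil: "\<And>y. y \<in> U \<Longrightarrow> bilinear (G y)"
    and diff: "\<And>a b. (\<lambda>y. G y a b) differentiable (at x)"
  shows "linear (coord_curvature G x u v)"
proof -
  have 1: "linear (\<lambda>w. frechet_derivative (\<lambda>y. G y a w) (at x) b)" for a b
    by (rule linear_derivative_of_linear_field[where L="\<lambda>y. G y a", OF U bilinearD(2)[OF bil] diff])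
  have 2: "linear (\<lambda>w. G x a (G x b w))" for a b
    using linear_compose[OF bilinearD(2)[OF bil[OF U(2)]] bilinearD(2)[OF bil[OF U(2)]], of a b]
    by (simp add: o_def)
  show ?thesis unfolding coord_curvature_def[abs_def]
    by (intro linear_compose_sub linear_compose_add 1 2)
qed

lemma coord_curvature_linear_first:
  fixes G :: "'v::euclidean_space \<Rightarrow> 'v \<Rightarrow> 'v \<Rightarrow> 'v"
  assumes U: "open U" "x \<in> U" and bil: "\<And>y. y \<in> U \<Longrightarrow> bilinear (G y)"
    and diff: "\<And>a b. (\<lambda>y. G y a b) differentiable (at x)"
  shows "linear (\<lambda>u. coord_curvature G x u v w)"
proof -
  have 1: "linear (\<lambda>u. frechet_derivative (\<lambda>y. G y u w) (at x) v)"
    by (rule linear_derivative_of_linear_field[where L="\<lambda>y u. G y u w", OF U bilinearD(1)[OF bil] diff])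
  have 2: "linear (\<lambda>u. G x v (G x u w))"
    using linear_compose[OF bilinearD(1)[OF bil[OF U(2)], of w] bilinearD(2)[OF bil[OF U(2)], of v]]
    by (simp add: o_def)
  show ?thesis unfolding coord_curvature_def
    by (intro linear_compose_sub linear_compose_add 1 2 bilinearD(1)[OF bil[OF U(2)]]
        linear_frechet_derivative diff)
qed

lemma coord_curvature_imult:
  fixes G :: "complex ^ 'n::finite \<Rightarrow> complex ^ 'n \<Rightarrow> complex ^ 'n \<Rightarrow> complex ^ 'n"
  assumes U: "open U" "x \<in> U" and J: "\<And>y a b. y \<in> U \<Longrightarrow> G y a (imult b) = imult (G y a b)"
    and diff: "\<And>a b. (\<lambda>y. G y a b) differentiable (at x)"
  shows "coord_curvature G x u v (imult w) = imult (coord_curvature G x u v w)"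
proof -
  have "frechet_derivative (\<lambda>y. G y a (imult b)) (at x) e = imult (frechet_derivative (\<lambda>y. G y a b) (at x) e)" for a b e
  proof -
    have "frechet_derivative (\<lambda>y. G y a (imult b)) (at x) = frechet_derivative (\<lambda>y. imult (G y a b)) (at x)"
      by (rule frechet_derivative_cong_open[OF U]) (rule J)
    also have "\<dots> = (\<lambda>e. imult (frechet_derivative (\<lambda>y. G y a b) (at x) e))"
      by (rule frechet_derivative_eqI[OF has_derivative_compose[OF
            frechet_derivative_works[THEN iffD1, OF diff] linear_imp_has_derivative[OF linear_imult]]])
    finally show ?thesis by (rule fun_cong)
  qed
  then show ?thesis
    by (simp only: coord_curvature_def J[OF U(2)] linear_diff[OF linear_imult] linear_add[OF linear_imult])
qed

lemma bianchi_identity: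
  fixes G :: "'v::euclidean_space \<Rightarrow> 'v \<Rightarrow> 'v \<Rightarrow> 'v"
  assumes U: "open U" "x \<in> U" and sym: "\<And>y a b. y \<in> U \<Longrightarrow> G y a b = G y b a"
  shows "coord_curvature G x u v w + coord_curvature G x v w u + coord_curvature G x w u v = 0"
proof -
  have s: "frechet_derivative (\<lambda>y. G y a b) (at x) = frechet_derivative (\<lambda>y. G y b a) (at x)" for a b
    by (rule frechet_derivative_cong_open[OF U]) (rule sym)
  show ?thesis
    unfolding coord_curvature_def s[of v u] s[of w v] s[of u w]
      sym[OF U(2), of v u] sym[OF U(2), of w v] sym[OF U(2), of u w] by simp
qed

text \<open>By the Bianchi identity \<open>R(u, v) (\<i> w) = R(\<i> w, v) u - R(\<i> w, u) v\<close>.  The curvature commutes with \<open>\<i>\<close>, so by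
cyclicity the trace of \<open>w \<mapsto> R(\<i> w, v) u\<close> is that of \<open>w \<mapsto> R(w, v) (\<i> u)\<close>, a value of the Ricci
tensor.\<close>

lemma trace_complex_curvature_zero:
  fixes G :: "complex ^ 'n::finite \<Rightarrow> complex ^ 'n \<Rightarrow> complex ^ 'n \<Rightarrow> complex ^ 'n"
  assumes U: "open U" "x \<in> U" and bil: "\<And>y. y \<in> U \<Longrightarrow> bilinear (G y)"
    and diff: "\<And>a b. (\<lambda>y. G y a b) differentiable (at x)"
    and sym: "\<And>y a b. y \<in> U \<Longrightarrow> G y a b = G y b a"
    and J: "\<And>y a b. y \<in> U \<Longrightarrow> G y a (imult b) = imult (G y a b)"
    and ricci: "\<And>v w. lin_trace (\<lambda>u. coord_curvature G x u v w) = 0"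
  shows "lin_trace (\<lambda>w. coord_curvature G x u v (imult w)) = 0"
proof -
  let ?R = "coord_curvature G x"
  have t: "lin_trace (\<lambda>w. ?R (imult w) a b) = 0" for a b
  proof -
    have "lin_trace (\<lambda>w. ?R (imult w) a b) = lin_trace (\<lambda>w. imult (?R w a b))"
      by (rule lin_trace_cyclic[OF linear_imult coord_curvature_linear_first[where G=G, OF U bil diff]])
    also have "\<dots> = lin_trace (\<lambda>w. ?R w a (imult b))"
      by (simp only: coord_curvature_imult[where G=G, OF U J diff])
    finally show ?thesis by (simp only: ricci)
  qed
  have "?R u v (imult w) = ?R (imult w) v u - ?R (imult w) u v" for w
  proof -
    have "?R u v (imult w) + ?R v (imult w) u + ?R (imult w) u v = 0" by (rule bianchi_identity[where G=G, OF U sym])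
    moreover have "?R v (imult w) u = - ?R (imult w) v u" by (simp add: coord_curvature_def)
    ultimately show ?thesis by (simp add: algebra_simps)
  qed
  then have "lin_trace (\<lambda>w. ?R u v (imult w)) =
      lin_trace (\<lambda>w. ?R (imult w) v u) - lin_trace (\<lambda>w. ?R (imult w) u v)"
    by (simp add: lin_trace_def inner_diff_left sum_subtractf)
  then show ?thesis by (simp only: t)
qed

section \<open>The Hopf metric and its flat connection\<close>

text \<open>Quaternion multiplication, where \<open>(z, w)\<close> stands for \<open>z + w j\<close>.  The scalar \<open>\<i>\<close> acts by left
multiplication.\<close>

definition qmult :: "complex ^ 2 \<Rightarrow> complex ^ 2 \<Rightarrow> complex ^ 2" where
  "qmult a b = vector [a $ 1 * b $ 1 - a $ 2 * cnj (b $ 2), a $ 1 * b $ 2 + a $ 2 * cnj (b $ 1)]"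

definition qconj :: "complex ^ 2 \<Rightarrow> complex ^ 2" where
  "qconj a = vector [cnj (a $ 1), - a $ 2]"

lemma qmult_nth [simp]:
  "qmult a b $ 1 = a $ 1 * b $ 1 - a $ 2 * cnj (b $ 2)"
  "qmult a b $ 2 = a $ 1 * b $ 2 + a $ 2 * cnj (b $ 1)"
  by (simp_all add: qmult_def)

lemma qconj_nth [simp]: "qconj a $ 1 = cnj (a $ 1)" "qconj a $ 2 = - a $ 2"
  by (simp_all add: qconj_def)

lemma vec2_eq_iff: "a = b \<longleftrightarrow> a $ 1 = b $ 1 \<and> a $ 2 = b $ (2::2)"
  by (simp add: vec_eq_iff forall_2)

lemma bilinear_qmult: "bilinear qmult"
  unfolding bilinear_def
  by (auto intro!: linearI simp: vec2_eq_iff algebra_simps scaleR_conv_of_real[where 'a=complex])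

lemma qmult_assoc: "qmult (qmult a b) c = qmult a (qmult b c)"
  by (simp add: vec2_eq_iff algebra_simps)

lemma qmult_imult: "qmult (imult a) b = imult (qmult a b)"
  by (simp add: vec2_eq_iff algebra_simps)

lemma inner_C2: "a \<bullet> b = Re (a $ 1) * Re (b $ 1) + Im (a $ 1) * Im (b $ 1)
    + Re (a $ 2) * Re (b $ 2) + Im (a $ 2) * Im (b $ (2::2))"
  by (simp add: inner_vec_def sum_2 inner_complex_def)

lemma imult_nth: "Re (imult v $ i) = - Im (v $ i)" "Im (imult v $ i) = Re (v $ i)"
  by simp_all

text \<open>Write \<open>x*\<close> for the conjugate of \<open>x\<close> and multiply \<open>x* u + u* x = 2 \<langle>x, u\<rangle>\<close> by \<open>x*\<close> from
the right.\<close>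

lemma qmult_qconj_sandwich:
  "qmult (qmult (qconj x) u) (qconj x) = (2 * (x \<bullet> u)) *\<^sub>R qconj x - (x \<bullet> x) *\<^sub>R qconj u"
  by (simp add: vec2_eq_iff inner_C2 complex_eq_iff algebra_simps)

lemma inner_qmult_polar:
  "qmult (qmult v (qconj x)) u \<bullet> w + v \<bullet> qmult (qmult w (qconj x)) u = 2 * (x \<bullet> u) * (v \<bullet> w)"
  by (simp add: inner_C2 algebra_simps)

lemma inner_qmult_skew:
  "(qmult (qmult v (qconj x)) u - qmult (qmult u (qconj x)) v) \<bullet> w =
     - ((qmult (qmult w (qconj x)) u - qmult (qmult u (qconj x)) w) \<bullet> v)"
  by (simp add: inner_C2 algebra_simps)

definition hopf_metric :: "complex ^ 2 \<Rightarrow> complex ^ 2 \<Rightarrow> complex ^ 2 \<Rightarrow> real" where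
  "hopf_metric x u v = inverse (x \<bullet> x) * (u \<bullet> v)"

text \<open>As a formula in quaternions, \<open>\<Gamma>(u, v) = - v x\<^sup>-\<^sup>1 u\<close>.  On the field \<open>v = a x\<close> this is \<open>- a u\<close>, which cancels
the derivative of \<open>a x\<close> in direction \<open>u\<close>: these fields are parallel.\<close>

definition hopf_connection :: "complex ^ 2 \<Rightarrow> complex ^ 2 \<Rightarrow> complex ^ 2 \<Rightarrow> complex ^ 2" where
  "hopf_connection x u v = - inverse (x \<bullet> x) *\<^sub>R qmult (qmult v (qconj x)) u"

lemma bilinear_hopf_connection: "bilinear (hopf_connection x)"
  unfolding bilinear_def hopf_connection_def
  by (auto intro!: linearI simp: vec2_eq_iff algebra_simps scaleR_conv_of_real[where 'a=complex])

lemma hopf_connection_imult: "hopf_connection x u (imult v) = imult (hopf_connection x u v)"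
  by (simp add: hopf_connection_def qmult_imult linear_cmul[OF linear_imult] linear_neg[OF linear_imult])

lemma has_derivative_inverse_sqnorm:
  fixes x :: "'v::real_inner"
  assumes "x \<noteq> 0"
  shows "((\<lambda>x. inverse (x \<bullet> x)) has_derivative (\<lambda>u. - 2 * (x \<bullet> u) * inverse (x \<bullet> x) ^ 2)) (at x)"
proof -
  have "((\<lambda>x. inverse (x \<bullet> x)) has_derivative
     (\<lambda>u. - (inverse (x \<bullet> x) * (x \<bullet> u + u \<bullet> x) * inverse (x \<bullet> x)))) (at x)"
    by (rule Deriv.has_derivative_inverse[OF _ has_derivative_inner[OF has_derivative_ident has_derivative_ident]])
       (use assms in simp)
  then show ?thesis
    by (rule has_derivative_eq_rhs) (simp add: fun_eq_iff inner_commute power2_eq_square algebra_simps)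
qed

lemma hopf_metric_has_derivative:
  "x \<noteq> 0 \<Longrightarrow> ((\<lambda>x. hopf_metric x v w) has_derivative
     (\<lambda>u. - 2 * (x \<bullet> u) * inverse (x \<bullet> x) ^ 2 * (v \<bullet> w))) (at x)"
  unfolding hopf_metric_def by (rule has_derivative_mult_left[OF has_derivative_inverse_sqnorm])

lemma hopf_metric_compatible:
  assumes "x \<noteq> 0"
  shows "frechet_derivative (\<lambda>x. hopf_metric x v w) (at x) u =
     hopf_metric x (hopf_connection x u v) w + hopf_metric x v (hopf_connection x u w)"
proof -
  have "hopf_metric x (hopf_connection x u v) w + hopf_metric x v (hopf_connection x u w) =
    - (inverse (x \<bullet> x) ^ 2) * (qmult (qmult v (qconj x)) u \<bullet> w + v \<bullet> qmult (qmult w (qconj x)) u)"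
    by (simp add: hopf_metric_def hopf_connection_def power2_eq_square algebra_simps)
  also have "\<dots> = - 2 * (x \<bullet> u) * inverse (x \<bullet> x) ^ 2 * (v \<bullet> w)" unfolding inner_qmult_polar by simp
  finally show ?thesis using frechet_derivative_eqI[OF hopf_metric_has_derivative[OF assms]] by simp
qed

lemma hopf_connection_skew_torsion:
  "hopf_metric x (hopf_connection x u v - hopf_connection x v u) w =
   - hopf_metric x (hopf_connection x u w - hopf_connection x w u) v"
proof -
  have "hopf_metric x (hopf_connection x u v - hopf_connection x v u) w =
    - (inverse (x \<bullet> x) ^ 2) * ((qmult (qmult v (qconj x)) u - qmult (qmult u (qconj x)) v) \<bullet> w)" for v w :: "complex ^ 2"
    by (simp add: hopf_metric_def hopf_connection_def power2_eq_square algebra_simps)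
  then show ?thesis using inner_qmult_skew[of v x u w] by simp
qed

lemma linear_qmult_qconj: "linear (\<lambda>x. qmult (qmult v (qconj x)) u)"
  by (auto intro!: linearI simp: vec2_eq_iff algebra_simps scaleR_conv_of_real[where 'a=complex])

text \<open>In quaternions, the derivative of \<open>- w x\<^sup>-\<^sup>1 v\<close> in direction \<open>u\<close> is \<open>w x\<^sup>-\<^sup>1 u x\<^sup>-\<^sup>1 v\<close>.\<close>

lemma hopf_connection_has_derivative:
  assumes "x \<noteq> 0"
  shows "((\<lambda>x. hopf_connection x v w) has_derivative
     (\<lambda>u. inverse (x \<bullet> x) ^ 2 *\<^sub>R qmult (qmult w (qmult (qmult (qconj x) u) (qconj x))) v)) (at x)"
proof -
  define N where "N = inverse (x \<bullet> x)"
  have N: "N * (N * (x \<bullet> x)) = N" using assms by (simp add: N_def)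
  have "((\<lambda>x. - inverse (x \<bullet> x)) has_derivative (\<lambda>u. 2 * (x \<bullet> u) * N ^ 2)) (at x)"
    using has_derivative_minus[OF has_derivative_inverse_sqnorm[OF assms]] by (simp add: N_def)
  from has_derivative_scaleR[OF this linear_imp_has_derivative[OF linear_qmult_qconj]]
  have D: "((\<lambda>x. hopf_connection x v w) has_derivative
     (\<lambda>u. (- N) *\<^sub>R qmult (qmult w (qconj u)) v + (2 * (x \<bullet> u) * N ^ 2) *\<^sub>R qmult (qmult w (qconj x)) v)) (at x)"
    by (simp add: hopf_connection_def N_def)
  show ?thesis
  proof (rule has_derivative_eq_rhs[OF D], rule ext)
    fix u
    have "qmult (qmult w (qmult (qmult (qconj x) u) (qconj x))) v =
        (2 * (x \<bullet> u)) *\<^sub>R qmult (qmult w (qconj x)) v - (x \<bullet> x) *\<^sub>R qmult (qmult w (qconj u)) v"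
      unfolding qmult_qconj_sandwich
      by (simp add: bilinear_rsub[OF bilinear_qmult] bilinear_rmul[OF bilinear_qmult]
          bilinear_lsub[OF bilinear_qmult] bilinear_lmul[OF bilinear_qmult])
    then have "N ^ 2 *\<^sub>R qmult (qmult w (qmult (qmult (qconj x) u) (qconj x))) v =
        (2 * (x \<bullet> u) * N ^ 2) *\<^sub>R qmult (qmult w (qconj x)) v
        - (N * (N * (x \<bullet> x))) *\<^sub>R qmult (qmult w (qconj u)) v"
      by (simp add: scaleR_diff_right power2_eq_square mult_ac)
    then show "(- N) *\<^sub>R qmult (qmult w (qconj u)) v + (2 * (x \<bullet> u) * N ^ 2) *\<^sub>R qmult (qmult w (qconj x)) v =
      inverse (x \<bullet> x) ^ 2 *\<^sub>R qmult (qmult w (qmult (qmult (qconj x) u) (qconj x))) v"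
      unfolding N by (simp add: N_def)
  qed
qed

text \<open>The derivative terms are \<open>w x\<^sup>-\<^sup>1 u x\<^sup>-\<^sup>1 v\<close> and \<open>w x\<^sup>-\<^sup>1 v x\<^sup>-\<^sup>1 u\<close>.  By associativity the quadratic terms are
the same two expressions, and all four cancel.\<close>

lemma hopf_connection_flat:
  assumes "x \<noteq> 0"
  shows "coord_curvature hopf_connection x u v w = 0"
proof -
  have "hopf_connection x u (hopf_connection x v w) =
      inverse (x \<bullet> x) ^ 2 *\<^sub>R qmult (qmult w (qmult (qmult (qconj x) v) (qconj x))) u" for u v
    by (simp add: hopf_connection_def bilinear_lmul[OF bilinear_qmult] bilinear_lneg[OF bilinear_qmult]
        qmult_assoc power2_eq_square)
  then show ?thesis
    by (simp add: coord_curvature_def frechet_derivative_eqI[OF hopf_connection_has_derivative[OF assms]])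
qed

lemma smooth_on_inverse_sqnorm: "smooth_on (- {0 :: 'v::euclidean_space}) (\<lambda>x. inverse (x \<bullet> x))"
proof (rule smooth_on_inverse)
  show "smooth_on (- {0 :: 'v}) (\<lambda>x. x \<bullet> x)"
    by (rule smooth_on_bilinear[OF bounded_bilinear_inner]) (auto intro: smooth_on_linear linear_ident)
qed auto

lemma smooth_on_hopf_connection: "smooth_on (- {0}) (\<lambda>x. hopf_connection x u v)"
proof -
  have "smooth_on (- {0}) (\<lambda>x. inverse (x \<bullet> x) *\<^sub>R (- qmult (qmult v (qconj x)) u))"
    by (rule smooth_on_bilinear[OF bounded_bilinear_scaleR _ smooth_on_inverse_sqnorm smooth_on_linear])
       (auto intro: linear_compose_neg linear_qmult_qconj)
  then show ?thesis by (simp add: hopf_connection_def)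
qed

lemma smooth_on_hopf_metric: "smooth_on (- {0}) (\<lambda>x. hopf_metric x u v)"
  unfolding hopf_metric_def
  by (rule smooth_on_bilinear[OF bounded_bilinear_mult _ smooth_on_inverse_sqnorm smooth_on_const]) auto

text \<open>Up to sign this is the determinant of \<open>(x, u, v, w)\<close> in \<open>\<real>\<^sup>4\<close>, so that its quotient by \<open>|x|\<^sup>4\<close> is the pullback of
the volume form of the unit sphere along \<open>x \<mapsto> x / |x|\<close>.\<close>

definition hopf_torsion_form :: "complex ^ 2 \<Rightarrow> complex ^ 2 \<Rightarrow> complex ^ 2 \<Rightarrow> complex ^ 2 \<Rightarrow> real" where
  "hopf_torsion_form x u v w =
     (x \<bullet> imult u) * (imult v \<bullet> w) - (x \<bullet> imult v) * (imult u \<bullet> w) + (x \<bullet> imult w) * (imult u \<bullet> v)"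

lemma hopf_dc:
  assumes "x \<noteq> 0"
  shows "- ext_d2 (\<lambda>x u v. hopf_metric x (imult u) v) x (imult u) (imult v) (imult w) =
    2 * inverse (x \<bullet> x) ^ 2 * hopf_torsion_form x u v w"
proof -
  have i: "imult (imult a) \<bullet> imult b = imult a \<bullet> b" for a b :: "complex ^ 2"
    by (simp add: inner_C2)
  show ?thesis
    unfolding ext_d2_def frechet_derivative_eqI[OF hopf_metric_has_derivative[OF assms]] i hopf_torsion_form_def
    by (simp add: algebra_simps)
qed

lemma hopf_torsion_form_alternating:
  "hopf_torsion_form u x v w = - hopf_torsion_form x u v w"
  "hopf_torsion_form x v u w = - hopf_torsion_form x u v w"
  "hopf_torsion_form x u w v = - hopf_torsion_form x u v w"
  unfolding hopf_torsion_form_def inner_C2 by (simp_all add: algebra_simps)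

text \<open>The inner product of \<open>x\<close> with Cramer's rule
\<open>det(a, u, v, w) x = det(x, u, v, w) a - det(x, a, v, w) u + det(x, a, u, w) v - det(x, a, u, v) w\<close>.\<close>

lemma hopf_torsion_form_cramer:
  "(x \<bullet> a) * hopf_torsion_form x u v w - (x \<bullet> u) * hopf_torsion_form x a v w
     + (x \<bullet> v) * hopf_torsion_form x a u w - (x \<bullet> w) * hopf_torsion_form x a u v =
   (x \<bullet> x) * hopf_torsion_form a u v w"
  unfolding hopf_torsion_form_def inner_C2 imult_nth by algebra

lemma hopf_torsion_form_linear: "linear (\<lambda>x. hopf_torsion_form x u v w)"
  by (rule linearI) (simp_all add: hopf_torsion_form_def inner_add_left algebra_simps)

text \<open>Differentiating the linear dependence on \<open>x\<close> contributes four times the determinant of \<open>(a, u, v, w)\<close>, one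
for each term of the exterior derivative; differentiating \<open>|x|\<^sup>-\<^sup>4\<close> contributes the same amount with the
opposite sign, by Cramer's rule.\<close>

lemma hopf_skt:
  assumes "x \<noteq> 0"
  shows "ext_d3 (\<lambda>x u v w. 2 * inverse (x \<bullet> x) ^ 2 * hopf_torsion_form x u v w) x a u v w = 0"
proof -
  let ?N = "inverse (x \<bullet> x)" and ?H = "hopf_torsion_form"
  have D: "((\<lambda>x. 2 * inverse (x \<bullet> x) ^ 2 * ?H x b c d) has_derivative
      (\<lambda>e. 2 * ?N ^ 3 * ((x \<bullet> x) * ?H e b c d - 4 * (x \<bullet> e) * ?H x b c d))) (at x)" for b c d
  proof -
    have "((\<lambda>x. (inverse (x \<bullet> x) * inverse (x \<bullet> x)) * ?H x b c d) has_derivative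
       (\<lambda>e. (?N * ?N) * ?H e b c d + (?N * (- 2 * (x \<bullet> e) * ?N ^ 2) + (- 2 * (x \<bullet> e) * ?N ^ 2) * ?N) * ?H x b c d)) (at x)"
      by (rule has_derivative_mult[OF has_derivative_mult[OF has_derivative_inverse_sqnorm[OF assms]
          has_derivative_inverse_sqnorm[OF assms]] linear_imp_has_derivative[OF hopf_torsion_form_linear]])
    note D2 = has_derivative_mult_right[OF this, of 2]
    have 1: "(\<lambda>x. 2 * inverse (x \<bullet> x) ^ 2 * ?H x b c d) =
        (\<lambda>x. 2 * ((inverse (x \<bullet> x) * inverse (x \<bullet> x)) * ?H x b c d))"
      by (simp add: power2_eq_square mult.assoc)
    have alg: "2 * ((N * N) * h + (N * (- 2 * e * N ^ 2) + (- 2 * e * N ^ 2) * N) * k)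
        = 2 * N ^ 3 * (s * h - 4 * e * k)" if "N * s = 1" for N s h k e :: real
      using that by algebra
    have 2: "2 * ((?N * ?N) * ?H e b c d + (?N * (- 2 * (x \<bullet> e) * ?N ^ 2) + (- 2 * (x \<bullet> e) * ?N ^ 2) * ?N) * ?H x b c d)
        = 2 * ?N ^ 3 * ((x \<bullet> x) * ?H e b c d - 4 * (x \<bullet> e) * ?H x b c d)" for e
      by (rule alg) (use assms in simp)
    show ?thesis unfolding 1 by (rule has_derivative_eq_rhs[OF D2]) (rule ext, rule 2)
  qed
  have "ext_d3 (\<lambda>x u v w. 2 * inverse (x \<bullet> x) ^ 2 * hopf_torsion_form x u v w) x a u v w =
    2 * ?N ^ 3 * ((x \<bullet> x) * (?H a u v w - ?H u a v w + ?H v a u w - ?H w a u v)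
      - 4 * ((x \<bullet> a) * ?H x u v w - (x \<bullet> u) * ?H x a v w + (x \<bullet> v) * ?H x a u w - (x \<bullet> w) * ?H x a u v))"
    unfolding ext_d3_def frechet_derivative_eqI[OF D] by (simp add: algebra_simps)
  moreover have "?H a u v w - ?H u a v w + ?H v a u w - ?H w a u v = 4 * ?H a u v w"
    using hopf_torsion_form_alternating(1)[of u a v w] hopf_torsion_form_alternating(1)[of v a u w]
      hopf_torsion_form_alternating(2)[of a v u w] hopf_torsion_form_alternating(1)[of w a u v]
      hopf_torsion_form_alternating(2)[of a w u v] hopf_torsion_form_alternating(3)[of a u w v] by linarith
  ultimately show ?thesis by (simp add: hopf_torsion_form_cramer)
qed


section \<open>Products of coordinate spaces\<close>

definition vfst :: "complex ^ ('m::finite + 'n::finite) \<Rightarrow> complex ^ 'm" where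
  "vfst x = (\<chi> i. x $ Inl i)"

definition vsnd :: "complex ^ ('m::finite + 'n::finite) \<Rightarrow> complex ^ 'n" where
  "vsnd x = (\<chi> i. x $ Inr i)"

lemma vec_join_proj [simp]: "vfst (vec_join a b) = a" "vsnd (vec_join a b) = b"
  by (simp_all add: vfst_def vsnd_def vec_join_def)

lemma vec_join_split [simp]: "vec_join (vfst x) (vsnd x) = x"
  by (auto simp: vfst_def vsnd_def vec_join_def vec_eq_iff split: sum.split)

lemma vec_join_eq_iff: "vec_join a b = x \<longleftrightarrow> a = vfst x \<and> b = vsnd x"
  by (metis vec_join_proj vec_join_split)

lemma eq_vec_join_iff: "x = vec_join a b \<longleftrightarrow> vfst x = a \<and> vsnd x = b"
  by (metis vec_join_proj vec_join_split)

lemma linear_vfst: "linear vfst" and linear_vsnd: "linear vsnd"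
  by (auto intro!: linearI simp: vfst_def vsnd_def vec_eq_iff)

lemma vproj_imult: "vfst (imult x) = imult (vfst x)" "vsnd (imult x) = imult (vsnd x)"
  by (simp_all add: vfst_def vsnd_def vec_eq_iff)

lemma linear_inl: "linear (\<lambda>a. vec_join a 0)" and linear_inr: "linear (\<lambda>b. vec_join 0 b)"
  by (auto intro!: linearI simp: vec_join_def vec_eq_iff split: sum.split)

lemma vec_join_add: "vec_join a b = vec_join a 0 + vec_join 0 b"
  by (auto simp: vec_join_def vec_eq_iff split: sum.split)

lemma vec_join_imult: "vec_join (imult a) (imult b) = imult (vec_join a b)"
  by (simp add: vec_join_eq_iff vproj_imult)

lemma vec_join_diff: "vec_join a b - vec_join c d = vec_join (a - c) (b - d)"
  by (rule sym) (simp add: vec_join_eq_iff linear_diff[OF linear_vfst] linear_diff[OF linear_vsnd])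

lemma has_derivative_vec_join:
  assumes "(f has_derivative f') (at x)" "(g has_derivative g') (at x)"
  shows "((\<lambda>x. vec_join (f x) (g x)) has_derivative (\<lambda>u. vec_join (f' u) (g' u))) (at x)"
  using has_derivative_add[OF has_derivative_compose[OF assms(1) linear_imp_has_derivative[OF linear_inl]]
      has_derivative_compose[OF assms(2) linear_imp_has_derivative[OF linear_inr]]]
  by (simp only: vec_join_add[symmetric])

lemma smooth_on_vec_join:
  assumes "open S" "smooth_on S f" "smooth_on S g"
  shows "smooth_on S (\<lambda>x. vec_join (f x) (g x))"
proof -
  have "smooth_on S (\<lambda>x. vec_join (f x) 0)" "smooth_on S (\<lambda>x. vec_join 0 (g x))"
    using smooth_on_compose[OF assms(1) open_UNIV subset_UNIV assms(2) smooth_on_linear[OF linear_inl]]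
      smooth_on_compose[OF assms(1) open_UNIV subset_UNIV assms(3) smooth_on_linear[OF linear_inr]] by auto
  from smooth_on_add[OF assms(1) this] show ?thesis by (simp only: vec_join_add[symmetric])
qed

lemma holo_on_vec_join:
  assumes S: "open S" and f: "holo_on S f" and g: "holo_on S g"
  shows "holo_on S (\<lambda>x. vec_join (f x) (g x))"
  unfolding holo_on_def
proof (intro conjI ballI allI)
  note sm = holo_on_imp_smooth_on[OF f] holo_on_imp_smooth_on[OF g]
  show "smooth_on S (\<lambda>x. vec_join (f x) (g x))" by (rule smooth_on_vec_join[OF S sm])
  fix x v assume x: "x \<in> S"
  show "frechet_derivative (\<lambda>x. vec_join (f x) (g x)) (at x) (imult v) =
      imult (frechet_derivative (\<lambda>x. vec_join (f x) (g x)) (at x) v)"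
    using f g x
    by (simp add: frechet_derivative_eqI[OF has_derivative_vec_join[OF smooth_on_imp_has_derivative[OF sm(1) x]
        smooth_on_imp_has_derivative[OF sm(2) x]]] vec_join_imult holo_on_def)
qed

lemma continuous_on_vproj: "continuous_on S vfst" "continuous_on S vsnd"
  by (simp_all add: linear_vfst linear_vsnd linear_continuous_on linear_linear[symmetric] flip: linear_conv_bounded_linear)

lemma open_vproj:
  assumes "open A" "open B"
  shows "open {x. vfst x \<in> A \<and> vsnd x \<in> B}"
  using open_Int[OF open_vimage[OF assms(1) continuous_on_vproj(1)] open_vimage[OF assms(2) continuous_on_vproj(2)]]
  by (simp add: vimage_def Int_def)

lemma continuous_on_vec_join: "continuous_on S (\<lambda>(a, b). vec_join a b)"
proof -
  have "linear (\<lambda>(a, b). vec_join a b)"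
    by (auto intro!: linearI simp: vec_join_def vec_eq_iff split: sum.split)
  then show ?thesis by (intro linear_continuous_on) (simp only: linear_conv_bounded_linear)
qed

section \<open>Direct sums of bilinear forms and connections\<close>

definition sum_form ::
  "(complex ^ 'm::finite \<Rightarrow> complex ^ 'm \<Rightarrow> complex ^ 'm \<Rightarrow> real) \<Rightarrow>
   (complex ^ 'n::finite \<Rightarrow> complex ^ 'n \<Rightarrow> complex ^ 'n \<Rightarrow> real) \<Rightarrow>
   complex ^ ('m + 'n) \<Rightarrow> complex ^ ('m + 'n) \<Rightarrow> complex ^ ('m + 'n) \<Rightarrow> real" where
  "sum_form B C x u v = B (vfst x) (vfst u) (vfst v) + C (vsnd x) (vsnd u) (vsnd v)"

definition sum_connection ::
  "(complex ^ 'm::finite \<Rightarrow> complex ^ 'm \<Rightarrow> complex ^ 'm \<Rightarrow> complex ^ 'm) \<Rightarrow>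
   (complex ^ 'n::finite \<Rightarrow> complex ^ 'n \<Rightarrow> complex ^ 'n \<Rightarrow> complex ^ 'n) \<Rightarrow>
   complex ^ ('m + 'n) \<Rightarrow> complex ^ ('m + 'n) \<Rightarrow> complex ^ ('m + 'n) \<Rightarrow> complex ^ ('m + 'n)" where
  "sum_connection G H x u v = vec_join (G (vfst x) (vfst u) (vfst v)) (H (vsnd x) (vsnd u) (vsnd v))"

lemma has_derivative_vfst:
  "f differentiable (at (vfst x)) \<Longrightarrow>
     ((\<lambda>y. f (vfst y)) has_derivative (\<lambda>u. frechet_derivative f (at (vfst x)) (vfst u))) (at x)"
  by (rule has_derivative_compose[OF linear_imp_has_derivative[OF linear_vfst]])
     (simp add: frechet_derivative_works)

lemma has_derivative_vsnd:
  "f differentiable (at (vsnd x)) \<Longrightarrow>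
     ((\<lambda>y. f (vsnd y)) has_derivative (\<lambda>u. frechet_derivative f (at (vsnd x)) (vsnd u))) (at x)"
  by (rule has_derivative_compose[OF linear_imp_has_derivative[OF linear_vsnd]])
     (simp add: frechet_derivative_works)

lemma frechet_derivative_sum_form:
  assumes "\<And>u v. (\<lambda>x. B x u v) differentiable (at (vfst x))"
    and "\<And>u v. (\<lambda>x. C x u v) differentiable (at (vsnd x))"
  shows "frechet_derivative (\<lambda>x. sum_form B C x v w) (at x) u =
    frechet_derivative (\<lambda>x. B x (vfst v) (vfst w)) (at (vfst x)) (vfst u) +
    frechet_derivative (\<lambda>x. C x (vsnd v) (vsnd w)) (at (vsnd x)) (vsnd u)"
  unfolding sum_form_def
  using frechet_derivative_eqI[OF has_derivative_add[OF has_derivative_vfst[OF assms(1)] has_derivative_vsnd[OF assms(2)]]]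
  by simp

lemma ext_d2_sum_form:
  assumes "\<And>u v. (\<lambda>x. B x u v) differentiable (at (vfst x))"
    and "\<And>u v. (\<lambda>x. C x u v) differentiable (at (vsnd x))"
  shows "ext_d2 (sum_form B C) x u v w =
    ext_d2 B (vfst x) (vfst u) (vfst v) (vfst w) + ext_d2 C (vsnd x) (vsnd u) (vsnd v) (vsnd w)"
  unfolding ext_d2_def frechet_derivative_sum_form[OF assms] by simp

lemma ext_d2_cong:
  assumes "open S" "x \<in> S" "\<And>y u v. y \<in> S \<Longrightarrow> A y u v = B y u v"
  shows "ext_d2 A x u v w = ext_d2 B x u v w"
proof -
  have "frechet_derivative (\<lambda>y. A y u v) (at x) = frechet_derivative (\<lambda>y. B y u v) (at x)" for u v
    by (rule frechet_derivative_cong_open[OF assms(1,2)]) (rule assms(3))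
  then show ?thesis by (simp add: ext_d2_def)
qed

lemma ext_d3_cong:
  assumes "open S" "x \<in> S" "\<And>y u v w. y \<in> S \<Longrightarrow> A y u v w = B y u v w"
  shows "ext_d3 A x a u v w = ext_d3 B x a u v w"
proof -
  have "frechet_derivative (\<lambda>y. A y u v w) (at x) = frechet_derivative (\<lambda>y. B y u v w) (at x)" for u v w
    by (rule frechet_derivative_cong_open[OF assms(1,2)]) (rule assms(3))
  then show ?thesis by (simp add: ext_d3_def)
qed

lemma ext_d3_vsnd:
  assumes "\<And>u v w. (\<lambda>x. A x u v w) differentiable (at (vsnd x))"
  shows "ext_d3 (\<lambda>x u v w. A (vsnd x) (vsnd u) (vsnd v) (vsnd w)) x a u v w =
     ext_d3 A (vsnd x) (vsnd a) (vsnd u) (vsnd v) (vsnd w)"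
  unfolding ext_d3_def frechet_derivative_eqI[OF has_derivative_vsnd[OF assms]] by simp

lemma bilinear_sum_connection:
  assumes "bilinear (G (vfst x))" "bilinear (H (vsnd x))"
  shows "bilinear (sum_connection G H x)"
  unfolding bilinear_def sum_connection_def
  by (auto intro!: linearI simp: vec_join_eq_iff linear_add[OF linear_vfst] linear_add[OF linear_vsnd]
      linear_cmul[OF linear_vfst] linear_cmul[OF linear_vsnd]
      bilinear_ladd[OF assms(1)] bilinear_ladd[OF assms(2)] bilinear_radd[OF assms(1)] bilinear_radd[OF assms(2)]
      bilinear_lmul[OF assms(1)] bilinear_lmul[OF assms(2)] bilinear_rmul[OF assms(1)] bilinear_rmul[OF assms(2)])

lemma coord_curvature_sum_connection:
  assumes "\<And>u v. (\<lambda>x. G x u v) differentiable (at (vfst x))"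
    and "\<And>u v. (\<lambda>x. H x u v) differentiable (at (vsnd x))"
  shows "coord_curvature (sum_connection G H) x u v w =
    vec_join (coord_curvature G (vfst x) (vfst u) (vfst v) (vfst w))
      (coord_curvature H (vsnd x) (vsnd u) (vsnd v) (vsnd w))"
proof -
  have D: "frechet_derivative (\<lambda>y. sum_connection G H y a b) (at x) e =
     vec_join (frechet_derivative (\<lambda>y. G y (vfst a) (vfst b)) (at (vfst x)) (vfst e))
       (frechet_derivative (\<lambda>y. H y (vsnd a) (vsnd b)) (at (vsnd x)) (vsnd e))" for a b e
    unfolding sum_connection_def
    using frechet_derivative_eqI[OF has_derivative_vec_join[OF has_derivative_vfst[OF assms(1)] has_derivative_vsnd[OF assms(2)]]]
    by simp
  show ?thesis
    unfolding coord_curvature_def D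
    by (rule sym) (simp add: vec_join_eq_iff sum_connection_def linear_diff[OF linear_vfst] linear_diff[OF linear_vsnd]
        linear_add[OF linear_vfst] linear_add[OF linear_vsnd])
qed

section \<open>Products of complex manifolds\<close>

definition prod_chart :: "('a, 'm::finite) chart \<Rightarrow> ('b, 'n::finite) chart \<Rightarrow> ('a \<times> 'b, 'm + 'n) chart" where
  "prod_chart c d = (fst c \<times> fst d, \<lambda>(p, q). vec_join (snd c p) (snd d q))"

lemma prod_manifold_simps:
  "mtop (prod_manifold M N) = prod_topology (mtop M) (mtop N)"
  "atlas (prod_manifold M N) = {prod_chart c d | c d. c \<in> atlas M \<and> d \<in> atlas N}"
  by (simp_all add: prod_manifold_def prod_chart_def)

lemma fst_prod_chart: "fst (prod_chart c d) = fst c \<times> fst d"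
  by (simp add: prod_chart_def)

lemma snd_prod_chart: "snd (prod_chart c d) y = vec_join (snd c (fst y)) (snd d (snd y))"
  by (simp add: prod_chart_def case_prod_beta)

lemma cmap_image_prod_chart:
  "cmap_image (prod_chart c d) = {x. vfst x \<in> cmap_image c \<and> vsnd x \<in> cmap_image d}"
proof -
  have "x \<in> cmap_image (prod_chart c d) \<longleftrightarrow> vfst x \<in> cmap_image c \<and> vsnd x \<in> cmap_image d" for x
    unfolding cmap_image_def fst_prod_chart image_iff snd_prod_chart eq_vec_join_iff by force
  then show ?thesis by blast
qed

lemma image_prod_chart:
  "snd (prod_chart c d) ` (A \<times> B) = {x. vfst x \<in> snd c ` A \<and> vsnd x \<in> snd d ` B}"
proof -
  have "x \<in> snd (prod_chart c d) ` (A \<times> B) \<longleftrightarrow> vfst x \<in> snd c ` A \<and> vsnd x \<in> snd d ` B" for x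
    unfolding image_iff snd_prod_chart eq_vec_join_iff by force
  then show ?thesis by blast
qed

lemma in_cmap_image_prod_chart:
  assumes "vfst x \<in> snd c ` A \<and> vsnd x \<in> snd d ` B" "A \<subseteq> fst c" "B \<subseteq> fst d"
  shows "x \<in> cmap_image (prod_chart c d)"
  using assms unfolding cmap_image_prod_chart mem_Collect_eq cmap_image_def[of c] cmap_image_def[of d] by blast

lemma holo_on_vproj:
  assumes A: "open A" and B: "open B"
  shows "holo_on A f \<Longrightarrow> holo_on {x. vfst x \<in> A \<and> vsnd x \<in> B} (\<lambda>x. f (vfst x))"
    and "holo_on B h \<Longrightarrow> holo_on {x. vfst x \<in> A \<and> vsnd x \<in> B} (\<lambda>x. h (vsnd x))"
proof -
  note S = open_vproj[OF A B]
  show "holo_on {x. vfst x \<in> A \<and> vsnd x \<in> B} (\<lambda>x. f (vfst x))" if "holo_on A f"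
    by (rule holo_on_compose[where f=vfst and g=f, OF S A _ holo_on_linear[OF linear_vfst vproj_imult(1)] that]) auto
  show "holo_on {x. vfst x \<in> A \<and> vsnd x \<in> B} (\<lambda>x. h (vsnd x))" if "holo_on B h"
    by (rule holo_on_compose[where f=vsnd and g=h, OF S B _ holo_on_linear[OF linear_vsnd vproj_imult(2)] that]) auto
qed

lemma inj_on_prod_chart:
  assumes "inj_on (snd c) (fst c)" "inj_on (snd d) (fst d)"
  shows "inj_on (snd (prod_chart c d)) (fst (prod_chart c d))"
  using assms by (auto simp: inj_on_def fst_prod_chart snd_prod_chart vec_join_eq_iff)

lemma cmap_inv_prod_chart:
  assumes "inj_on (snd c) (fst c)" "inj_on (snd d) (fst d)" "x \<in> cmap_image (prod_chart c d)"
  shows "cmap_inv (prod_chart c d) x = (cmap_inv c (vfst x), cmap_inv d (vsnd x))"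
proof -
  let ?y = "(cmap_inv c (vfst x), cmap_inv d (vsnd x))"
  have "?y \<in> fst (prod_chart c d)" "snd (prod_chart c d) ?y = x"
    using assms(3) by (auto simp: fst_prod_chart snd_prod_chart cmap_image_prod_chart cmap_inv_in cmap_inv_right)
  then show ?thesis
    unfolding cmap_inv_def[of "prod_chart c d"] using inv_into_f_f[OF inj_on_prod_chart[OF assms(1,2)]] by metis
qed

lemma second_countable_prod:
  assumes "second_countable_space X" "second_countable_space Y"
  shows "second_countable_space (prod_topology X Y)"
proof -
  obtain A where A: "countable A" "\<And>V. V \<in> A \<Longrightarrow> openin X V"
    "\<And>U x. openin X U \<Longrightarrow> x \<in> U \<Longrightarrow> \<exists>V\<in>A. x \<in> V \<and> V \<subseteq> U"
    using assms(1) unfolding second_countable_space_def by metis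
  obtain B where B: "countable B" "\<And>V. V \<in> B \<Longrightarrow> openin Y V"
    "\<And>U x. openin Y U \<Longrightarrow> x \<in> U \<Longrightarrow> \<exists>V\<in>B. x \<in> V \<and> V \<subseteq> U"
    using assms(2) unfolding second_countable_space_def by metis
  show ?thesis
    unfolding second_countable_space_def
  proof (intro exI[of _ "(\<lambda>(U, V). U \<times> V) ` (A \<times> B)"] conjI ballI allI impI)
    show "countable ((\<lambda>(U, V). U \<times> V) ` (A \<times> B))" using A(1) B(1) by simp
    show "openin (prod_topology X Y) W" if "W \<in> (\<lambda>(U, V). U \<times> V) ` (A \<times> B)" for W
      using that A(2) B(2) by (auto simp: openin_prod_Times_iff)
    fix W z assume "openin (prod_topology X Y) W \<and> z \<in> W"
    then obtain U V where UV: "openin X U" "openin Y V" "fst z \<in> U" "snd z \<in> V" "U \<times> V \<subseteq> W"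
      unfolding openin_prod_topology_alt by (metis prod.collapse)
    obtain U' where U': "U' \<in> A" "fst z \<in> U'" "U' \<subseteq> U" using A(3)[OF UV(1,3)] by blast
    obtain V' where V': "V' \<in> B" "snd z \<in> V'" "V' \<subseteq> V" using B(3)[OF UV(2,4)] by blast
    have "z \<in> U' \<times> V'" "U' \<times> V' \<subseteq> W" using U' V' UV(5) by (auto simp: mem_Times_iff)
    then show "\<exists>V\<in>(\<lambda>(U, V). U \<times> V) ` (A \<times> B). z \<in> V \<and> V \<subseteq> W"
      using U'(1) V'(1) by (intro bexI[of _ "U' \<times> V'"]) auto
  qed
qed

lemma homeomorphic_map_prod_chart:
  assumes "homeomorphic_map (subtopology X (fst c)) (top_of_set (cmap_image c)) (snd c)"
    and "homeomorphic_map (subtopology Y (fst d)) (top_of_set (cmap_image d)) (snd d)"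
  shows "homeomorphic_map (subtopology (prod_topology X Y) (fst (prod_chart c d)))
    (top_of_set (cmap_image (prod_chart c d))) (snd (prod_chart c d))"
proof -
  obtain f g where "homeomorphic_maps (subtopology X (fst c)) (top_of_set (cmap_image c)) (snd c) f"
    "homeomorphic_maps (subtopology Y (fst d)) (top_of_set (cmap_image d)) (snd d) g"
    using assms unfolding homeomorphic_map_maps by blast
  then have "homeomorphic_maps (prod_topology (subtopology X (fst c)) (subtopology Y (fst d)))
      (prod_topology (top_of_set (cmap_image c)) (top_of_set (cmap_image d)))
      (\<lambda>(p, q). (snd c p, snd d q)) (\<lambda>(p, q). (f p, g q))"
    using homeomorphic_maps_prod by blast
  then have 1: "homeomorphic_map (subtopology (prod_topology X Y) (fst c \<times> fst d))
      (top_of_set (cmap_image c \<times> cmap_image d)) (\<lambda>(p, q). (snd c p, snd d q))"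
    unfolding homeomorphic_map_maps by (auto simp: subtopology_Times)
  have "homeomorphic_maps (top_of_set (cmap_image c \<times> cmap_image d)) (top_of_set (cmap_image (prod_chart c d)))
     (\<lambda>(a, b). vec_join a b) (\<lambda>x. (vfst x, vsnd x))"
    unfolding homeomorphic_maps_def continuous_map_in_subtopology
    by (auto simp: cmap_image_prod_chart continuous_on_vec_join continuous_on_vproj intro!: continuous_on_Pair)
  then have 2: "homeomorphic_map (top_of_set (cmap_image c \<times> cmap_image d)) (top_of_set (cmap_image (prod_chart c d)))
     (\<lambda>(a, b). vec_join a b)" using homeomorphic_maps_imp_map by blast
  have "(\<lambda>(a, b). vec_join a b) \<circ> (\<lambda>(p, q). (snd c p, snd d q)) = snd (prod_chart c d)"
    by (auto simp: snd_prod_chart)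
  with homeomorphic_map_compose[OF 1 2] show ?thesis by (simp add: fst_prod_chart)
qed

lemma complex_manifold_prod:
  assumes M: "complex_manifold M" and N: "complex_manifold N"
  shows "complex_manifold (prod_manifold M N)"
  unfolding complex_manifold_def prod_manifold_simps
proof (intro conjI ballI)
  show "Hausdorff_space (prod_topology (mtop M) (mtop N))"
    using complex_manifoldD(1)[OF M] complex_manifoldD(1)[OF N] by (simp add: Hausdorff_space_prod_topology)
  show "second_countable_space (prod_topology (mtop M) (mtop N))"
    by (intro second_countable_prod complex_manifoldD(2) M N)
  show "(\<Union>c\<in>{prod_chart c d |c d. c \<in> atlas M \<and> d \<in> atlas N}. fst c) = topspace (prod_topology (mtop M) (mtop N))"
  proof -
    have "(\<Union>c\<in>{prod_chart c d |c d. c \<in> atlas M \<and> d \<in> atlas N}. fst c) =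
        (\<Union>c\<in>atlas M. fst c) \<times> (\<Union>d\<in>atlas N. fst d)"
    proof (intro equalityI subsetI)
      fix z assume "z \<in> (\<Union>c\<in>{prod_chart c d |c d. c \<in> atlas M \<and> d \<in> atlas N}. fst c)"
      then obtain c d where "c \<in> atlas M" "d \<in> atlas N" "z \<in> fst (prod_chart c d)" by blast
      then show "z \<in> (\<Union>c\<in>atlas M. fst c) \<times> (\<Union>d\<in>atlas N. fst d)"
        unfolding fst_prod_chart by blast
    next
      fix z assume "z \<in> (\<Union>c\<in>atlas M. fst c) \<times> (\<Union>d\<in>atlas N. fst d)"
      then obtain c d where cd: "c \<in> atlas M" "d \<in> atlas N" and "z \<in> fst c \<times> fst d" by blast
      then have "z \<in> fst (prod_chart c d)" by (simp only: fst_prod_chart)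
      with cd show "z \<in> (\<Union>c\<in>{prod_chart c d |c d. c \<in> atlas M \<and> d \<in> atlas N}. fst c)" by blast
    qed
    then show ?thesis by (simp add: complex_manifoldD(3)[OF M] complex_manifoldD(3)[OF N])
  qed
next
  fix e assume "e \<in> {prod_chart c d |c d. c \<in> atlas M \<and> d \<in> atlas N}"
  then obtain c d where e: "e = prod_chart c d" and c: "c \<in> atlas M" and d: "d \<in> atlas N" by blast
  show "openin (prod_topology (mtop M) (mtop N)) (fst e)"
    using complex_manifoldD(4)[OF M c] complex_manifoldD(4)[OF N d]
    by (simp add: e fst_prod_chart openin_prod_Times_iff)
  show "open (cmap_image e)"
    unfolding e cmap_image_prod_chart
    by (rule open_vproj[OF complex_manifoldD(5)[OF M c] complex_manifoldD(5)[OF N d]])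
  show "homeomorphic_map (subtopology (prod_topology (mtop M) (mtop N)) (fst e)) (top_of_set (cmap_image e)) (snd e)"
    unfolding e
    by (rule homeomorphic_map_prod_chart[OF complex_manifoldD(6)[OF M c] complex_manifoldD(6)[OF N d]])
  fix e' assume "e' \<in> {prod_chart c d |c d. c \<in> atlas M \<and> d \<in> atlas N}"
  then obtain c' d' where e': "e' = prod_chart c' d'" and c': "c' \<in> atlas M" and d': "d' \<in> atlas N" by blast
  let ?A = "snd c ` (fst c \<inter> fst c')" and ?B = "snd d ` (fst d \<inter> fst d')"
  have AB: "snd e ` (fst e \<inter> fst e') = {x. vfst x \<in> ?A \<and> vsnd x \<in> ?B}"
  proof -
    have "fst e \<inter> fst e' = (fst c \<inter> fst c') \<times> (fst d \<inter> fst d')" by (auto simp: e e' fst_prod_chart)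
    then show ?thesis by (simp only: e image_prod_chart)
  qed
  have op: "open ?A" "open ?B"
    by (rule open_chart_image[OF M c openin_Int[OF complex_manifoldD(4)[OF M c] complex_manifoldD(4)[OF M c']]], simp)
       (rule open_chart_image[OF N d openin_Int[OF complex_manifoldD(4)[OF N d] complex_manifoldD(4)[OF N d']]], simp)
  let ?S = "{x. vfst x \<in> ?A \<and> vsnd x \<in> ?B}"
  have S: "open ?S" by (rule open_vproj[OF op])
  have "holo_on ?S (\<lambda>x. (snd c' \<circ> cmap_inv c) (vfst x))"
    by (rule holo_on_vproj(1)[OF op complex_manifoldD(7)[OF M c c']])
  moreover have "holo_on ?S (\<lambda>x. (snd d' \<circ> cmap_inv d) (vsnd x))"
    by (rule holo_on_vproj(2)[OF op complex_manifoldD(7)[OF N d d']])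
  ultimately have H: "holo_on ?S (\<lambda>x. vec_join ((snd c' \<circ> cmap_inv c) (vfst x)) ((snd d' \<circ> cmap_inv d) (vsnd x)))"
    by (rule holo_on_vec_join[OF S])
  show "holo_on (snd e ` (fst e \<inter> fst e')) (snd e' \<circ> cmap_inv e)"
    unfolding AB
  proof (rule holo_on_cong[OF S _ H])
    fix x assume "x \<in> ?S"
    then have "x \<in> cmap_image (prod_chart c d)"
      unfolding mem_Collect_eq cmap_image_def[of c] cmap_image_def[of d]
      by (rule in_cmap_image_prod_chart) auto
    from cmap_inv_prod_chart[OF inj_on_chart[OF M c] inj_on_chart[OF N d] this]
    show "vec_join ((snd c' \<circ> cmap_inv c) (vfst x)) ((snd d' \<circ> cmap_inv d) (vsnd x)) = (snd e' \<circ> cmap_inv e) x"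
      by (simp add: e e' snd_prod_chart)
  qed
qed

lemma holomorphic_map_fst:
  assumes M: "complex_manifold M" and N: "complex_manifold N"
  shows "holomorphic_map (prod_manifold M N) M fst"
  unfolding holomorphic_map_def prod_manifold_simps
proof (intro conjI ballI)
  show "continuous_map (prod_topology (mtop M) (mtop N)) (mtop M) fst" by (rule continuous_map_fst)
  fix e c' assume "e \<in> {prod_chart c d |c d. c \<in> atlas M \<and> d \<in> atlas N}" and c': "c' \<in> atlas M"
  then obtain c d where e: "e = prod_chart c d" and c: "c \<in> atlas M" and d: "d \<in> atlas N" by blast
  let ?A = "snd c ` (fst c \<inter> fst c')" and ?B = "cmap_image d"
  let ?S = "{x. vfst x \<in> ?A \<and> vsnd x \<in> ?B}"
  have S_eq: "snd e ` {y \<in> fst e. fst y \<in> fst c'} = ?S"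
  proof -
    have "{y \<in> fst e. fst y \<in> fst c'} = (fst c \<inter> fst c') \<times> (fst d)" by (auto simp: e fst_prod_chart)
    then show ?thesis by (simp only: e image_prod_chart cmap_image_def)
  qed
  have A: "open ?A"
    by (rule open_chart_image[OF M c openin_Int[OF complex_manifoldD(4)[OF M c] complex_manifoldD(4)[OF M c']]]) simp
  have S: "open ?S" by (rule open_vproj[OF A complex_manifoldD(5)[OF N d]])
  have H: "holo_on ?S (\<lambda>x. (snd c' \<circ> cmap_inv c) (vfst x))"
    by (rule holo_on_vproj(1)[OF A complex_manifoldD(5)[OF N d] complex_manifoldD(7)[OF M c c']])
  show "holo_on (snd e ` {y \<in> fst e. fst y \<in> fst c'}) (snd c' \<circ> fst \<circ> cmap_inv e)"
    unfolding S_eq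
  proof (rule holo_on_cong[OF S _ H])
    fix x assume "x \<in> ?S"
    then have "x \<in> cmap_image (prod_chart c d)"
      unfolding mem_Collect_eq cmap_image_def[of c] cmap_image_def[of d]
      by (rule in_cmap_image_prod_chart) auto
    from cmap_inv_prod_chart[OF inj_on_chart[OF M c] inj_on_chart[OF N d] this]
    show "(snd c' \<circ> cmap_inv c) (vfst x) = (snd c' \<circ> fst \<circ> cmap_inv e) x" by (simp add: e)
  qed
qed

lemma holomorphic_map_snd:
  assumes M: "complex_manifold M" and N: "complex_manifold N"
  shows "holomorphic_map (prod_manifold M N) N snd"
  unfolding holomorphic_map_def prod_manifold_simps
proof (intro conjI ballI)
  show "continuous_map (prod_topology (mtop M) (mtop N)) (mtop N) snd" by (rule continuous_map_snd)
  fix e d' assume "e \<in> {prod_chart c d |c d. c \<in> atlas M \<and> d \<in> atlas N}" and d': "d' \<in> atlas N"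
  then obtain c d where e: "e = prod_chart c d" and c: "c \<in> atlas M" and d: "d \<in> atlas N" by blast
  let ?A = "cmap_image c" and ?B = "snd d ` (fst d \<inter> fst d')"
  let ?S = "{x. vfst x \<in> ?A \<and> vsnd x \<in> ?B}"
  have S_eq: "snd e ` {y \<in> fst e. snd y \<in> fst d'} = ?S"
  proof -
    have "{y \<in> fst e. snd y \<in> fst d'} = (fst c) \<times> (fst d \<inter> fst d')" by (auto simp: e fst_prod_chart)
    then show ?thesis by (simp only: e image_prod_chart cmap_image_def)
  qed
  have B: "open ?B"
    by (rule open_chart_image[OF N d openin_Int[OF complex_manifoldD(4)[OF N d] complex_manifoldD(4)[OF N d']]]) simp
  have S: "open ?S" by (rule open_vproj[OF complex_manifoldD(5)[OF M c] B])
  have H: "holo_on ?S (\<lambda>x. (snd d' \<circ> cmap_inv d) (vsnd x))"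
    by (rule holo_on_vproj(2)[OF complex_manifoldD(5)[OF M c] B complex_manifoldD(7)[OF N d d']])
  show "holo_on (snd e ` {y \<in> fst e. snd y \<in> fst d'}) (snd d' \<circ> snd \<circ> cmap_inv e)"
    unfolding S_eq
  proof (rule holo_on_cong[OF S _ H])
    fix x assume "x \<in> ?S"
    then have "x \<in> cmap_image (prod_chart c d)"
      unfolding mem_Collect_eq cmap_image_def[of c] cmap_image_def[of d]
      by (rule in_cmap_image_prod_chart) auto
    from cmap_inv_prod_chart[OF inj_on_chart[OF M c] inj_on_chart[OF N d] this]
    show "(snd d' \<circ> cmap_inv d) (vsnd x) = (snd d' \<circ> snd \<circ> cmap_inv e) x" by (simp add: e)
  qed
qed

lemma holomorphic_map_map_prod:
  assumes M: "complex_manifold M" and N: "complex_manifold N"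
    and M': "complex_manifold M'" and N': "complex_manifold N'"
    and F: "holomorphic_map M M' F" and G: "holomorphic_map N N' G"
  shows "holomorphic_map (prod_manifold M N) (prod_manifold M' N') (map_prod F G)"
  unfolding holomorphic_map_def prod_manifold_simps
proof (intro conjI ballI)
  note cF = holomorphic_map_continuous[OF F] and cG = holomorphic_map_continuous[OF G]
  show "continuous_map (prod_topology (mtop M) (mtop N)) (prod_topology (mtop M') (mtop N')) (map_prod F G)"
    using cF cG unfolding map_prod_def continuous_map_prod_top by blast
  fix e e' assume "e \<in> {prod_chart c d |c d. c \<in> atlas M \<and> d \<in> atlas N}"
    and "e' \<in> {prod_chart c d |c d. c \<in> atlas M' \<and> d \<in> atlas N'}"
  then obtain c d c' d' where e: "e = prod_chart c d" "e' = prod_chart c' d'"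
    and c: "c \<in> atlas M" and d: "d \<in> atlas N" and c': "c' \<in> atlas M'" and d': "d' \<in> atlas N'" by blast
  let ?A = "snd c ` {p \<in> fst c. F p \<in> fst c'}" and ?B = "snd d ` {q \<in> fst d. G q \<in> fst d'}"
  let ?S = "{x. vfst x \<in> ?A \<and> vsnd x \<in> ?B}"
  have S_eq: "snd e ` {y \<in> fst e. map_prod F G y \<in> fst e'} = ?S"
  proof -
    have "{y \<in> fst e. map_prod F G y \<in> fst e'} = ({p \<in> fst c. F p \<in> fst c'}) \<times> ({q \<in> fst d. G q \<in> fst d'})" by (auto simp: e fst_prod_chart)
    then show ?thesis by (simp only: e image_prod_chart cmap_image_def)
  qed
  have A: "open ?A" by (rule open_chart_domain[OF M M' cF c c'])
  have B: "open ?B" by (rule open_chart_domain[OF N N' cG d d'])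
  have S: "open ?S" by (rule open_vproj[OF A B])
  have HA: "holo_on ?S (\<lambda>x. (snd c' \<circ> F \<circ> cmap_inv c) (vfst x))"
    by (rule holo_on_vproj(1)[OF A B holomorphic_map_holo[OF F c c']])
  have HB: "holo_on ?S (\<lambda>x. (snd d' \<circ> G \<circ> cmap_inv d) (vsnd x))"
    by (rule holo_on_vproj(2)[OF A B holomorphic_map_holo[OF G d d']])
  show "holo_on (snd e ` {y \<in> fst e. map_prod F G y \<in> fst e'}) (snd e' \<circ> map_prod F G \<circ> cmap_inv e)"
    unfolding S_eq
  proof (rule holo_on_cong[OF S _ holo_on_vec_join[OF S HA HB]])
    fix x assume "x \<in> ?S"
    then have "x \<in> cmap_image (prod_chart c d)"
      unfolding mem_Collect_eq cmap_image_def[of c] cmap_image_def[of d]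
      by (rule in_cmap_image_prod_chart) auto
    from cmap_inv_prod_chart[OF inj_on_chart[OF M c] inj_on_chart[OF N d] this]
    show "vec_join ((snd c' \<circ> F \<circ> cmap_inv c) (vfst x)) ((snd d' \<circ> G \<circ> cmap_inv d) (vsnd x)) =
        (snd e' \<circ> map_prod F G \<circ> cmap_inv e) x" by (simp add: e snd_prod_chart)
  qed
qed

lemma chart_deriv_proj:
  assumes M: "complex_manifold M" and N: "complex_manifold N"
    and c: "c \<in> atlas M" and d: "d \<in> atlas N" and y: "y \<in> fst (prod_chart c d)"
  shows "chart_deriv (prod_chart c d) c fst y = vfst" "chart_deriv (prod_chart c d) d snd y = vsnd"
proof -
  let ?e = "prod_chart c d"
  have op: "open (cmap_image ?e)"
    unfolding cmap_image_prod_chart by (rule open_vproj[OF complex_manifoldD(5)[OF M c] complex_manifoldD(5)[OF N d]])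
  have y': "snd ?e y \<in> cmap_image ?e" using y by (auto simp: cmap_image_def)
  have inv: "cmap_inv ?e x = (cmap_inv c (vfst x), cmap_inv d (vsnd x))"
    "vfst x \<in> cmap_image c" "vsnd x \<in> cmap_image d" if "x \<in> cmap_image ?e" for x
    using cmap_inv_prod_chart[OF inj_on_chart[OF M c] inj_on_chart[OF N d] that] that
    by (auto simp: cmap_image_prod_chart)
  have "frechet_derivative (snd c \<circ> fst \<circ> cmap_inv ?e) (at (snd ?e y)) = frechet_derivative vfst (at (snd ?e y))"
    by (rule frechet_derivative_cong_open[OF op y']) (simp add: inv cmap_inv_right)
  then show "chart_deriv ?e c fst y = vfst"
    by (simp add: chart_deriv_def frechet_derivative_eqI[OF linear_imp_has_derivative[OF linear_vfst]])
  have "frechet_derivative (snd d \<circ> snd \<circ> cmap_inv ?e) (at (snd ?e y)) = frechet_derivative vsnd (at (snd ?e y))"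
    by (rule frechet_derivative_cong_open[OF op y']) (simp add: inv cmap_inv_right)
  then show "chart_deriv ?e d snd y = vsnd"
    by (simp add: chart_deriv_def frechet_derivative_eqI[OF linear_imp_has_derivative[OF linear_vsnd]])
qed

section \<open>The covering manifold\<close>

abbreviation punctured_chart :: "(complex ^ 2, 2) chart" where
  "punctured_chart \<equiv> (- {0}, \<lambda>x. x)"

lemma punctured_C2_simps: "mtop punctured_C2 = top_of_set (- {0})" "atlas punctured_C2 = {punctured_chart}"
  by (simp_all add: punctured_C2_def)

lemma cmap_punctured: "cmap_image punctured_chart = - {0}"
  "x \<noteq> 0 \<Longrightarrow> cmap_inv punctured_chart x = x"
proof -
  show "cmap_image punctured_chart = - {0}" by (simp add: cmap_image_def)
  have "inv_into (- {0}) (\<lambda>x. x) x = x" if "x \<noteq> (0 :: complex ^ 2)"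
    using inv_into_f_f[of "\<lambda>x. x" "- {0 :: complex ^ 2}" x] that by (simp add: inj_on_def)
  then show "x \<noteq> 0 \<Longrightarrow> cmap_inv punctured_chart x = x" by (simp add: cmap_inv_def)
qed

lemma linear_holo_on_punctured:
  assumes L: "linear L" "\<And>v. L (imult v) = imult (L v)" and S: "S \<subseteq> - {0}" "open S"
  shows "holo_on S (L \<circ> cmap_inv punctured_chart)"
proof (rule holo_on_cong[OF S(2) _ holo_on_linear[OF L]])
  fix x assume "x \<in> S"
  then have "x \<noteq> 0" using S(1) by blast
  then show "L x = (L \<circ> cmap_inv punctured_chart) x" by (simp add: cmap_punctured(2))
qed

lemma second_countable_top_of_set:
  "second_countable_space (top_of_set (S :: 'v::euclidean_space set))"
proof -
  obtain B :: "'v set set" where B: "countable B" "\<And>C. C \<in> B \<Longrightarrow> openin (top_of_set S) C"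
    "\<And>T. openin (top_of_set S) T \<Longrightarrow> \<exists>U. U \<subseteq> B \<and> T = \<Union>U"
    using subset_second_countable[of S] by metis
  show ?thesis
    unfolding second_countable_space_def
  proof (intro exI[of _ B] conjI ballI allI impI)
    fix U x assume "openin (top_of_set S) U \<and> x \<in> U"
    then show "\<exists>V\<in>B. x \<in> V \<and> V \<subseteq> U" using B(3)[of U] by blast
  qed (use B in auto)
qed

lemma complex_manifold_punctured_C2: "complex_manifold punctured_C2"
  unfolding complex_manifold_def punctured_C2_simps
proof (intro conjI ballI)
  show "Hausdorff_space (top_of_set (- {0 :: complex ^ 2}))"
    by (rule Hausdorff_space_subtopology) simp
  show "second_countable_space (top_of_set (- {0 :: complex ^ 2}))" by (rule second_countable_top_of_set)
  show "(\<Union>c\<in>{punctured_chart}. fst c) = topspace (top_of_set (- {0}))" by simp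
  fix c d :: "(complex ^ 2, 2) chart" assume c: "c \<in> {punctured_chart}" and d: "d \<in> {punctured_chart}"
  show "openin (top_of_set (- {0})) (fst c)" "open (cmap_image c)"
    using c by (auto simp: cmap_punctured openin_subtopology_self)
  show "homeomorphic_map (subtopology (top_of_set (- {0})) (fst c)) (top_of_set (cmap_image c)) (snd c)"
    using c homeomorphic_map_id[of "top_of_set (- {0 :: complex ^ 2})"]
    by (auto simp: cmap_punctured subtopology_subtopology id_def)
  have "holo_on (- {0}) ((\<lambda>x. x) \<circ> cmap_inv punctured_chart)"
    by (rule linear_holo_on_punctured) (auto simp: linear_ident)
  then show "holo_on (snd c ` (fst c \<inter> fst d)) (snd d \<circ> cmap_inv c)" using c d by simp
qed

lemma holomorphic_map_scale:
  assumes "r \<noteq> 0"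
  shows "holomorphic_map punctured_C2 punctured_C2 (\<lambda>x. r *\<^sub>R x)"
  unfolding holomorphic_map_def punctured_C2_simps
proof (intro conjI ballI)
  show "continuous_map (top_of_set (- {0})) (top_of_set (- {0 :: complex ^ 2})) (\<lambda>x. r *\<^sub>R x)"
    using assms by (auto simp: continuous_map_in_subtopology intro!: continuous_intros)
  fix c d :: "(complex ^ 2, 2) chart" assume c: "c \<in> {punctured_chart}" and d: "d \<in> {punctured_chart}"
  have "holo_on (- {0}) ((\<lambda>x. r *\<^sub>R x) \<circ> cmap_inv punctured_chart)"
    by (rule linear_holo_on_punctured)
       (auto intro!: linearI simp: scaleR_add_right linear_cmul[OF linear_imult] mult.commute)
  moreover have "{p \<in> - {0 :: complex ^ 2}. r *\<^sub>R p \<in> - {0}} = - {0}" using assms by auto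
  ultimately show "holo_on (snd c ` {p \<in> fst c. r *\<^sub>R p \<in> fst d}) (snd d \<circ> (\<lambda>x. r *\<^sub>R x) \<circ> cmap_inv c)"
    using c d by (simp add: o_def)
qed

lemma chart_deriv_scale:
  assumes "x \<noteq> 0" "r \<noteq> 0"
  shows "chart_deriv punctured_chart punctured_chart (\<lambda>x. r *\<^sub>R x) x = (\<lambda>u. r *\<^sub>R u)"
proof -
  have "frechet_derivative ((\<lambda>x. x) \<circ> (\<lambda>x. r *\<^sub>R x) \<circ> cmap_inv punctured_chart) (at x) = frechet_derivative (\<lambda>x. r *\<^sub>R x) (at x)"
    by (rule frechet_derivative_cong_open[of "- {0}"]) (use assms in \<open>auto simp: cmap_punctured(2)\<close>)
  also have "\<dots> = (\<lambda>u. r *\<^sub>R u)"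
    by (rule frechet_derivative_eqI) (auto intro!: derivative_eq_intros)
  finally show ?thesis by (simp add: chart_deriv_def)
qed

lemma chart_at_punctured: "chart_at punctured_C2 x = punctured_chart" if "x \<noteq> 0"
  using chart_at(1)[OF complex_manifold_punctured_C2, of x] that by (simp add: punctured_C2_simps)

lemma coord_form_euclidean:
  assumes "x \<noteq> 0"
  shows "coord_form punctured_C2 euclidean_metric punctured_chart x u v = u \<bullet> v"
  using coord_form_chart_at[OF complex_manifold_punctured_C2, of x euclidean_metric u v] assms
  by (simp add: chart_at_punctured punctured_C2_simps euclidean_metric_def)

lemma complex_manifold_cover: "complex_manifold K \<Longrightarrow> complex_manifold (cover K)"
  unfolding cover_def by (intro complex_manifold_prod complex_manifold_punctured_C2)

lemma atlas_cover: "atlas (cover K) = {prod_chart c punctured_chart | c. c \<in> atlas K}"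
  by (auto simp: cover_def prod_manifold_simps punctured_C2_simps)

lemma topspace_cover: "topspace (mtop (cover K)) = topspace (mtop K) \<times> (- {0})"
  by (simp add: cover_def prod_manifold_simps punctured_C2_simps)

lemma coord_form_cover_metric:
  assumes K: "complex_manifold K" and c: "c \<in> atlas K" and x: "x \<in> cmap_image (prod_chart c punctured_chart)"
  shows "coord_form (cover K) (cover_metric K g) (prod_chart c punctured_chart) x u v =
     sum_form (coord_form K g c) hopf_metric x u v"
proof -
  let ?e = "prod_chart c punctured_chart"
  note P = complex_manifold_punctured_C2
  have e: "?e \<in> atlas (cover K)" unfolding atlas_cover using c by blast
  have P': "punctured_chart \<in> atlas punctured_C2" by (simp add: punctured_C2_simps)
  note C = complex_manifold_cover[OF K]
  define y where "y = cmap_inv ?e x"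
  have y: "y \<in> fst ?e" "snd ?e y = x" using x by (simp_all add: y_def cmap_inv_in cmap_inv_right)
  then have y': "fst y \<in> fst c" "snd y \<in> - {0}" "snd c (fst y) = vfst x" "snd y = vsnd x"
    by (auto simp: fst_prod_chart snd_prod_chart)
  have f: "holomorphic_map (cover K) K fst" "holomorphic_map (cover K) punctured_C2 snd"
    unfolding cover_def by (rule holomorphic_map_fst[OF K P] holomorphic_map_snd[OF K P])+
  have "coord_form (cover K) (pullback (cover K) K fst g) ?e x u v = coord_form K g c (vfst x) (vfst u) (vfst v)"
    using coord_form_pullback[OF C K f(1) e c y(1) y'(1), of g u v] chart_deriv_proj[OF K P c P' y(1)] y y' by simp
  moreover have "coord_form (cover K) (pullback (cover K) punctured_C2 snd euclidean_metric) ?e x u v = vsnd u \<bullet> vsnd v"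
    using coord_form_pullback[OF C P f(2) e P' y(1), of euclidean_metric u v] chart_deriv_proj[OF K P c P' y(1)] y y'
    by (simp add: coord_form_euclidean)
  moreover have "coord_form (cover K) (cover_metric K g) ?e x u v =
      coord_form (cover K) (pullback (cover K) K fst g) ?e x u v +
      coord_form (cover K) (pullback (cover K) punctured_C2 snd euclidean_metric) ?e x u v / (norm (snd y))\<^sup>2"
    by (simp add: coord_form_def cover_metric_def Let_def y_def)
  ultimately show ?thesis
    using y' by (simp add: sum_form_def hopf_metric_def power2_norm_eq_inner field_simps)
qed


section \<open>Quotients by a properly discontinuous action of the integers\<close>

text \<open>In the chart chosen at \<open>p\<close> the coordinate expression of \<open>g\<close> at \<open>p\<close> is \<open>g p\<close> itself, so pointwise
properties may be checked in charts.\<close>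

lemma hermitian_metricI:
  assumes M: "complex_manifold M"
    and form: "\<And>c x. c \<in> atlas M \<Longrightarrow> x \<in> cmap_image c \<Longrightarrow> hermitian_form (coord_form M g c x)"
    and smooth: "\<And>c u v. c \<in> atlas M \<Longrightarrow> smooth_on (cmap_image c) (\<lambda>x. coord_form M g c x u v)"
  shows "hermitian_metric M g"
proof -
  have "hermitian_form (g p)" if p: "p \<in> topspace (mtop M)" for p
  proof -
    note c = chart_at[OF M p]
    have "coord_form M g (chart_at M p) (snd (chart_at M p) p) = g p"
      by (intro ext) (rule coord_form_chart_at[OF M p])
    moreover have "snd (chart_at M p) p \<in> cmap_image (chart_at M p)" using c(2) by (auto simp: cmap_image_def)
    ultimately show ?thesis using form[OF c(1)] by metis
  qed
  then show ?thesis
    unfolding hermitian_metric_def hermitian_form_def using smooth by blast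
qed

text \<open>An action of the integers by biholomorphisms, with quotient map \<open>q\<close>.  The height stands for the real coordinate
of a mapping torus.  As it increases by \<open>n\<close> under the action of \<open>n\<close>, only finitely many translates can meet
near two given points: the height makes the action free and properly discontinuous.\<close>

locale deck_group =
  fixes M :: "('b, 'n::finite) cmfd" and Y :: "'a topology"
    and \<gamma> :: "int \<Rightarrow> 'b \<Rightarrow> 'b" and height :: "'b \<Rightarrow> real" and q :: "'b \<Rightarrow> 'a"
  assumes M: "complex_manifold M"
    and holomorphic_deck: "holomorphic_map M M (\<gamma> n)"
    and deck_0: "y \<in> topspace (mtop M) \<Longrightarrow> \<gamma> 0 y = y"
    and deck_add: "y \<in> topspace (mtop M) \<Longrightarrow> \<gamma> (m + n) y = \<gamma> m (\<gamma> n y)"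
    and continuous_height: "continuous_map (mtop M) euclideanreal height"
    and height_deck: "y \<in> topspace (mtop M) \<Longrightarrow> height (\<gamma> n y) = height y + of_int n"
    and quotient: "quotient_map (mtop M) Y q"
    and fibre: "y \<in> topspace (mtop M) \<Longrightarrow> y' \<in> topspace (mtop M) \<Longrightarrow> q y = q y' \<longleftrightarrow> (\<exists>n. y' = \<gamma> n y)"
begin

abbreviation "X \<equiv> topspace (mtop M)"

lemma continuous_deck: "continuous_map (mtop M) (mtop M) (\<gamma> n)"
  by (rule holomorphic_map_continuous[OF holomorphic_deck])

lemma deck_in: "y \<in> X \<Longrightarrow> \<gamma> n y \<in> X"
  using continuous_deck[of n] by (auto simp: continuous_map)

lemma q_deck: "y \<in> X \<Longrightarrow> q (\<gamma> n y) = q y"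
  using fibre[of y "\<gamma> n y"] deck_in by metis

lemma q_image: "q ` X = topspace Y"
  using quotient by (rule quotient_imp_surjective_map)

lemma openin_deck_vimage: "openin (mtop M) U \<Longrightarrow> openin (mtop M) {y \<in> X. \<gamma> n y \<in> U}"
  using continuous_deck[of n] by (auto simp: continuous_map)

lemma open_q:
  assumes U: "openin (mtop M) U"
  shows "openin Y (q ` U)"
proof -
  have UX: "U \<subseteq> X" using openin_subset[OF U] .
  have "{y \<in> X. q y \<in> q ` U} = (\<Union>n. {y \<in> X. \<gamma> n y \<in> U})"
  proof (intro equalityI subsetI)
    fix y assume "y \<in> {y \<in> X. q y \<in> q ` U}"
    then obtain u where u: "y \<in> X" "u \<in> U" "q y = q u" by auto
    then show "y \<in> (\<Union>n. {y \<in> X. \<gamma> n y \<in> U})" using fibre[of y u] UX by auto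
  next
    fix y assume "y \<in> (\<Union>n. {y \<in> X. \<gamma> n y \<in> U})"
    then obtain n where "y \<in> X" "\<gamma> n y \<in> U" by auto
    then show "y \<in> {y \<in> X. q y \<in> q ` U}" using q_deck[of y n] by (metis (mono_tags) imageI mem_Collect_eq)
  qed
  then have "openin (mtop M) {y \<in> X. q y \<in> q ` U}" using openin_deck_vimage[OF U] by auto
  moreover have "q ` U \<subseteq> topspace Y" using UX q_image by blast
  ultimately show ?thesis using quotient unfolding quotient_map_def by blast
qed

lemma continuous_q: "continuous_map (mtop M) Y q"
  by (rule quotient_imp_continuous_map[OF quotient])

text \<open>The translates of a strip of total width 1 are disjoint, so \<open>q\<close> is injective on it.\<close>

definition strip :: "'b \<Rightarrow> 'b set" where
  "strip y = {y' \<in> X. \<bar>height y' - height y\<bar> < 1 / 2}"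

lemma openin_strip: "openin (mtop M) (strip y)"
proof -
  have "openin (mtop M) {y' \<in> X. height y' \<in> ball (height y) (1 / 2)}"
    using continuous_height open_ball unfolding continuous_map by (auto simp del: mem_ball)
  then show ?thesis by (simp add: strip_def dist_real_def abs_minus_commute)
qed

lemma strip_deck:
  assumes "a \<in> strip y" "\<gamma> n a \<in> strip y"
  shows "n = 0"
proof -
  have "height (\<gamma> n a) = height a + of_int n" using assms height_deck by (auto simp: strip_def)
  moreover have "\<bar>height a - height y\<bar> < 1 / 2" "\<bar>height (\<gamma> n a) - height y\<bar> < 1 / 2"
    using assms unfolding strip_def by blast+
  ultimately show ?thesis by linarith
qed

lemma inj_on_strip: "inj_on q (strip y)"
proof (rule inj_onI)
  fix a b assume ab: "a \<in> strip y" "b \<in> strip y" "q a = q b"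
  then obtain n where n: "b = \<gamma> n a" using fibre by (auto simp: strip_def)
  then have "n = 0" using ab strip_deck by blast
  then show "a = b" using n ab(1) deck_0 by (auto simp: strip_def)
qed

text \<open>Of all translates of the strip around \<open>y\<close>, only those by two consecutive integers can meet the strip around
\<open>y'\<close>.  For each of these integers the translate of \<open>y\<close> is separated from \<open>y'\<close> in the covering manifold, and
the two pairs of neighbourhoods can be intersected.\<close>

lemma Hausdorff_quotient: "Hausdorff_space Y"
  unfolding Hausdorff_space_def
proof (intro allI impI)
  fix p p' assume pp: "p \<in> topspace Y \<and> p' \<in> topspace Y \<and> p \<noteq> p'"
  then obtain y y' where y: "y \<in> X" "y' \<in> X" "p = q y" "p' = q y'" using q_image by blast
  have "\<gamma> n y \<noteq> y'" for n using y pp q_deck by metis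
  \<comment> \<open>the difference of the heights of points of the two strips is within 1 of \<open>height y' - height y\<close>, so only \<open>m\<close> and \<open>m + 1\<close> matter\<close>
  define m where "m = \<lfloor>height y' - height y\<rfloor>"
  have "\<exists>V V'. openin (mtop M) V \<and> openin (mtop M) V' \<and> y \<in> V \<and> y' \<in> V' \<and> (\<forall>a\<in>V. \<gamma> n a \<notin> V')" for n
  proof -
    have "\<gamma> n y \<in> X" "\<gamma> n y \<noteq> y'" using y deck_in \<open>\<gamma> n y \<noteq> y'\<close> by auto
    then obtain V V' where V: "openin (mtop M) V" "openin (mtop M) V'" "\<gamma> n y \<in> V" "y' \<in> V'" "disjnt V V'"
      using complex_manifoldD(1)[OF M] y(2) unfolding Hausdorff_space_def by metis
    then show ?thesis using y openin_deck_vimage[OF V(1), of n]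
      by (intro exI[of _ "{a \<in> X. \<gamma> n a \<in> V}"] exI[of _ V']) (auto simp: disjnt_iff)
  qed
  then obtain V V' where V: "\<And>n. openin (mtop M) (V n)" "\<And>n. openin (mtop M) (V' n)" "\<And>n. y \<in> V n"
    "\<And>n. y' \<in> V' n" "\<And>n a. a \<in> V n \<Longrightarrow> \<gamma> n a \<notin> V' n" by metis
  define U where "U = strip y \<inter> (V m \<inter> V (m + 1))"
  define U' where "U' = strip y' \<inter> (V' m \<inter> V' (m + 1))"
  have op: "openin (mtop M) U" "openin (mtop M) U'" unfolding U_def U'_def by (intro openin_Int openin_strip V)+
  have sep: "\<gamma> n a \<notin> U'" if "a \<in> U" for n a
  proof
    assume a': "\<gamma> n a \<in> U'"
    have "height (\<gamma> n a) = height a + of_int n" using that by (intro height_deck) (auto simp: U_def strip_def)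
    moreover have "\<bar>height a - height y\<bar> < 1 / 2" "\<bar>height (\<gamma> n a) - height y'\<bar> < 1 / 2"
      using that a' unfolding U_def U'_def strip_def by blast+
    ultimately have "n = m \<or> n = m + 1" unfolding m_def by linarith
    then show False using V(5) that a' unfolding U_def U'_def by auto
  qed
  have UX: "U \<subseteq> X" "U' \<subseteq> X" using op openin_subset by auto
  have "q a \<noteq> q b" if ab: "a \<in> U" "b \<in> U'" for a b
  proof
    assume "q a = q b"
    then obtain n where "b = \<gamma> n a" using fibre[of a b] ab UX by blast
    then show False using sep ab by blast
  qed
  then have "disjnt (q ` U) (q ` U')" unfolding disjnt_iff by blast
  moreover have "y \<in> U" "y' \<in> U'" using y V by (auto simp: U_def U'_def strip_def)
  ultimately show "\<exists>U V. openin Y U \<and> openin Y V \<and> p \<in> U \<and> p' \<in> V \<and> disjnt U V"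
    using open_q[OF op(1)] open_q[OF op(2)] y by blast
qed

lemma second_countable_quotient: "second_countable_space Y"
proof -
  obtain B where B: "countable B" "\<And>V. V \<in> B \<Longrightarrow> openin (mtop M) V"
    "\<And>U x. openin (mtop M) U \<Longrightarrow> x \<in> U \<Longrightarrow> \<exists>V\<in>B. x \<in> V \<and> V \<subseteq> U"
    using complex_manifoldD(2)[OF M] unfolding second_countable_space_def by metis
  show ?thesis
    unfolding second_countable_space_def
  proof (intro exI[of _ "(`) q ` B"] conjI ballI allI impI)
    show "countable ((`) q ` B)" using B(1) by simp
    show "openin Y V" if "V \<in> (`) q ` B" for V using that B(2) open_q by auto
    fix U p assume U: "openin Y U \<and> p \<in> U"
    then obtain y where y: "y \<in> X" "p = q y" using openin_subset q_image by blast
    have "openin (mtop M) {y \<in> X. q y \<in> U}" using U continuous_q by (auto simp: continuous_map)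
    then obtain V where V: "V \<in> B" "y \<in> V" "V \<subseteq> {y \<in> X. q y \<in> U}" using B(3) y U by blast
    then show "\<exists>V\<in>(`) q ` B. p \<in> V \<and> V \<subseteq> U" using y by (intro bexI[of _ "q ` V"]) auto
  qed
qed

text \<open>Two local inverses of \<open>q\<close> differ by a deck transformation.  Hence the changes between the charts of the quotient
are locally coordinate expressions of deck transformations.\<close>

lemma local_inverse_deck:
  assumes W: "openin (mtop M) W" "inj_on q W" and y: "y \<in> X" "q y \<in> q ` W"
  shows "\<exists>n V. openin (mtop M) V \<and> y \<in> V \<and> (\<forall>z\<in>V. q z \<in> q ` W \<and> inv_into W q (q z) = \<gamma> n z \<and> \<gamma> n z \<in> W)"
proof -
  obtain w where w: "w \<in> W" "q y = q w" using y(2) by auto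
  moreover have "w \<in> X" using w openin_subset[OF W(1)] by blast
  ultimately obtain n where n: "w = \<gamma> n y" using fibre y(1) by blast
  have "q z \<in> q ` W \<and> inv_into W q (q z) = \<gamma> n z \<and> \<gamma> n z \<in> W" if "z \<in> {z \<in> X. \<gamma> n z \<in> W}" for z
  proof -
    have z: "z \<in> X" "\<gamma> n z \<in> W" using that by auto
    have "q z = q (\<gamma> n z)" using q_deck z(1) by metis
    then show ?thesis using z(2) inv_into_f_f[OF W(2)] by auto
  qed
  moreover have "y \<in> {z \<in> X. \<gamma> n z \<in> W}" using y(1) w(1) n by auto
  ultimately show ?thesis using openin_deck_vimage[OF W(1)] by blast
qed

section \<open>The induced complex structure\<close>

abbreviation "N \<equiv> induced_manifold M Y q"

definition lifted_chart :: "'b set \<Rightarrow> ('b, 'n) chart \<Rightarrow> ('a, 'n) chart" where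
  "lifted_chart W c = (q ` W, snd c \<circ> inv_into W q)"

definition liftable :: "'b set \<Rightarrow> ('b, 'n) chart \<Rightarrow> bool" where
  "liftable W c \<longleftrightarrow> c \<in> atlas M \<and> W \<subseteq> fst c \<and> openin (mtop M) W \<and> inj_on q W"

lemma mtop_N: "mtop N = Y"
  by (simp add: induced_manifold_def)

lemma atlas_N: "atlas N = {lifted_chart W c | W c. liftable W c}"
  by (auto simp: induced_manifold_def lifted_chart_def liftable_def)

lemma liftableD:
  assumes "liftable W c"
  shows "c \<in> atlas M" "W \<subseteq> fst c" "openin (mtop M) W" "inj_on q W"
  using assms by (auto simp: liftable_def)

lemma liftable_strip:
  assumes "c \<in> atlas M"
  shows "liftable (fst c \<inter> strip y) c"
  using assms complex_manifoldD(4)[OF M assms] openin_strip inj_on_subset[OF inj_on_strip Int_lower2]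
  by (auto simp: liftable_def)

lemma fst_lifted_chart: "fst (lifted_chart W c) = q ` W"
  by (simp add: lifted_chart_def)

lemma snd_lifted_chart: "liftable W c \<Longrightarrow> y \<in> W \<Longrightarrow> snd (lifted_chart W c) (q y) = snd c y"
  using inv_into_f_f[OF liftableD(4)] by (simp add: lifted_chart_def)

lemma cmap_image_lifted_chart: "liftable W c \<Longrightarrow> cmap_image (lifted_chart W c) = snd c ` W"
  unfolding cmap_image_def fst_lifted_chart by (auto simp: snd_lifted_chart image_iff)

lemma inj_on_lifted_chart:
  assumes "liftable W c"
  shows "inj_on (snd (lifted_chart W c)) (fst (lifted_chart W c))"
proof -
  have "inj_on (snd c) W" using inj_on_subset[OF inj_on_chart[OF M liftableD(1)] liftableD(2)] assms by blast
  then show ?thesis unfolding fst_lifted_chart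
    by (auto simp: inj_on_def snd_lifted_chart[OF assms])
qed

lemma cmap_inv_lifted_chart:
  assumes "liftable W c" "y \<in> W"
  shows "cmap_inv (lifted_chart W c) (snd c y) = q y"
  using inv_into_f_f[OF inj_on_lifted_chart[OF assms(1)], of "q y"] assms
  by (simp add: cmap_inv_def fst_lifted_chart snd_lifted_chart)

lemma holo_lifted_chart:
  assumes c: "c \<in> atlas M" and W: "liftable W d"
  shows "holo_on (snd c ` {y \<in> fst c. q y \<in> q ` W}) (snd (lifted_chart W d) \<circ> q \<circ> cmap_inv c)"
proof (rule holo_on_local)
  note d = liftableD[OF W]
  fix x assume "x \<in> snd c ` {y \<in> fst c. q y \<in> q ` W}"
  then obtain y where y: "y \<in> fst c" "q y \<in> q ` W" "x = snd c y" by auto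
  have yX: "y \<in> X" using y(1) chart_subset_topspace[OF M c] by blast
  obtain n V where V: "openin (mtop M) V" "y \<in> V"
    "\<And>z. z \<in> V \<Longrightarrow> q z \<in> q ` W \<and> inv_into W q (q z) = \<gamma> n z \<and> \<gamma> n z \<in> W"
    using local_inverse_deck[OF d(3,4) yX y(2)] by metis
  let ?T = "snd c ` (fst c \<inter> V)"
  have T: "open ?T"
    by (rule open_chart_image[OF M c openin_Int[OF complex_manifoldD(4)[OF M c] V(1)]]) simp
  have "holo_on ?T (snd d \<circ> \<gamma> n \<circ> cmap_inv c)"
    by (rule holo_on_subset[OF _ holomorphic_map_holo[OF holomorphic_deck c d(1)]]) (use V(3) d(2) in blast)
  then have "holo_on ?T (snd (lifted_chart W d) \<circ> q \<circ> cmap_inv c)"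
  proof (rule holo_on_cong[OF T, rotated])
    fix x assume "x \<in> ?T"
    then obtain z where z: "z \<in> fst c" "z \<in> V" "x = snd c z" by auto
    then show "(snd d \<circ> \<gamma> n \<circ> cmap_inv c) x = (snd (lifted_chart W d) \<circ> q \<circ> cmap_inv c) x"
      using V(3)[OF z(2)] cmap_inv_left[OF M c z(1)] by (simp add: lifted_chart_def)
  qed
  then show "\<exists>T. open T \<and> x \<in> T \<and> holo_on T (snd (lifted_chart W d) \<circ> q \<circ> cmap_inv c)"
    using T y V(2) by blast
qed

lemma homeomorphic_map_q:
  assumes "openin (mtop M) W" "inj_on q W"
  shows "homeomorphic_map (subtopology (mtop M) W) (subtopology Y (q ` W)) q"
  unfolding homeomorphic_eq_everything_map
proof -
  have WX: "W \<subseteq> X" using openin_subset[OF assms(1)] .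
  have qW: "q ` W \<subseteq> topspace Y" using WX q_image by blast
  have cont: "continuous_map (subtopology (mtop M) W) (subtopology Y (q ` W)) q"
    using continuous_map_from_subtopology[OF continuous_q] WX
    by (auto simp: continuous_map_in_subtopology)
  have op: "open_map (subtopology (mtop M) W) (subtopology Y (q ` W)) q"
    unfolding open_map_def
  proof (intro allI impI)
    fix U assume "openin (subtopology (mtop M) W) U"
    then have U: "openin (mtop M) U" "U \<subseteq> W" using assms(1) by (auto simp: openin_open_subtopology)
    then show "openin (subtopology Y (q ` W)) (q ` U)"
      using open_q[OF U(1)] by (auto simp: openin_subtopology intro!: exI[of _ "q ` U"])
  qed
  have "homeomorphic_map (subtopology (mtop M) W) (subtopology Y (q ` W)) q"
    by (rule bijective_open_imp_homeomorphic_map[OF cont op])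
       (use WX qW assms(2) in \<open>auto simp: Int_absorb1\<close>)
  then show "continuous_map (subtopology (mtop M) W) (subtopology Y (q ` W)) q \<and>
    open_map (subtopology (mtop M) W) (subtopology Y (q ` W)) q \<and>
    closed_map (subtopology (mtop M) W) (subtopology Y (q ` W)) q \<and>
    q ` topspace (subtopology (mtop M) W) = topspace (subtopology Y (q ` W)) \<and>
    inj_on q (topspace (subtopology (mtop M) W))"
    unfolding homeomorphic_eq_everything_map .
qed

lemma homeomorphic_map_lifted_chart:
  assumes W: "liftable W c"
  shows "homeomorphic_map (subtopology Y (fst (lifted_chart W c)))
    (top_of_set (cmap_image (lifted_chart W c))) (snd (lifted_chart W c))"
proof -
  note c = liftableD[OF W]
  have WX: "W \<subseteq> X" using openin_subset[OF c(3)] .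
  obtain k where k: "homeomorphic_maps (subtopology (mtop M) W) (subtopology Y (q ` W)) q k"
    using homeomorphic_map_q[OF c(3,4)] unfolding homeomorphic_map_maps by blast
  then have 1: "homeomorphic_map (subtopology Y (q ` W)) (subtopology (mtop M) W) k"
    using homeomorphic_maps_sym homeomorphic_maps_imp_map by blast
  have "subtopology (subtopology (mtop M) (fst c)) W = subtopology (mtop M) W"
    using c(2) by (simp add: subtopology_subtopology Int_absorb1)
  moreover have "subtopology (top_of_set (cmap_image c)) (snd c ` W) = top_of_set (snd c ` W)"
    using c(2) by (simp add: subtopology_subtopology cmap_image_def Int_absorb1 image_mono)
  moreover have "homeomorphic_map (subtopology (subtopology (mtop M) (fst c)) W)
      (subtopology (top_of_set (cmap_image c)) (snd c ` W)) (snd c)"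
    by (rule homeomorphic_map_subtopologies_alt[OF complex_manifoldD(6)[OF M c(1)]])
       (use c(2) inj_on_chart[OF M c(1)] in \<open>auto simp: inj_on_def cmap_image_def\<close>)
  ultimately have 2: "homeomorphic_map (subtopology (mtop M) W) (top_of_set (snd c ` W)) (snd c)" by simp
  have "homeomorphic_map (subtopology Y (q ` W)) (top_of_set (snd c ` W)) (snd (lifted_chart W c))"
  proof (rule homeomorphic_map_eq[OF homeomorphic_map_compose[OF 1 2]])
    fix p assume "p \<in> topspace (subtopology Y (q ` W))"
    then obtain y where y: "y \<in> W" "p = q y" by auto
    then have "k p = y" using k WX unfolding homeomorphic_maps_def by auto
    then show "(snd c \<circ> k) p = snd (lifted_chart W c) p" using y snd_lifted_chart[OF W] by simp
  qed
  then show ?thesis by (simp add: fst_lifted_chart cmap_image_lifted_chart[OF W])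
qed

lemma complex_manifold_N: "complex_manifold N"
  unfolding complex_manifold_def mtop_N atlas_N
proof (intro conjI ballI)
  show "Hausdorff_space Y" by (rule Hausdorff_quotient)
  show "second_countable_space Y" by (rule second_countable_quotient)
  show "(\<Union>c\<in>{lifted_chart W c |W c. liftable W c}. fst c) = topspace Y"
  proof (intro equalityI subsetI)
    fix p assume "p \<in> (\<Union>c\<in>{lifted_chart W c |W c. liftable W c}. fst c)"
    then obtain W c where W: "liftable W c" and "p \<in> fst (lifted_chart W c)" by blast
    then have p: "p \<in> q ` W" by (simp only: fst_lifted_chart)
    have "W \<subseteq> X" using openin_subset[OF liftableD(3)[OF W]] .
    then show "p \<in> topspace Y" using p q_image by blast
  next
    fix p assume "p \<in> topspace Y"
    then obtain y where y: "y \<in> X" "p = q y" using q_image by blast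
    note c = chart_at[OF M y(1)]
    have "y \<in> fst (chart_at M y) \<inter> strip y" using c(2) y(1) by (auto simp: strip_def)
    then have "p \<in> fst (lifted_chart (fst (chart_at M y) \<inter> strip y) (chart_at M y))"
      unfolding fst_lifted_chart y(2) by (rule imageI)
    then show "p \<in> (\<Union>c\<in>{lifted_chart W c |W c. liftable W c}. fst c)" using liftable_strip[OF c(1)] by blast
  qed
next
  fix e assume "e \<in> {lifted_chart W c |W c. liftable W c}"
  then obtain W c where e: "e = lifted_chart W c" and W: "liftable W c" by blast
  note c = liftableD[OF W]
  show "openin Y (fst e)" unfolding e fst_lifted_chart by (rule open_q[OF c(3)])
  show "open (cmap_image e)"
    unfolding e cmap_image_lifted_chart[OF W] by (rule open_chart_image[OF M c(1,3,2)])
  show "homeomorphic_map (subtopology Y (fst e)) (top_of_set (cmap_image e)) (snd e)"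
    unfolding e by (rule homeomorphic_map_lifted_chart[OF W])
  fix e' assume "e' \<in> {lifted_chart W c |W c. liftable W c}"
  then obtain W' c' where e': "e' = lifted_chart W' c'" and W': "liftable W' c'" by blast
  let ?S = "snd c ` {y \<in> W. q y \<in> q ` W'}"
  have S: "snd e ` (fst e \<inter> fst e') = ?S"
    unfolding e e' fst_lifted_chart using snd_lifted_chart[OF W] by (force simp: image_iff)
  have "openin (mtop M) {y \<in> X. q y \<in> q ` W'}"
    using open_q[OF liftableD(3)[OF W']] continuous_q by (auto simp: continuous_map)
  then have "openin (mtop M) (W \<inter> {y \<in> X. q y \<in> q ` W'})" using c(3) by blast
  moreover have "W \<inter> {y \<in> X. q y \<in> q ` W'} = {y \<in> W. q y \<in> q ` W'}" using openin_subset[OF c(3)] by auto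
  ultimately have "openin (mtop M) {y \<in> W. q y \<in> q ` W'}" by simp
  then have openS: "open ?S" by (rule open_chart_image[OF M c(1)]) (use c(2) in auto)
  have "holo_on ?S (snd e' \<circ> q \<circ> cmap_inv c)"
    unfolding e' by (rule holo_on_subset[OF _ holo_lifted_chart[OF c(1) W']]) (use c(2) in auto)
  then show "holo_on (snd e ` (fst e \<inter> fst e')) (snd e' \<circ> cmap_inv e)"
    unfolding S
  proof (rule holo_on_cong[OF openS, rotated])
    fix x assume "x \<in> ?S"
    then obtain y where y: "y \<in> W" "x = snd c y" by auto
    then show "(snd e' \<circ> q \<circ> cmap_inv c) x = (snd e' \<circ> cmap_inv e) x"
      using cmap_inv_lifted_chart[OF W y(1)] cmap_inv_left[OF M c(1)] c(2) by (auto simp: e)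
  qed
qed

lemma holomorphic_q: "holomorphic_map M N q"
  unfolding holomorphic_map_def mtop_N
proof (intro conjI ballI)
  show "continuous_map (mtop M) Y q" by (rule continuous_q)
  fix c d assume c: "c \<in> atlas M" and "d \<in> atlas N"
  then obtain W e where "d = lifted_chart W e" "liftable W e" unfolding atlas_N by blast
  then show "holo_on (snd c ` {p \<in> fst c. q p \<in> fst d}) (snd d \<circ> q \<circ> cmap_inv c)"
    using holo_lifted_chart[OF c] by (simp add: fst_lifted_chart)
qed

lemma chart_deriv_q:
  assumes W: "liftable W c" and y: "y \<in> W"
  shows "chart_deriv c (lifted_chart W c) q y u = u"
proof -
  note c = liftableD[OF W]
  have "frechet_derivative (snd (lifted_chart W c) \<circ> q \<circ> cmap_inv c) (at (snd c y)) =
      frechet_derivative (\<lambda>x. x) (at (snd c y))"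
  proof (rule frechet_derivative_cong_open)
    show "open (snd c ` W)" by (rule open_chart_image[OF M c(1,3,2)])
    show "snd c y \<in> snd c ` W" using y by simp
    fix x assume "x \<in> snd c ` W"
    then obtain z where z: "z \<in> W" "x = snd c z" by auto
    then have "cmap_inv c x = z" using cmap_inv_left[OF M c(1)] c(2) by auto
    then show "(snd (lifted_chart W c) \<circ> q \<circ> cmap_inv c) x = x"
      using z snd_lifted_chart[OF W] by simp
  qed
  then show ?thesis by (simp add: chart_deriv_def)
qed

text \<open>In a lifted chart the differential of \<open>q\<close> is the identity.\<close>

lemma inj_differential_q:
  assumes y: "y \<in> X"
  shows "inj (differential M N q y)"
proof -
  let ?c = "chart_at M y" and ?d = "chart_at N (q y)"
  note c = chart_at[OF M y]
  have "q y \<in> topspace (mtop N)" using y q_image mtop_N by auto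
  note d = chart_at[OF complex_manifold_N this]
  define W where "W = fst ?c \<inter> strip y"
  have W: "liftable W ?c" unfolding W_def by (rule liftable_strip[OF c(1)])
  have yW: "y \<in> W" using c(2) y by (auto simp: W_def strip_def)
  have e: "lifted_chart W ?c \<in> atlas N" unfolding atlas_N using W by blast
  have qe: "q y \<in> fst (lifted_chart W ?c)" using yW by (simp add: fst_lifted_chart)
  have "differential M N q y u = chart_deriv (lifted_chart W ?c) ?d (\<lambda>p. p) (q y) u" for u
    using chart_deriv_compose[OF M complex_manifold_N holomorphic_q holomorphic_map_id[OF complex_manifold_N]
        c(1) e d(1) c(2) qe d(2), of u] chart_deriv_q[OF W yW]
    by (simp add: differential_chart_deriv)
  then have "chart_deriv ?d (lifted_chart W ?c) (\<lambda>p. p) (q y) (differential M N q y u) = u" for u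
    using transition_inverse[OF complex_manifold_N e d(1) qe d(2)] by simp
  then show ?thesis by (metis injI)
qed

section \<open>The induced metric\<close>

text \<open>The induced metric lifts tangent vectors to a chosen point \<open>\<gamma> n y\<close> of the fibre of \<open>y\<close>.  As
\<open>q = q \<circ> \<gamma> n\<close>, the lift of \<open>dq u\<close> to this point is \<open>d(\<gamma> n) u\<close>, and the invariance of \<open>G\<close> removes
\<open>\<gamma> n\<close>.\<close>

lemma pullback_induced_metric:
  assumes inv: "\<And>n y u v. y \<in> X \<Longrightarrow> pullback M M (\<gamma> n) G y u v = G y u v"
    and y: "y \<in> X"
  shows "pullback M N q (induced_metric M N q G) y u v = G y u v"
proof -
  define y0 where "y0 = (SOME y'. y' \<in> X \<and> q y' = q y)"
  have y0: "y0 \<in> X \<and> q y0 = q y" unfolding y0_def by (rule someI[of _ y]) (use y in simp)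
  then obtain n where n: "y0 = \<gamma> n y" using fibre y by metis
  let ?L = "inv (differential M N q y0)"
  have L: "?L (differential M N q y w) = differential M M (\<gamma> n) y w" for w
  proof -
    have qy: "q y \<in> topspace (mtop N)" using y q_image mtop_N by auto
    note c = chart_at[OF M y] and d = chart_at[OF complex_manifold_N qy]
      and c0 = chart_at[OF M deck_in[OF y, of n]]
    have "chart_deriv (chart_at M y) (chart_at N (q y)) q y =
        chart_deriv (chart_at M y) (chart_at N (q y)) (\<lambda>p. q (\<gamma> n p)) y"
      by (rule chart_deriv_cong[OF M c(1,2) complex_manifoldD(4)[OF M c(1)] c(2)])
         (use q_deck chart_subset_topspace[OF M c(1)] in auto)
    then have "differential M N q y w = differential M N q y0 (differential M M (\<gamma> n) y w)"
      using chart_deriv_compose[OF M M holomorphic_deck holomorphic_q c(1) c0(1) d(1) c(2) c0(2)]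
        d(2) q_deck[OF y, of n]
      by (simp add: differential_chart_deriv n)
    then show ?thesis using inv_f_f[OF inj_differential_q[of y0]] y0 by simp
  qed
  have "pullback M N q (induced_metric M N q G) y u v = G y0 (?L (differential M N q y u)) (?L (differential M N q y v))"
    by (simp add: pullback_def induced_metric_def y0_def[symmetric] Let_def)
  also have "\<dots> = pullback M M (\<gamma> n) G y u v" unfolding L by (simp add: pullback_def n)
  finally show ?thesis by (simp add: inv[OF y])
qed

lemma coord_form_induced_metric:
  assumes inv: "\<And>n y u v. y \<in> X \<Longrightarrow> pullback M M (\<gamma> n) G y u v = G y u v"
    and W: "liftable W c" and x: "x \<in> snd c ` W"
  shows "coord_form N (induced_metric M N q G) (lifted_chart W c) x u v = coord_form M G c x u v"
proof -
  note c = liftableD[OF W]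
  obtain y where y: "y \<in> W" "x = snd c y" using x by auto
  have yc: "y \<in> fst c" using y c(2) by auto
  have e: "lifted_chart W c \<in> atlas N" unfolding atlas_N using W by blast
  have qe: "q y \<in> fst (lifted_chart W c)" using y by (simp add: fst_lifted_chart)
  have "coord_form M (pullback M N q (induced_metric M N q G)) c x u v =
      coord_form N (induced_metric M N q G) (lifted_chart W c) x u v"
    using coord_form_pullback[OF M complex_manifold_N holomorphic_q c(1) e yc qe]
    by (simp add: chart_deriv_q[OF W y(1)] snd_lifted_chart[OF W y(1)] y(2))
  moreover have "coord_form M (pullback M N q (induced_metric M N q G)) c x u v = coord_form M G c x u v"
  proof -
    have "y \<in> X" using chart_subset_topspace[OF M c(1)] yc by blast
    then show ?thesis
      using pullback_induced_metric[of G, OF inv] coord_form_chart_deriv[OF M c(1) yc] y(2) by metis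
  qed
  ultimately show ?thesis by simp
qed

lemma hermitian_metric_induced:
  assumes G: "hermitian_metric M G"
    and inv: "\<And>n y u v. y \<in> X \<Longrightarrow> pullback M M (\<gamma> n) G y u v = G y u v"
  shows "hermitian_metric N (induced_metric M N q G)"
proof (rule hermitian_metricI[OF complex_manifold_N])
  fix e assume "e \<in> atlas N"
  then obtain W c where e: "e = lifted_chart W c" and W: "liftable W c" unfolding atlas_N by blast
  note c = liftableD[OF W] and eq = coord_form_induced_metric[of G, OF inv W]
  have sub: "cmap_image e \<subseteq> cmap_image c"
    using c(2) unfolding e cmap_image_lifted_chart[OF W] cmap_image_def[of c] by blast
  show "hermitian_form (coord_form N (induced_metric M N q G) e x)" if "x \<in> cmap_image e" for x
  proof -
    have "coord_form N (induced_metric M N q G) e x = coord_form M G c x"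
      using that eq unfolding e cmap_image_lifted_chart[OF W] by (intro ext) simp
    then show ?thesis using hermitian_form_coord_form[OF M G c(1)] that sub by auto
  qed
  show "smooth_on (cmap_image e) (\<lambda>x. coord_form N (induced_metric M N q G) e x u v)" for u v
  proof (rule smooth_on_cong)
    show "open (cmap_image e)"
      by (rule complex_manifoldD(5)[OF complex_manifold_N]) (unfold atlas_N e, use W in blast)
    show "smooth_on (cmap_image e) (\<lambda>x. coord_form M G c x u v)"
      by (rule smooth_on_subset[OF sub]) (use G c(1) in \<open>simp add: hermitian_metric_def\<close>)
    show "coord_form M G c x u v = coord_form N (induced_metric M N q G) e x u v" if "x \<in> cmap_image e" for x
      using that eq unfolding e cmap_image_lifted_chart[OF W] by simp
  qed
qed

end


section \<open>Integer iterates\<close>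

lemma inv_into_bij:
  assumes "bij_betw f S S" "x \<in> S"
  shows "inv_into S f x \<in> S" "f (inv_into S f x) = x" "inv_into S f (f x) = x" "f x \<in> S"
  using assms by (auto simp: bij_betw_def inv_into_into f_inv_into_f)

lemma funpow_in: "(\<And>x. x \<in> S \<Longrightarrow> h x \<in> S) \<Longrightarrow> x \<in> S \<Longrightarrow> (h ^^ k) x \<in> S"
  by (induction k) auto

lemma int_iterate_in:
  assumes "bij_betw f S S" "x \<in> S"
  shows "int_iterate S f n x \<in> S"
  using inv_into_bij[OF assms(1)] assms(2) funpow_in[of S f x] funpow_in[of S "inv_into S f" x]
  by (simp add: int_iterate_def)

lemma int_iterate_0: "int_iterate S f 0 = (\<lambda>x. x)"
  by (simp add: int_iterate_def fun_eq_iff)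

lemma int_iterate_Suc:
  assumes f: "bij_betw f S S" and x: "x \<in> S"
  shows "int_iterate S f (n + 1) x = f (int_iterate S f n x)"
proof (cases "0 \<le> n")
  case True
  then show ?thesis by (simp add: int_iterate_def nat_add_distrib)
next
  case False
  define k where "k = nat (- n - 1)"
  have k: "nat (- n) = Suc k" "nat (- (n + 1)) = k" using False by (auto simp: k_def)
  have "(inv_into S f ^^ k) x \<in> S" by (rule funpow_in[OF inv_into_bij(1)[OF f] x])
  then have "f ((inv_into S f ^^ Suc k) x) = (inv_into S f ^^ k) x"
    using inv_into_bij(2)[OF f] by simp
  moreover have "int_iterate S f (n + 1) x = (inv_into S f ^^ k) x"
    using False k(2) by (cases "n = -1") (auto simp: int_iterate_def k_def)
  ultimately show ?thesis using False k(1) by (simp add: int_iterate_def)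
qed

lemma int_iterate_pred:
  assumes f: "bij_betw f S S" and x: "x \<in> S"
  shows "int_iterate S f (n - 1) x = inv_into S f (int_iterate S f n x)"
  using int_iterate_Suc[OF f x, of "n - 1"] inv_into_bij(3)[OF f int_iterate_in[OF f x]] by simp

lemma int_iterate_add:
  assumes f: "bij_betw f S S" and x: "x \<in> S"
  shows "int_iterate S f (m + n) x = int_iterate S f m (int_iterate S f n x)"
proof (induction m rule: int_induct[where k=0])
  case base
  show ?case by (simp add: int_iterate_0)
next
  case (step1 i)
  have "int_iterate S f (i + 1 + n) x = f (int_iterate S f (i + n) x)"
    using int_iterate_Suc[OF f x, of "i + n"] by (simp add: add.commute add.left_commute)
  then show ?case using step1 int_iterate_Suc[OF f int_iterate_in[OF f x], of i n] by simp
next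
  case (step2 i)
  have "int_iterate S f (i - 1 + n) x = inv_into S f (int_iterate S f (i + n) x)"
    using int_iterate_pred[OF f x, of "i + n"] by (simp add: algebra_simps)
  then show ?case using step2 int_iterate_pred[OF f int_iterate_in[OF f x], of i n] by simp
qed

lemma int_iterate_map_prod:
  assumes f: "bij_betw f S S" and z: "p \<in> S" "s \<in> T"
  shows "int_iterate (S \<times> T) (map_prod f id) n (p, s) = (int_iterate S f n p, s)"
proof -
  let ?F = "map_prod f id" and ?S = "S \<times> T"
  have F: "bij_betw ?F ?S ?S"
    by (rule bij_betw_map_prod[OF f]) simp
  have z': "(p, s) \<in> ?S" using z by simp
  show ?thesis
  proof (induction n rule: int_induct[where k=0])
    case base
    show ?case by (simp add: int_iterate_0)
  next
    case (step1 i)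
    show ?case
      unfolding int_iterate_Suc[OF F z'] int_iterate_Suc[OF f z(1)] step1(2) by simp
  next
    case (step2 i)
    \<comment> \<open>only the values of \<open>map_prod f id\<close> are at hand, so its inverse is found by exhibiting a preimage\<close>
    let ?w = "(int_iterate S f (i - 1) p, s)"
    have "?w \<in> ?S" using int_iterate_in[OF f z(1)] z(2) by simp
    moreover have "?F ?w = (int_iterate S f i p, s)" using int_iterate_Suc[OF f z(1), of "i - 1"] by simp
    ultimately have "inv_into ?S ?F (int_iterate S f i p, s) = ?w" using inv_into_bij(3)[OF F] by metis
    then show ?case by (simp only: int_iterate_pred[OF F z'] step2(2))
  qed
qed

lemma torus_orbit_eq_iff:
  assumes f: "bij_betw f S S" and x: "x \<in> S" "x' \<in> S"
  shows "torus_orbit S f (x, t) = torus_orbit S f (x', t') \<longleftrightarrow>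
    (\<exists>n. x' = int_iterate S f n x \<and> t' = t + of_int n)"
proof
  assume "torus_orbit S f (x, t) = torus_orbit S f (x', t')"
  moreover have "(x', t') \<in> torus_orbit S f (x', t')"
    by (auto simp: torus_orbit_def int_iterate_0 intro!: image_eqI[of _ _ 0])
  ultimately have "(x', t') \<in> torus_orbit S f (x, t)" by simp
  then show "\<exists>n. x' = int_iterate S f n x \<and> t' = t + of_int n" by (auto simp: torus_orbit_def)
next
  assume "\<exists>n. x' = int_iterate S f n x \<and> t' = t + of_int n"
  then obtain n where n: "x' = int_iterate S f n x" "t' = t + of_int n" by blast
  have shift: "(int_iterate S f m x', t' + of_int m) = (int_iterate S f (m + n) x, t + of_int (m + n))" for m
    using int_iterate_add[OF f x(1)] by (simp add: n)
  have "torus_orbit S f (x', t') = (\<lambda>k. (int_iterate S f k x, t + of_int k)) ` range (\<lambda>m. m + n)"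
    unfolding torus_orbit_def case_prod_conv shift image_image ..
  also have "range (\<lambda>m. m + n) = UNIV" by (rule surj_plus_right)
  finally show "torus_orbit S f (x, t) = torus_orbit S f (x', t')" by (simp add: torus_orbit_def)
qed

section \<open>Isometries\<close>

lemma pullback_id:
  assumes "complex_manifold M" "p \<in> topspace (mtop M)"
  shows "pullback M M (\<lambda>p. p) g p u v = g p u v"
  by (simp add: pullback_def differential_chart_deriv chart_deriv_id[OF assms(1) chart_at[OF assms]])

lemma pullback_cong:
  assumes M: "complex_manifold M" and p: "p \<in> topspace (mtop M)"
    and eq: "\<And>p. p \<in> topspace (mtop M) \<Longrightarrow> F p = G p"
  shows "pullback M N F h p u v = pullback M N G h p u v"
proof -
  note c = chart_at[OF M p]
  have "chart_deriv (chart_at M p) (chart_at N (G p)) F p = chart_deriv (chart_at M p) (chart_at N (G p)) G p"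
    by (rule chart_deriv_cong[OF M c(1,2) complex_manifoldD(4)[OF M c(1)] c(2)])
       (use eq chart_subset_topspace[OF M c(1)] in auto)
  then show ?thesis by (simp add: pullback_def differential_chart_deriv eq[OF p])
qed

definition isometry_map :: "('a, 'n::finite) cmfd \<Rightarrow> ('a, 'n) bilin_field \<Rightarrow> ('a \<Rightarrow> 'a) \<Rightarrow> bool" where
  "isometry_map M g F \<longleftrightarrow> holomorphic_map M M F \<and>
     (\<forall>p\<in>topspace (mtop M). \<forall>u v. pullback M M F g p u v = g p u v)"

lemma isometry_map_compose:
  assumes M: "complex_manifold M" and F: "isometry_map M g F" and G: "isometry_map M g G"
  shows "isometry_map M g (\<lambda>p. G (F p))"
proof -
  have hF: "holomorphic_map M M F" and hG: "holomorphic_map M M G" using F G by (auto simp: isometry_map_def)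
  have "pullback M M (\<lambda>p. G (F p)) g p u v = g p u v" if p: "p \<in> topspace (mtop M)" for p u v
  proof -
    have "F p \<in> topspace (mtop M)" using holomorphic_map_continuous[OF hF] p by (auto simp: continuous_map)
    then have "pullback M M F (pullback M M G g) p u v = pullback M M F g p u v"
      using G unfolding isometry_map_def by (simp add: pullback_def[of M M F])
    then show ?thesis using pullback_compose[OF M M M hF hG p] F p unfolding isometry_map_def by metis
  qed
  then show ?thesis using holomorphic_map_compose[OF M M M hF hG] by (simp add: isometry_map_def)
qed

lemma isometry_map_funpow:
  assumes "complex_manifold M" "isometry_map M g F"
  shows "isometry_map M g (F ^^ k)"
proof (induction k)
  case 0
  have "isometry_map M g (\<lambda>p. p)"
    unfolding isometry_map_def using holomorphic_map_id[OF assms(1)] pullback_id[OF assms(1)] by blast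
  then show ?case by (simp add: id_def)
next
  case (Suc k)
  show ?case using isometry_map_compose[OF assms(1) Suc assms(2)] by (simp add: o_def)
qed

lemma isometry_map_inverse:
  assumes M: "complex_manifold M" and F: "isometry_map M g F" and G: "holomorphic_map M M G"
    and FG: "\<And>p. p \<in> topspace (mtop M) \<Longrightarrow> F (G p) = p"
  shows "isometry_map M g G"
proof -
  have hF: "holomorphic_map M M F" using F by (simp add: isometry_map_def)
  have "pullback M M G g p u v = g p u v" if p: "p \<in> topspace (mtop M)" for p u v
  proof -
    have Gp: "G p \<in> topspace (mtop M)" using holomorphic_map_continuous[OF G] p by (auto simp: continuous_map)
    have "pullback M M G g p u v = pullback M M G (pullback M M F g) p u v"
      using F Gp unfolding isometry_map_def by (simp add: pullback_def[of M M G])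
    also have "\<dots> = pullback M M (\<lambda>p. F (G p)) g p u v" by (rule pullback_compose[OF M M M G hF p])
    also have "\<dots> = pullback M M (\<lambda>p. p) g p u v" by (rule pullback_cong[OF M p FG])
    finally show ?thesis using pullback_id[OF M p] by metis
  qed
  then show ?thesis using G by (simp add: isometry_map_def)
qed

lemma isometry_map_int_iterate:
  assumes M: "complex_manifold M" and \<psi>: "kaehler_isometry M g \<psi>"
  shows "isometry_map M g (int_iterate (topspace (mtop M)) \<psi> n)"
proof -
  let ?S = "topspace (mtop M)"
  have bij: "bij_betw \<psi> ?S ?S" and h: "holomorphic_map M M \<psi>" "holomorphic_map M M (inv_into ?S \<psi>)"
    and iso: "isometry_map M g \<psi>"
    using \<psi> by (auto simp: kaehler_isometry_def biholomorphic_map_def isometry_map_def)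
  have "isometry_map M g (inv_into ?S \<psi>)"
    by (rule isometry_map_inverse[OF M iso h(2) inv_into_bij(2)[OF bij]])
  then show ?thesis using isometry_map_funpow[OF M] iso by (simp add: int_iterate_def)
qed

section \<open>The deck transformations\<close>

definition deck :: "('a, 'n::finite) cmfd \<Rightarrow> ('a \<Rightarrow> 'a) \<Rightarrow> int \<Rightarrow> 'a \<times> (complex ^ 2) \<Rightarrow> 'a \<times> (complex ^ 2)" where
  "deck K \<psi> n = map_prod (int_iterate (topspace (mtop K)) \<psi> n) (\<lambda>x. (2 powr of_int n) *\<^sub>R x)"

text \<open>The real coordinate of the mapping torus as a function on the cover.\<close>

definition log_norm :: "'a \<times> (complex ^ 2) \<Rightarrow> real" where
  "log_norm y = log 2 (norm (snd y))"

lemma pullback_scale_euclidean: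
  assumes "x \<noteq> 0" "r \<noteq> 0"
  shows "pullback punctured_C2 punctured_C2 (\<lambda>x. r *\<^sub>R x) euclidean_metric x u v = r\<^sup>2 * euclidean_metric x u v"
  using assms by (simp add: pullback_def differential_chart_deriv chart_at_punctured chart_deriv_scale
      euclidean_metric_def power2_eq_square)

text \<open>On \<open>K\<close> the transformation is an isometry; on \<open>\<complex>\<^sup>2 - {0}\<close> it is a homothety, under which \<open>g\<^sub>E\<close> and
\<open>R\<^sup>2\<close> are multiplied by the same factor.\<close>

lemma pullback_deck_cover_metric:
  assumes K: "complex_manifold K" and \<psi>: "kaehler_isometry K g \<psi>" and y: "y \<in> topspace (mtop (cover K))"
  shows "pullback (cover K) (cover K) (deck K \<psi> n) (cover_metric K g) y u v = cover_metric K g y u v"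
proof -
  define r where "r = (2 :: real) powr of_int n"
  define \<Psi> where "\<Psi> = int_iterate (topspace (mtop K)) \<psi> n"
  have r: "r \<noteq> 0" by (simp add: r_def)
  have y': "fst y \<in> topspace (mtop K)" "snd y \<noteq> 0" using y by (auto simp: topspace_cover)
  note P = complex_manifold_punctured_C2 and C = complex_manifold_cover[OF K]
  have \<Psi>: "isometry_map K g \<Psi>" unfolding \<Psi>_def by (rule isometry_map_int_iterate[OF K \<psi>])
  then have h\<Psi>: "holomorphic_map K K \<Psi>" by (simp add: isometry_map_def)
  note hs = holomorphic_map_scale[OF r]
  have hd: "holomorphic_map (cover K) (cover K) (deck K \<psi> n)"
    unfolding cover_def deck_def \<Psi>_def[symmetric] r_def[symmetric]
    by (rule holomorphic_map_map_prod[OF K P K P h\<Psi> hs])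
  have f: "holomorphic_map (cover K) K fst" "holomorphic_map (cover K) punctured_C2 snd"
    unfolding cover_def by (rule holomorphic_map_fst[OF K P] holomorphic_map_snd[OF K P])+
  have c: "fst (deck K \<psi> n z) = \<Psi> (fst z)" "snd (deck K \<psi> n z) = r *\<^sub>R snd z" for z
    by (simp_all add: deck_def \<Psi>_def r_def)
  have 1: "pullback (cover K) (cover K) (deck K \<psi> n) (pullback (cover K) K fst g) y u v =
      pullback (cover K) K fst g y u v"
  proof -
    have "pullback (cover K) (cover K) (deck K \<psi> n) (pullback (cover K) K fst g) y u v =
        pullback (cover K) K (\<lambda>z. \<Psi> (fst z)) g y u v"
      using pullback_compose[OF C C K hd f(1) y] by (simp add: c)
    also have "\<dots> = pullback (cover K) K fst (pullback K K \<Psi> g) y u v"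
      by (rule pullback_compose[OF C K K f(1) h\<Psi> y, symmetric])
    also have "\<dots> = pullback (cover K) K fst g y u v"
      using \<Psi> y'(1) by (simp add: pullback_def[of "cover K" K fst] isometry_map_def)
    finally show ?thesis .
  qed
  have 2: "pullback (cover K) (cover K) (deck K \<psi> n) (pullback (cover K) punctured_C2 snd euclidean_metric) y u v =
      r\<^sup>2 * pullback (cover K) punctured_C2 snd euclidean_metric y u v"
  proof -
    have "pullback (cover K) (cover K) (deck K \<psi> n) (pullback (cover K) punctured_C2 snd euclidean_metric) y u v =
        pullback (cover K) punctured_C2 (\<lambda>z. r *\<^sub>R snd z) euclidean_metric y u v"
      using pullback_compose[OF C C P hd f(2) y] by (simp add: c)
    also have "\<dots> = pullback (cover K) punctured_C2 snd
        (pullback punctured_C2 punctured_C2 (\<lambda>x. r *\<^sub>R x) euclidean_metric) y u v"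
      by (rule pullback_compose[OF C P P f(2) hs y, symmetric])
    also have "\<dots> = r\<^sup>2 * pullback (cover K) punctured_C2 snd euclidean_metric y u v"
      using pullback_scale_euclidean[OF y'(2) r] by (simp add: pullback_def[of "cover K" punctured_C2 snd])
    finally show ?thesis .
  qed
  have "pullback (cover K) (cover K) (deck K \<psi> n) (cover_metric K g) y u v =
    pullback (cover K) (cover K) (deck K \<psi> n) (pullback (cover K) K fst g) y u v +
    pullback (cover K) (cover K) (deck K \<psi> n) (pullback (cover K) punctured_C2 snd euclidean_metric) y u v
      / (norm (r *\<^sub>R snd y))\<^sup>2"
    by (simp add: pullback_def[of "cover K" "cover K"] cover_metric_def c)
  then show ?thesis unfolding 1 2 using r by (simp add: cover_metric_def power_mult_distrib)
qed

section \<open>The covering map\<close>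

definition roll :: "'a \<times> (complex ^ 2) \<Rightarrow> ('a \<times> (complex ^ 2)) \<times> real" where
  "roll y = ((fst y, inverse (norm (snd y)) *\<^sub>R snd y), log 2 (norm (snd y)))"

lemma unroll_roll: "snd y \<noteq> 0 \<Longrightarrow> unroll (roll y) = y"
  by (simp add: unroll_def roll_def)

lemma roll_unroll: "q \<in> sphere3 \<Longrightarrow> roll (unroll ((p, q), t)) = ((p, q), t)"
  by (auto simp: unroll_def roll_def)

lemma homeomorphic_maps_roll:
  "homeomorphic_maps (mtop (cover K))
     (prod_topology (prod_topology (mtop K) (top_of_set sphere3)) euclideanreal) roll unroll"
  unfolding homeomorphic_maps_def
proof (intro conjI ballI)
  let ?X = "mtop (cover K)"
  have X: "?X = prod_topology (mtop K) (top_of_set (- {0}))"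
    by (simp add: cover_def prod_manifold_simps punctured_C2_simps)
  have snd: "continuous_map ?X (top_of_set (- {0})) snd" unfolding X by (rule continuous_map_snd)
  have s: "continuous_map (top_of_set (- {0})) (top_of_set sphere3) (\<lambda>x. inverse (norm x) *\<^sub>R x)"
    unfolding continuous_map_in_subtopology
    by (auto intro!: continuous_intros)
  have l: "continuous_map (top_of_set (- {0 :: complex ^ 2})) euclideanreal (\<lambda>x. log 2 (norm x))"
    unfolding continuous_map_iff_continuous by (auto intro!: continuous_intros)
  show "continuous_map ?X (prod_topology (prod_topology (mtop K) (top_of_set sphere3)) euclideanreal) roll"
    unfolding roll_def[abs_def]
    by (intro continuous_map_pairedI)
       (use continuous_map_compose[OF snd s] continuous_map_compose[OF snd l] in
        \<open>simp_all add: o_def X continuous_map_fst\<close>)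
  let ?Z = "prod_topology (prod_topology (mtop K) (top_of_set sphere3)) euclideanreal"
  have u: "unroll = (\<lambda>z. (fst (fst z), (2 powr snd z) *\<^sub>R snd (fst z)))"
    by (auto simp: unroll_def fun_eq_iff)
  have f1: "continuous_map ?Z (mtop K) (\<lambda>z. fst (fst z))"
    using continuous_map_compose[OF continuous_map_fst continuous_map_fst] by (simp add: o_def)
  have f2: "continuous_map ?Z (prod_topology (top_of_set sphere3) euclideanreal) (\<lambda>z. (snd (fst z), snd z))"
    by (intro continuous_map_pairedI continuous_map_snd)
       (use continuous_map_compose[OF continuous_map_fst continuous_map_snd] in \<open>simp add: o_def\<close>)
  have f3: "continuous_map (prod_topology (top_of_set sphere3) euclideanreal) (top_of_set (- {0}))
     (\<lambda>(x, t). (2 powr t) *\<^sub>R x)"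
    using prod_topology_subtopology_eu[of sphere3 "UNIV :: real set"]
    by (auto simp: continuous_map_in_subtopology case_prod_beta intro!: continuous_intros)
  show "continuous_map ?Z ?X unroll"
    unfolding u X by (intro continuous_map_pairedI f1) (use continuous_map_compose[OF f2 f3] in \<open>simp add: o_def\<close>)
  show "unroll (roll y) = y" if "y \<in> topspace ?X" for y
    by (rule unroll_roll) (use that in \<open>auto simp: topspace_cover\<close>)
  show "roll (unroll z) = z" if "z \<in> topspace ?Z" for z
    using that roll_unroll by (cases z) auto
qed

lemma torus_cover_eq:
  assumes "y \<in> topspace (mtop (cover K))"
  shows "torus_cover K \<psi> y = torus_orbit (topspace (mtop K) \<times> sphere3) (map_prod \<psi> id) (roll y)"
proof -
  let ?Z = "(topspace (mtop K) \<times> sphere3) \<times> UNIV"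
  have "inj_on unroll ?Z"
    by (rule inj_on_inverseI[of _ roll]) (auto simp: roll_unroll)
  moreover have "roll y \<in> ?Z" using assms by (auto simp: topspace_cover roll_def)
  ultimately have "inv_into ?Z unroll (unroll (roll y)) = roll y" by (rule inv_into_f_f)
  then show ?thesis using assms unroll_roll[of y] by (auto simp: torus_cover_def topspace_cover)
qed

lemma quotient_map_torus_cover: "quotient_map (mtop (cover K)) (torus_space K \<psi>) (torus_cover K \<psi>)"
proof -
  let ?Z = "prod_topology (prod_topology (mtop K) (top_of_set sphere3)) euclideanreal"
  have "homeomorphic_map (mtop (cover K)) ?Z roll"
    using homeomorphic_maps_roll homeomorphic_maps_imp_map by blast
  then have 1: "quotient_map (mtop (cover K)) ?Z roll" by (simp add: homeomorphic_map_def)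
  have 2: "quotient_map ?Z (torus_space K \<psi>) (torus_orbit (topspace (mtop K) \<times> sphere3) (map_prod \<psi> id))"
    unfolding torus_space_def mapping_torus_def
    using quotient_map_quotient_topology[of ?Z "torus_orbit (topspace (mtop K) \<times> sphere3) (map_prod \<psi> id)"]
    by simp
  show ?thesis
    by (rule quotient_map_eq[OF quotient_map_compose[OF 1 2]]) (simp add: torus_cover_eq)
qed

lemma log_norm_scale: "x \<noteq> 0 \<Longrightarrow> log 2 (norm ((2 powr t) *\<^sub>R x)) = log 2 (norm x) + t"
  for x :: "'v::real_normed_vector"
  by (simp add: log_mult)

lemma torus_cover_fibre:
  assumes \<psi>: "bij_betw \<psi> (topspace (mtop K)) (topspace (mtop K))"
    and y: "y \<in> topspace (mtop (cover K))" "y' \<in> topspace (mtop (cover K))"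
  shows "torus_cover K \<psi> y = torus_cover K \<psi> y' \<longleftrightarrow> (\<exists>n. y' = deck K \<psi> n y)"
proof -
  let ?S = "topspace (mtop K)"
  obtain p x p' x' where yy: "y = (p, x)" "y' = (p', x')" by (cases y, cases y')
  have p: "p \<in> ?S" "p' \<in> ?S" "x \<noteq> 0" "x' \<noteq> 0" using y by (auto simp: topspace_cover yy)
  let ?s = "inverse (norm x) *\<^sub>R x" and ?s' = "inverse (norm x') *\<^sub>R x'"
  have s: "?s \<in> sphere3" "?s' \<in> sphere3" using p by auto
  have bij: "bij_betw (map_prod \<psi> id) (?S \<times> sphere3) (?S \<times> sphere3)"
    by (rule bij_betw_map_prod[OF \<psi>]) simp
  have "torus_cover K \<psi> y = torus_cover K \<psi> y' \<longleftrightarrow>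
    (\<exists>n. (p', ?s') = int_iterate (?S \<times> sphere3) (map_prod \<psi> id) n (p, ?s) \<and> log 2 (norm x') = log 2 (norm x) + of_int n)"
    by (unfold torus_cover_eq[OF y(1)] torus_cover_eq[OF y(2)], unfold roll_def yy fst_conv snd_conv,
        rule torus_orbit_eq_iff[OF bij]) (use p s in auto)
  also have "\<dots> \<longleftrightarrow> (\<exists>n. p' = int_iterate ?S \<psi> n p \<and> x' = (2 powr of_int n) *\<^sub>R x)"
  proof -
    have "?s' = ?s \<and> log 2 (norm x') = log 2 (norm x) + of_int n \<longleftrightarrow> x' = (2 powr of_int n) *\<^sub>R x" for n :: int
    proof
      assume a: "?s' = ?s \<and> log 2 (norm x') = log 2 (norm x) + of_int n"
      have "norm x' = 2 powr log 2 (norm x')" using p by simp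
      also have "\<dots> = norm x * 2 powr of_int n" using a p by (simp add: powr_add)
      finally have n: "norm x' = norm x * 2 powr of_int n" .
      have "x' = norm x' *\<^sub>R ?s'" using p by simp
      also have "\<dots> = (norm x * 2 powr of_int n) *\<^sub>R ?s" by (rule arg_cong2[where f=scaleR, OF n conjunct1[OF a]])
      also have "\<dots> = (2 powr of_int n) *\<^sub>R x" using p by simp
      finally show "x' = (2 powr of_int n) *\<^sub>R x" .
    next
      assume "x' = (2 powr of_int n) *\<^sub>R x"
      then show "?s' = ?s \<and> log 2 (norm x') = log 2 (norm x) + of_int n"
        using log_norm_scale[OF p(3), of "of_int n"] by simp
    qed
    then show ?thesis by (simp add: int_iterate_map_prod[OF \<psi> p(1) s(1)])
  qed
  also have "\<dots> \<longleftrightarrow> (\<exists>n. y' = deck K \<psi> n y)" by (simp add: deck_def yy)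
  finally show ?thesis .
qed

lemma deck_group_torus:
  assumes K: "complex_manifold K" and \<psi>: "kaehler_isometry K g \<psi>"
  shows "deck_group (cover K) (torus_space K \<psi>) (deck K \<psi>) log_norm (torus_cover K \<psi>)"
proof
  let ?S = "topspace (mtop K)"
  have bij: "bij_betw \<psi> ?S ?S" using \<psi> by (auto simp: kaehler_isometry_def biholomorphic_map_def)
  show "complex_manifold (cover K)" by (rule complex_manifold_cover[OF K])
  show "holomorphic_map (cover K) (cover K) (deck K \<psi> n)" for n
    unfolding cover_def deck_def
    by (rule holomorphic_map_map_prod[OF K complex_manifold_punctured_C2 K complex_manifold_punctured_C2
          _ holomorphic_map_scale])
       (use isometry_map_int_iterate[OF K \<psi>] in \<open>auto simp: isometry_map_def\<close>)
  show "deck K \<psi> 0 y = y" for y by (simp add: deck_def int_iterate_0 prod_eq_iff)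
  show "deck K \<psi> (m + n) y = deck K \<psi> m (deck K \<psi> n y)" if "y \<in> topspace (mtop (cover K))" for m n y
    using that int_iterate_add[OF bij] by (auto simp: deck_def topspace_cover powr_add)
  have "continuous_map (top_of_set (- {0 :: complex ^ 2})) euclideanreal (\<lambda>x. log 2 (norm x))"
    unfolding continuous_map_iff_continuous by (auto intro!: continuous_intros)
  from continuous_map_compose[OF continuous_map_snd this]
  show "continuous_map (mtop (cover K)) euclideanreal log_norm"
    by (simp add: log_norm_def[abs_def] o_def cover_def prod_manifold_simps punctured_C2_simps)
  show "log_norm (deck K \<psi> n y) = log_norm y + of_int n" if "y \<in> topspace (mtop (cover K))" for n y
  proof -
    have "snd y \<noteq> 0" using that by (auto simp: topspace_cover)
    from log_norm_scale[OF this] show ?thesis unfolding log_norm_def deck_def snd_map_prod .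
  qed
  show "quotient_map (mtop (cover K)) (torus_space K \<psi>) (torus_cover K \<psi>)" by (rule quotient_map_torus_cover)
  show "torus_cover K \<psi> y = torus_cover K \<psi> y' \<longleftrightarrow> (\<exists>n. y' = deck K \<psi> n y)"
    if "y \<in> topspace (mtop (cover K))" "y' \<in> topspace (mtop (cover K))" for y y'
    by (rule torus_cover_fibre[OF bij that])
qed


section \<open>Charts of the mapping torus\<close>

lemma hermitian_form_sum_form:
  assumes B: "hermitian_form (B (vfst x))" and x: "vsnd x \<noteq> 0"
  shows "hermitian_form (sum_form B hopf_metric x)"
proof -
  note bil = hermitian_formD(1)[OF B]
  have pos: "inverse (vsnd x \<bullet> vsnd x) > 0" using x by simp
  have "bilinear (sum_form B hopf_metric x)"
    unfolding bilinear_def sum_form_def hopf_metric_def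
    by (auto intro!: linearI simp: linear_add[OF linear_vfst] linear_add[OF linear_vsnd]
        linear_cmul[OF linear_vfst] linear_cmul[OF linear_vsnd] bilinear_ladd[OF bil] bilinear_radd[OF bil]
        bilinear_lmul[OF bil] bilinear_rmul[OF bil] inner_add_left inner_add_right algebra_simps)
  moreover have "sum_form B hopf_metric x u v = sum_form B hopf_metric x v u" for u v
    unfolding sum_form_def hopf_metric_def
    using hermitian_formD(2)[OF B, of "vfst u" "vfst v"] by (simp add: inner_commute)
  moreover have "sum_form B hopf_metric x u u > 0" if "u \<noteq> 0" for u
  proof -
    have "vfst u \<noteq> 0 \<or> vsnd u \<noteq> 0"
      using that vec_join_eq_iff[of 0 0 u] linear_0[OF linear_inl] by metis
    moreover have "B (vfst x) (vfst u) (vfst u) \<ge> 0"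
      using hermitian_formD(3)[OF B, of "vfst u"] bilinear_lzero[OF bil, of 0] by (cases "vfst u = 0") auto
    moreover have "hopf_metric (vsnd x) (vsnd u) (vsnd u) \<ge> 0" by (simp add: hopf_metric_def)
    moreover have "hopf_metric (vsnd x) (vsnd u) (vsnd u) > 0" if "vsnd u \<noteq> 0"
      using that pos unfolding hopf_metric_def by simp
    ultimately show ?thesis unfolding sum_form_def using hermitian_formD(3)[OF B, of "vfst u"]
      by (smt (verit))
  qed
  moreover have "sum_form B hopf_metric x (imult u) (imult v) = sum_form B hopf_metric x u v" for u v
  proof -
    have "imult a \<bullet> imult b = a \<bullet> b" for a b :: "complex ^ 2" by (simp add: inner_C2)
    then show ?thesis by (simp only: sum_form_def hopf_metric_def vproj_imult hermitian_formD(4)[OF B])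
  qed
  ultimately show ?thesis unfolding hermitian_form_def by blast
qed

lemma smooth_on_vfst:
  assumes "open S" "open T" "vfst ` S \<subseteq> T" "smooth_on T f"
  shows "smooth_on S (\<lambda>x. f (vfst x))"
  by (rule smooth_on_compose[where f=vfst and g=f, OF assms(1-3) smooth_on_linear[OF linear_vfst] assms(4)])

lemma smooth_on_vsnd:
  assumes "open S" "open T" "vsnd ` S \<subseteq> T" "smooth_on T f"
  shows "smooth_on S (\<lambda>x. f (vsnd x))"
  by (rule smooth_on_compose[where f=vsnd and g=f, OF assms(1-3) smooth_on_linear[OF linear_vsnd] assms(4)])

lemma hermitian_metric_cover:
  assumes K: "complex_manifold K" and g: "hermitian_metric K g"
  shows "hermitian_metric (cover K) (cover_metric K g)"
proof (rule hermitian_metricI[OF complex_manifold_cover[OF K]])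
  fix e assume "e \<in> atlas (cover K)"
  then obtain c where e: "e = prod_chart c punctured_chart" and c: "c \<in> atlas K" unfolding atlas_cover by blast
  have im: "vfst x \<in> cmap_image c" "vsnd x \<in> - {0}" if "x \<in> cmap_image e" for x
    using that unfolding e cmap_image_prod_chart cmap_punctured(1) by auto
  note eq = coord_form_cover_metric[OF K c, of _ g, folded e]
  show "hermitian_form (coord_form (cover K) (cover_metric K g) e x)" if x: "x \<in> cmap_image e" for x
  proof -
    have "coord_form (cover K) (cover_metric K g) e x = sum_form (coord_form K g c) hopf_metric x"
      by (intro ext) (rule eq[OF x])
    then show ?thesis
      using hermitian_form_sum_form[where B="coord_form K g c", OF hermitian_form_coord_form[OF K g c im(1)[OF x]]] im(2)[OF x]
      by simp
  qed
  have op: "open (cmap_image e)"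
    by (rule complex_manifoldD(5)[OF complex_manifold_cover[OF K] \<open>e \<in> atlas (cover K)\<close>])
  show "smooth_on (cmap_image e) (\<lambda>x. coord_form (cover K) (cover_metric K g) e x u v)" for u v
  proof (rule smooth_on_cong[OF op])
    have gs: "smooth_on (cmap_image c) (\<lambda>z. coord_form K g c z a b)" for a b
      using g c unfolding hermitian_metric_def by blast
    show "smooth_on (cmap_image e) (\<lambda>x. sum_form (coord_form K g c) hopf_metric x u v)"
      unfolding sum_form_def
      by (rule smooth_on_add[OF op smooth_on_vfst[OF op complex_manifoldD(5)[OF K c] _ gs]
            smooth_on_vsnd[OF op _ _ smooth_on_hopf_metric]])
         (use im in auto)
    show "sum_form (coord_form K g c) hopf_metric x u v = coord_form (cover K) (cover_metric K g) e x u v"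
      if "x \<in> cmap_image e" for x by (rule eq[OF that, symmetric])
  qed
qed

text \<open>The chart \<open>C\<close> of the mapping torus lies over the chart \<open>c\<close> of \<open>K\<close>, and in it the torus metric is visibly the
direct sum of \<open>g\<close> and the Hopf metric.  This is all that is needed of \<open>C\<close> in what follows.\<close>

definition chart_over ::
  "('a, 'n::finite) cmfd \<Rightarrow> ('a, 'n) bilin_field \<Rightarrow> ('a \<Rightarrow> 'a) \<Rightarrow>
     ('a torus_point, 'n + 2) chart \<Rightarrow> ('a, 'n) chart \<Rightarrow> bool" where
  "chart_over K g \<psi> C c \<longleftrightarrow> c \<in> atlas K \<and>
     cmap_image C \<subseteq> {x. vfst x \<in> cmap_image c \<and> vsnd x \<in> - {0}} \<and>
     (\<forall>x\<in>cmap_image C. \<forall>u v. coord_form (torus_manifold K \<psi>) (torus_metric K g \<psi>) C x u v =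
        sum_form (coord_form K g c) hopf_metric x u v)"

lemma chart_overD:
  assumes "chart_over K g \<psi> C c"
  shows "c \<in> atlas K" "x \<in> cmap_image C \<Longrightarrow> vfst x \<in> cmap_image c" "x \<in> cmap_image C \<Longrightarrow> vsnd x \<noteq> 0"
    "x \<in> cmap_image C \<Longrightarrow> coord_form (torus_manifold K \<psi>) (torus_metric K g \<psi>) C x u v =
        sum_form (coord_form K g c) hopf_metric x u v"
  using assms unfolding chart_over_def by blast+

lemma torus_hermitian_manifold:
  assumes K: "complex_manifold K" and g: "hermitian_metric K g" and \<psi>: "kaehler_isometry K g \<psi>"
  shows "complex_manifold (torus_manifold K \<psi>)" "hermitian_metric (torus_manifold K \<psi>) (torus_metric K g \<psi>)"
proof -
  interpret deck_group "cover K" "torus_space K \<psi>" "deck K \<psi>" log_norm "torus_cover K \<psi>"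
    by (rule deck_group_torus[OF K \<psi>])
  show "complex_manifold (torus_manifold K \<psi>)"
    unfolding torus_manifold_def by (rule complex_manifold_N)
  show "hermitian_metric (torus_manifold K \<psi>) (torus_metric K g \<psi>)"
    unfolding torus_manifold_def torus_metric_def
    by (rule hermitian_metric_induced[OF hermitian_metric_cover[OF K g] pullback_deck_cover_metric[OF K \<psi>]])
qed

lemma chart_over_lifted_chart:
  assumes K: "complex_manifold K" and \<psi>: "kaehler_isometry K g \<psi>" and c: "c \<in> atlas K"
    and W: "deck_group.liftable (cover K) (torus_cover K \<psi>) W (prod_chart c punctured_chart)"
  shows "chart_over K g \<psi> (deck_group.lifted_chart (torus_cover K \<psi>) W (prod_chart c punctured_chart)) c"
proof -
  interpret deck_group "cover K" "torus_space K \<psi>" "deck K \<psi>" log_norm "torus_cover K \<psi>"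
    by (rule deck_group_torus[OF K \<psi>])
  let ?e = "prod_chart c punctured_chart"
  let ?C = "lifted_chart W ?e"
  note im = cmap_image_lifted_chart[OF W]
  have sub: "cmap_image ?C \<subseteq> cmap_image ?e"
    unfolding im cmap_image_def[of ?e] by (rule image_mono[OF liftableD(2)[OF W]])
  have "coord_form (torus_manifold K \<psi>) (torus_metric K g \<psi>) ?C x u v = sum_form (coord_form K g c) hopf_metric x u v"
    if x: "x \<in> cmap_image ?C" for x u v
  proof -
    have "coord_form (torus_manifold K \<psi>) (torus_metric K g \<psi>) ?C x u v = coord_form (cover K) (cover_metric K g) ?e x u v"
      unfolding torus_manifold_def torus_metric_def
      by (rule coord_form_induced_metric[OF pullback_deck_cover_metric[OF K \<psi>] W x[unfolded im]])
    also have "\<dots> = sum_form (coord_form K g c) hopf_metric x u v"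
      by (rule coord_form_cover_metric[OF K c]) (use x sub in blast)
    finally show ?thesis .
  qed
  moreover have "cmap_image ?e = {x. vfst x \<in> cmap_image c \<and> vsnd x \<in> - {0}}"
    unfolding cmap_image_prod_chart cmap_punctured(1) ..
  ultimately show ?thesis unfolding chart_over_def using c sub by simp
qed

lemma chart_over_exists:
  assumes K: "complex_manifold K" and \<psi>: "kaehler_isometry K g \<psi>"
    and C: "C \<in> atlas (torus_manifold K \<psi>)"
  shows "\<exists>c. chart_over K g \<psi> C c"
proof -
  interpret deck_group "cover K" "torus_space K \<psi>" "deck K \<psi>" log_norm "torus_cover K \<psi>"
    by (rule deck_group_torus[OF K \<psi>])
  obtain W e where C': "C = lifted_chart W e" and W: "liftable W e"
    using C unfolding torus_manifold_def atlas_N by blast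
  obtain c where e: "e = prod_chart c punctured_chart" and c: "c \<in> atlas K"
    using liftableD(1)[OF W] unfolding atlas_cover by blast
  show ?thesis
    using chart_over_lifted_chart[OF K \<psi> c W[unfolded e]] unfolding C' e by blast
qed

text \<open>Every chart domain of \<open>K\<close> is covered by charts of the mapping torus, so that curvature can be
  pushed down from the torus to \<open>K\<close>.\<close>

lemma chart_over_surj:
  assumes K: "complex_manifold K" and \<psi>: "kaehler_isometry K g \<psi>"
    and c: "c \<in> atlas K" and z: "z \<in> cmap_image c"
  shows "\<exists>C x. C \<in> atlas (torus_manifold K \<psi>) \<and> chart_over K g \<psi> C c \<and> x \<in> cmap_image C \<and> vfst x = z"
proof -
  interpret deck_group "cover K" "torus_space K \<psi>" "deck K \<psi>" log_norm "torus_cover K \<psi>"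
    by (rule deck_group_torus[OF K \<psi>])
  let ?e = "prod_chart c punctured_chart"
  have e: "?e \<in> atlas (cover K)" unfolding atlas_cover using c by blast
  \<comment> \<open>any nonzero vector can serve as the second component\<close>
  define y where "y = (cmap_inv c z, axis 1 1 :: complex ^ 2)"
  have y: "y \<in> fst ?e" using cmap_inv_in[OF z] by (simp add: y_def fst_prod_chart axis_eq_0_iff)
  have yX: "y \<in> topspace (mtop (cover K))" using chart_subset_topspace[OF M e] y by blast
  define W where "W = fst ?e \<inter> strip y"
  have W: "liftable W ?e" unfolding W_def by (rule liftable_strip[OF e])
  have yW: "y \<in> W" using y yX by (simp add: W_def strip_def)
  have "snd ?e y \<in> cmap_image (lifted_chart W ?e)"
    unfolding cmap_image_lifted_chart[OF W] using yW by blast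
  moreover have "vfst (snd ?e y) = z" using cmap_inv_right[OF z] by (simp add: snd_prod_chart y_def)
  moreover have "lifted_chart W ?e \<in> atlas (torus_manifold K \<psi>)"
    unfolding torus_manifold_def atlas_N using W by blast
  ultimately show ?thesis using chart_over_lifted_chart[OF K \<psi> c W] by blast
qed

section \<open>The Bismut connection of the mapping torus\<close>

locale kaehler_torus =
  fixes K :: "('a, 'n::finite) cmfd" and g :: "('a, 'n) bilin_field" and \<psi> :: "'a \<Rightarrow> 'a"
    and \<Gamma> :: "('a, 'n) christoffel"
  assumes kaehler: "kaehler_manifold K g" and isometry: "kaehler_isometry K g \<psi>"
    and lc: "levi_civita K g \<Gamma>"
begin

abbreviation "T \<equiv> torus_manifold K \<psi>"
abbreviation "h \<equiv> torus_metric K g \<psi>"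
abbreviation "G c \<equiv> sum_connection (\<Gamma> c) hopf_connection"

lemma base_manifold: "complex_manifold K" and base_metric: "hermitian_metric K g"
  using kaehler by (auto simp: kaehler_manifold_def hermitian_manifold_def)

lemma torus_manifold: "complex_manifold T" and torus_metric: "hermitian_metric T h"
  by (rule torus_hermitian_manifold[OF base_manifold base_metric isometry])+

lemma open_T: "C \<in> atlas T \<Longrightarrow> open (cmap_image C)"
  by (rule complex_manifoldD(5)[OF torus_manifold])

lemma \<Gamma>_bilinear: "c \<in> atlas K \<Longrightarrow> z \<in> cmap_image c \<Longrightarrow> bilinear (\<Gamma> c z)"
  and \<Gamma>_smooth: "c \<in> atlas K \<Longrightarrow> smooth_on (cmap_image c) (\<lambda>z. \<Gamma> c z u v)"
  using lc unfolding levi_civita_def affine_connection_def by blast+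

lemma \<Gamma>_metric: "metric_connection K g \<Gamma>"
  using lc by (simp add: levi_civita_def)

lemma \<Gamma>_symmetric:
  assumes "c \<in> atlas K" "z \<in> cmap_image c"
  shows "\<Gamma> c z u v = \<Gamma> c z v u"
proof -
  have "torsion \<Gamma> c z u v = 0" using lc assms unfolding levi_civita_def by blast
  then show ?thesis by (simp add: torsion_eq)
qed

lemma \<Gamma>_imult: "c \<in> atlas K \<Longrightarrow> z \<in> cmap_image c \<Longrightarrow> \<Gamma> c z u (imult v) = imult (\<Gamma> c z u v)"
  by (rule levi_civita_complex[OF kaehler lc])

lemma \<Gamma>_differentiable: "c \<in> atlas K \<Longrightarrow> z \<in> cmap_image c \<Longrightarrow> (\<lambda>z. \<Gamma> c z u v) differentiable (at z)"
  by (rule smooth_on_imp_differentiable[OF \<Gamma>_smooth])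

lemma hopf_differentiable:
  assumes "x \<noteq> 0"
  shows "(\<lambda>x. hopf_metric x u v) differentiable (at x)" "(\<lambda>x. hopf_connection x u v) differentiable (at x)"
  by (rule smooth_on_imp_differentiable[OF smooth_on_hopf_metric], use assms in simp)
     (rule smooth_on_imp_differentiable[OF smooth_on_hopf_connection], use assms in simp)

lemma sum_metric:
  assumes C: "C \<in> atlas T" and over: "chart_over K g \<psi> C c" and x: "x \<in> cmap_image C"
  shows "frechet_derivative (\<lambda>y. coord_form T h C y v w) (at x) u =
    coord_form T h C x (G c x u v) w + coord_form T h C x v (G c x u w)"
proof -
  note c = chart_overD(1)[OF over] and z = chart_overD(2)[OF over x] and nz = chart_overD(3)[OF over x]
  have "frechet_derivative (\<lambda>y. coord_form T h C y v w) (at x) =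
      frechet_derivative (\<lambda>y. sum_form (coord_form K g c) hopf_metric y v w) (at x)"
    by (rule frechet_derivative_cong_open[OF open_T[OF C] x]) (rule chart_overD(4)[OF over])
  then show ?thesis
    using frechet_derivative_sum_form[where B="coord_form K g c" and C=hopf_metric,
        OF hermitian_metric_differentiable[OF base_metric c z] hopf_differentiable(1)[OF nz], of v w u]
      metric_connectionD[OF \<Gamma>_metric c z, of "vfst v" "vfst w" "vfst u"]
      hopf_metric_compatible[OF nz, of "vsnd v" "vsnd w" "vsnd u"]
    by (simp add: chart_overD(4)[OF over x] sum_form_def sum_connection_def)
qed

lemma sum_complex:
  assumes over: "chart_over K g \<psi> C c" and x: "x \<in> cmap_image C"
  shows "G c x u (imult v) = imult (G c x u v)"
  using \<Gamma>_imult[OF chart_overD(1)[OF over] chart_overD(2)[OF over x]] hopf_connection_imult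
  by (simp only: sum_connection_def vproj_imult vec_join_imult)

lemma sum_skew:
  assumes over: "chart_over K g \<psi> C c" and x: "x \<in> cmap_image C"
  shows "coord_form T h C x (G c x u v - G c x v u) w = - coord_form T h C x (G c x u w - G c x w u) v"
proof -
  note c = chart_overD(1)[OF over] and z = chart_overD(2)[OF over x]
  have "coord_form T h C x (G c x u v - G c x v u) w =
      hopf_metric (vsnd x) (hopf_connection (vsnd x) (vsnd u) (vsnd v) - hopf_connection (vsnd x) (vsnd v) (vsnd u)) (vsnd w)"
    for v w
    using \<Gamma>_symmetric[OF c z, of "vfst u" "vfst v"] bilinear_lzero[OF hermitian_formD(1)[OF hermitian_form_coord_form[OF base_manifold base_metric c z]]]
    by (simp add: chart_overD(4)[OF over x] sum_form_def sum_connection_def vec_join_diff)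
  then show ?thesis using hopf_connection_skew_torsion[of "vsnd x" "vsnd u" "vsnd v" "vsnd w"] by simp
qed

text \<open>The chart \<open>c\<close> is an arbitrary chart of \<open>K\<close> below \<open>C\<close>: whichever one is used to write down the sum, the Bismut
connection agrees with it.\<close>

lemma bismut_eq_sum:
  assumes B: "bismut_connection T h \<Delta>" and C: "C \<in> atlas T" and over: "chart_over K g \<psi> C c"
    and x: "x \<in> cmap_image C"
  shows "\<Delta> C x u v = G c x u v"
proof (rule bismut_unique[where G="G c x", OF torus_manifold torus_metric C x])
  show "metric_connection T h \<Delta>" "complex_connection T \<Delta>" "skew_torsion T h \<Delta>"
    using B by (simp_all add: bismut_connection_def)
qed (rule sum_metric[OF C over x] sum_complex[OF over x] sum_skew[OF over x])+

lemma sum_bilinear: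
  assumes over: "chart_over K g \<psi> C c" and x: "x \<in> cmap_image C"
  shows "bilinear (G c x)"
  by (rule bilinear_sum_connection[where G="\<Gamma> c", OF \<Gamma>_bilinear[OF chart_overD(1)[OF over] chart_overD(2)[OF over x]]
        bilinear_hopf_connection])

lemma sum_smooth:
  assumes C: "C \<in> atlas T" and over: "chart_over K g \<psi> C c"
  shows "smooth_on (cmap_image C) (\<lambda>x. G c x u v)"
  unfolding sum_connection_def
  by (rule smooth_on_vec_join[OF open_T[OF C]
        smooth_on_vfst[OF open_T[OF C] complex_manifoldD(5)[OF base_manifold chart_overD(1)[OF over]] _ \<Gamma>_smooth[OF chart_overD(1)[OF over]]]
        smooth_on_vsnd[OF open_T[OF C] _ _ smooth_on_hopf_connection]])
     (use chart_overD(2,3)[OF over] in auto)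

text \<open>A connection is a function of the chart alone, but the same chart of the torus can lie over several charts
of \<open>K\<close>, one of which has to be chosen.\<close>

definition base_chart :: "('a torus_point, 'n + 2) chart \<Rightarrow> ('a, 'n) chart" where
  "base_chart C = (SOME c. chart_over K g \<psi> C c)"

definition torus_connection :: "('a torus_point, 'n + 2) christoffel" where
  "torus_connection C = G (base_chart C)"

lemma base_chart: "C \<in> atlas T \<Longrightarrow> chart_over K g \<psi> C (base_chart C)"
  unfolding base_chart_def by (rule someI_ex[OF chart_over_exists[OF base_manifold isometry]])

lemma bismut_torus_connection: "bismut_connection T h torus_connection"
proof -
  have m: "metric_connection T h torus_connection"
    unfolding metric_connection_def cov_deriv_const torus_connection_def
    by (intro ballI allI sum_metric base_chart)
  have j: "complex_connection T torus_connection"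
    unfolding complex_connection_def cov_deriv_const torus_connection_def
    by (intro ballI allI sum_complex[OF base_chart])
  have s: "skew_torsion T h torus_connection"
    unfolding skew_torsion_def torsion_eq torus_connection_def
    by (intro ballI allI sum_skew[OF base_chart])
  have "affine_connection T torus_connection"
    unfolding affine_connection_def Let_def
  proof (intro conjI ballI allI)
    fix C assume C: "C \<in> atlas T"
    show "bilinear (torus_connection C x)" if "x \<in> cmap_image C" for x
      unfolding torus_connection_def by (rule sum_bilinear[OF base_chart[OF C] that])
    show "smooth_on (cmap_image C) (\<lambda>x. torus_connection C x u v)" for u v
      unfolding torus_connection_def by (rule sum_smooth[OF C base_chart[OF C]])
  next
    fix C D x u v assume "C \<in> atlas T" "D \<in> atlas T" "x \<in> snd C ` (fst C \<inter> fst D)"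
    then show "frechet_derivative (snd D \<circ> cmap_inv C) (at x) (torus_connection C x u v) =
      frechet_derivative (\<lambda>y. frechet_derivative (snd D \<circ> cmap_inv C) (at y) v) (at x) u +
      torus_connection D ((snd D \<circ> cmap_inv C) x) (frechet_derivative (snd D \<circ> cmap_inv C) (at x) u)
        (frechet_derivative (snd D \<circ> cmap_inv C) (at x) v)"
      by (rule bismut_transformation[OF torus_manifold torus_metric m j s])
  qed
  then show ?thesis using m j s by (simp add: bismut_connection_def)
qed

lemma sum_curvature:
  assumes over: "chart_over K g \<psi> C c" and x: "x \<in> cmap_image C"
  shows "coord_curvature (G c) x u v w =
    vec_join (coord_curvature (\<Gamma> c) (vfst x) (vfst u) (vfst v) (vfst w)) 0"
  using coord_curvature_sum_connection[where G="\<Gamma> c" and H=hopf_connection,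
      OF \<Gamma>_differentiable[OF chart_overD(1)[OF over] chart_overD(2)[OF over x]]
        hopf_differentiable(2)[OF chart_overD(3)[OF over x]], of u v w]
    hopf_connection_flat[OF chart_overD(3)[OF over x]] by simp

text \<open>The Kaehler form is closed, so the fundamental form of the Hopf metric alone contributes to \<open>d\<^sup>c\<omega>\<close>.\<close>

lemma torus_skt: "skt_manifold T h"
  unfolding skt_manifold_def hermitian_manifold_def
proof (intro conjI torus_manifold torus_metric ballI allI)
  fix C x a u v w assume C: "C \<in> atlas T" and x: "x \<in> cmap_image C"
  define c where "c = base_chart C"
  have over: "chart_over K g \<psi> C c" unfolding c_def by (rule base_chart[OF C])
  note c = chart_overD(1)[OF over]
  define \<omega> where "\<omega> z a b = hopf_metric z (imult a) b" for z a b
  define H where "H z a b e = 2 * inverse (z \<bullet> z) ^ 2 * hopf_torsion_form z a b e" for z a b e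
  have dc: "dc_fundamental_form T h C y u v w = H (vsnd y) (vsnd u) (vsnd v) (vsnd w)"
    if y: "y \<in> cmap_image C" for y u v w
  proof -
    note z = chart_overD(2)[OF over y] and nz = chart_overD(3)[OF over y]
    have 1: "ext_d2 (fundamental_form T h C) y a b e = ext_d2 (sum_form (fundamental_form K g c) \<omega>) y a b e" for a b e
      by (rule ext_d2_cong[OF open_T[OF C] y])
         (simp add: fundamental_form_def chart_overD(4)[OF over] sum_form_def \<omega>_def vproj_imult)
    have 2: "ext_d2 (sum_form (fundamental_form K g c) \<omega>) y a b e =
        ext_d2 (fundamental_form K g c) (vfst y) (vfst a) (vfst b) (vfst e) + ext_d2 \<omega> (vsnd y) (vsnd a) (vsnd b) (vsnd e)"
      for a b e
    proof (rule ext_d2_sum_form)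
      show "(\<lambda>x. fundamental_form K g c x u v) differentiable (at (vfst y))" for u v
        unfolding fundamental_form_def by (rule hermitian_metric_differentiable[OF base_metric c z])
      show "(\<lambda>x. \<omega> x u v) differentiable (at (vsnd y))" for u v
        unfolding \<omega>_def by (rule hopf_differentiable(1)[OF nz])
    qed
    have 3: "ext_d2 (fundamental_form K g c) (vfst y) a b e = 0" for a b e
      using kaehler c z unfolding kaehler_manifold_def by blast
    have "ext_d2 (fundamental_form T h C) y a b e = ext_d2 \<omega> (vsnd y) (vsnd a) (vsnd b) (vsnd e)" for a b e
      by (simp only: 1 2 3 add_0)
    then show ?thesis
      using hopf_dc[OF nz] by (simp add: dc_fundamental_form_def \<omega>_def[abs_def] H_def vproj_imult)
  qed
  have "ext_d3 (dc_fundamental_form T h C) x a u v w =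
      ext_d3 (\<lambda>y u v w. H (vsnd y) (vsnd u) (vsnd v) (vsnd w)) x a u v w"
    by (rule ext_d3_cong[OF open_T[OF C] x]) (rule dc)
  also have "\<dots> = ext_d3 H (vsnd x) (vsnd a) (vsnd u) (vsnd v) (vsnd w)"
  proof (rule ext_d3_vsnd)
    fix u v w
    have "(\<lambda>x. inverse (x \<bullet> x)) differentiable (at (vsnd x))"
      using has_derivative_inverse_sqnorm[OF chart_overD(3)[OF over x]] by (auto simp: differentiable_def)
    moreover have "(\<lambda>x. hopf_torsion_form x u v w) differentiable (at (vsnd x))"
      unfolding differentiable_def using linear_imp_has_derivative[OF hopf_torsion_form_linear] by blast
    ultimately show "(\<lambda>x. H x u v w) differentiable (at (vsnd x))"
      unfolding H_def by (intro differentiable_mult differentiable_power differentiable_const)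
  qed
  also have "\<dots> = 0" unfolding H_def[abs_def] by (rule hopf_skt[OF chart_overD(3)[OF over x]])
  finally show "ext_d3 (dc_fundamental_form T h C) x a u v w = 0" .
qed

text \<open>The curvature endomorphism factors through the projection to the first summand, and the cyclic property moves
its trace to \<open>K\<close>.\<close>

lemma torus_cyt:
  assumes ricci: "\<And>c z v w. c \<in> atlas K \<Longrightarrow> z \<in> cmap_image c \<Longrightarrow> ricci \<Gamma> c z v w = 0"
  shows "cyt T h"
  unfolding cyt_def
proof (intro exI conjI ballI allI impI)
  show "bismut_connection T h torus_connection" by (rule bismut_torus_connection)
  fix C x E and u v :: "complex ^ ('n + 2)"
  assume C: "C \<in> atlas T" and x: "x \<in> cmap_image C"
    and E: "orthonormal_frame (coord_form T h C x) E"
  define c where "c = base_chart C"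
  have over: "chart_over K g \<psi> C c" unfolding c_def by (rule base_chart[OF C])
  note c = chart_overD(1)[OF over] and z = chart_overD(2)[OF over x]
  note op = complex_manifoldD(5)[OF base_manifold c]
  let ?A = "\<lambda>w. coord_curvature (\<Gamma> c) (vfst x) (vfst u) (vfst v) (imult w)"
  have curv: "curvature torus_connection C x u v (imult w) = vec_join (?A (vfst w)) 0" for w
    by (simp only: curvature_eq torus_connection_def c_def[symmetric] sum_curvature[OF over x] vproj_imult)
  have linA: "linear ?A"
    using linear_compose[OF linear_imult coord_curvature_linear_last[where G="\<Gamma> c", OF op z \<Gamma>_bilinear[OF c] \<Gamma>_differentiable[OF c z]]]
    by (simp add: o_def)
  have lin1: "linear (\<lambda>a. vec_join (?A a) (0 :: complex ^ 2))" using linear_compose[OF linA linear_inl] by (simp add: o_def)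
  have lin2: "linear (\<lambda>w :: complex ^ ('n + 2). vec_join (?A (vfst w)) (0 :: complex ^ 2))" using linear_compose[OF linear_vfst lin1] by (simp add: o_def)
  have "(\<Sum>e\<in>E. coord_form T h C x (vec_join (?A (vfst e)) 0) e) = lin_trace (\<lambda>w :: complex ^ ('n + 2). vec_join (?A (vfst w)) (0 :: complex ^ 2))"
    by (rule lin_trace_orthonormal_frame[where L="\<lambda>w. vec_join (?A (vfst w)) 0", OF hermitian_formD(1)[OF hermitian_form_coord_form[OF torus_manifold torus_metric C x]] E lin2])
  also have "\<dots> = lin_trace ?A"
    using lin_trace_cyclic[OF linear_vfst lin1] by simp
  also have "\<dots> = 0"
  proof (rule trace_complex_curvature_zero[where G="\<Gamma> c", OF op z \<Gamma>_bilinear[OF c] \<Gamma>_differentiable[OF c z]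
        \<Gamma>_symmetric[OF c] \<Gamma>_imult[OF c]])
    show "lin_trace (\<lambda>u. coord_curvature (\<Gamma> c) (vfst x) u v w) = 0" for v w
      using ricci[OF c z, of v w] by (simp add: ricci_def lin_trace_def curvature_eq)
  qed
  finally show "bismut_ricci_form T h torus_connection C x E u v = 0"
    unfolding bismut_ricci_form_def curv by simp
qed

lemma torus_flat_imp_flat:
  assumes "bismut_flat T h"
  shows "flat_connection K \<Gamma>"
  unfolding flat_connection_def
proof (intro ballI allI)
  fix c z and u v w :: "complex ^ 'n"
  assume c: "c \<in> atlas K" and z: "z \<in> cmap_image c"
  obtain \<Delta> where B: "bismut_connection T h \<Delta>" and flat: "flat_connection T \<Delta>"
    using assms unfolding bismut_flat_def by blast
  obtain C x where C: "C \<in> atlas T" and over: "chart_over K g \<psi> C c" and x: "x \<in> cmap_image C" "vfst x = z"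
    using chart_over_surj[OF base_manifold isometry c z] by blast
  let ?u = "vec_join u (0 :: complex ^ 2)" and ?v = "vec_join v (0 :: complex ^ 2)"
    and ?w = "vec_join w (0 :: complex ^ 2)"
  have "0 = coord_curvature (\<Delta> C) x ?u ?v ?w"
    using flat C x(1) unfolding flat_connection_def curvature_eq by simp
  also have "\<dots> = coord_curvature (G c) x ?u ?v ?w"
    by (rule coord_curvature_cong[OF open_T[OF C] x(1)]) (rule bismut_eq_sum[OF B C over])
  also have "\<dots> = vec_join (coord_curvature (\<Gamma> c) z u v w) 0"
    by (simp add: sum_curvature[OF over x(1)] x(2))
  finally have "vfst (vec_join (coord_curvature (\<Gamma> c) z u v w) (0 :: complex ^ 2)) = 0"
    by (simp add: linear_0[OF linear_vfst])
  then show "curvature \<Gamma> c z u v w = 0" by (simp add: curvature_eq)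
qed

end

theorem proposition3p3:
  fixes K :: "('a, 'n::finite) cmfd"
    and g :: "('a, 'n) bilin_field"
    and \<psi> :: "'a \<Rightarrow> 'a"
  assumes "kaehler_manifold K g"
    and "compact_space (mtop K)"
    and "kaehler_isometry K g \<psi>"
    and "ricci_flat K g"
    and "\<not> flat_metric K g"
  shows "skt_manifold (torus_manifold K \<psi>) (torus_metric K g \<psi>) \<and>
    cyt (torus_manifold K \<psi>) (torus_metric K g \<psi>) \<and>
    \<not> bismut_flat (torus_manifold K \<psi>) (torus_metric K g \<psi>)"
proof -
  obtain \<Gamma> where lc: "levi_civita K g \<Gamma>"
    and ricci: "\<And>c x v w. c \<in> atlas K \<Longrightarrow> x \<in> cmap_image c \<Longrightarrow> ricci \<Gamma> c x v w = 0"
    using assms(4) unfolding ricci_flat_def by blast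
  interpret kaehler_torus K g \<psi> \<Gamma>
    by (rule kaehler_torus.intro[OF assms(1,3) lc])
  have "\<not> bismut_flat T h"
    using torus_flat_imp_flat lc assms(5) unfolding flat_metric_def by blast
  then show ?thesis using torus_skt torus_cyt[OF ricci] by blast
qed


end
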